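(* Steiner Tree parameterized by the number of terminals admits a PSAKS.
   Context: In Steiner Tree the input is a graph $G$, a terminal set $R\subseteq V(G)$ and a weight function $w:E(G)\to\mathbb{N}$; a Steiner tree is a subtree $T$ of $G$ with $R\subseteq V(T)$, of cost $w(T)=\sum_{e\in E(T)}w(e)$, and the goal is minimum cost. As a parameterized minimization problem: $ST((G,R),k',T)=-\infty$ if $|R|>k'$, $\infty$ if $T$ is not a Steiner tree for $R$, and $w(T)$ otherwise. A PSAKS (polynomial size approximate kernelization scheme) is a family, one for every $\alpha>1$, of $\alpha$-approximate kernels of size polynomial in the parameter: a polynomial-time reduction algorithm together with a polynomial-time solution lifting algorithm such that any $c$-approximate solution of the reduced instance is lifted to a solution whose ratio to the optimum of the original instance is at most $\alpha$ times the ratio of the given solution to the optimum of the reduced instance. *)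

theory Defs
  imports
    "HOL-Library.Extended_Real"
    "HOL-Computational_Algebra.Polynomial"
begin

section \<open>Computation model\<close>

text \<open>
  Binary trees (S-expressions) play the role of the words over a fixed finite alphabet. The
  length of the word represented by \<open>x\<close> is \<open>size x\<close>, the number of its inner nodes: writing a
  tree in preorder with one symbol per node and per leaf gives a word of length \<open>2 * size x + 1\<close>.
\<close>

datatype data = Leaf | Node (left: data) (right: data)
  where "left Leaf = Leaf" | "right Leaf = Leaf"

text \<open>
  Programs are the WHILE programs over binary trees of Jones (Computability and Complexity),
  in variable-free form: a program transforms one tree, and several variables are kept in a tuple.
  The empty tree is false, every other tree is true.

  The cost is not uniform: each step is charged the size of the data it copies or
  writes. So the cost bounds the size of the result, a Turing machine simulates a run in time
  polynomial in its cost, and one Turing machine step is a program of cost linear in the size of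
  the configuration. Polynomial cost is therefore polynomial time.
\<close>

datatype prog =
    PId
  | PConst data
  | PLeft
  | PRight
  | PFork prog prog
  | PSeq prog prog
  | PIf prog prog prog
  | PWhile prog prog

inductive exec :: "prog \<Rightarrow> data \<Rightarrow> nat \<Rightarrow> data \<Rightarrow> bool" where
  exec_Id: "exec PId x (1 + size x) x"
| exec_Const: "exec (PConst c) x (1 + size x + size c) c"
| exec_Left: "exec PLeft x (1 + size x) (left x)"
| exec_Right: "exec PRight x (1 + size x) (right x)"
| exec_Fork: "exec p x s y \<Longrightarrow> exec q x t z \<Longrightarrow>
    exec (PFork p q) x (1 + size x + s + t) (Node y z)"
| exec_Seq: "exec p x s y \<Longrightarrow> exec q y t z \<Longrightarrow> exec (PSeq p q) x (1 + s + t) z"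
| exec_If_true: "exec b x r c \<Longrightarrow> c \<noteq> Leaf \<Longrightarrow> exec p x s y \<Longrightarrow>
    exec (PIf b p q) x (1 + size x + r + s) y"
| exec_If_false: "exec b x r Leaf \<Longrightarrow> exec q x s y \<Longrightarrow>
    exec (PIf b p q) x (1 + size x + r + s) y"
| exec_While_true: "exec b x r c \<Longrightarrow> c \<noteq> Leaf \<Longrightarrow> exec p x s y \<Longrightarrow> exec (PWhile b p) y t z \<Longrightarrow>
    exec (PWhile b p) x (1 + size x + r + s + t) z"
| exec_While_false: "exec b x r Leaf \<Longrightarrow> exec (PWhile b p) x (1 + size x + r) x"

lemma exec_deterministic:
  "exec p x t y \<Longrightarrow> exec p x t' y' \<Longrightarrow> t' = t \<and> y' = y"
proof (induction arbitrary: t' y' rule: exec.induct)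
  case (exec_Fork p x s y q t z)
  from exec_Fork.prems show ?case by cases (auto dest: exec_Fork.IH)
next
  case (exec_Seq p x s y q t z)
  from exec_Seq.prems show ?case by cases (auto dest!: exec_Seq.IH)
next
  case (exec_If_true b x r c p s y q)
  from exec_If_true.prems show ?case
    by cases (use exec_If_true.hyps in \<open>auto dest!: exec_If_true.IH\<close>)
next
  case (exec_If_false b x r q s y p)
  from exec_If_false.prems show ?case by cases (auto dest!: exec_If_false.IH)
next
  case (exec_While_true b x r c p s y t z)
  from exec_While_true.prems show ?case
    by cases (use exec_While_true.hyps in \<open>auto dest!: exec_While_true.IH\<close>)
next
  case (exec_While_false b x r p)
  from exec_While_false.prems show ?case by cases (auto dest!: exec_While_false.IH)
qed (auto elim: exec.cases)

lemma exec_size_le: "exec p x t y \<Longrightarrow> size y \<le> t"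
proof (induction rule: exec.induct)
  case (exec_Left x) show ?case by (cases x) auto
next
  case (exec_Right x) show ?case by (cases x) auto
qed auto

definition poly_time_on :: "('a \<Rightarrow> data) \<Rightarrow> ('b \<Rightarrow> data) \<Rightarrow> 'a set \<Rightarrow> ('a \<Rightarrow> 'b) \<Rightarrow> bool" where
  "poly_time_on ea eb A f \<longleftrightarrow>
    (\<exists>P. \<exists>p :: nat poly. \<forall>a\<in>A. \<exists>t \<le> poly p (size (ea a)). exec P (ea a) t (eb (f a)))"


section \<open>Parameterized minimization problems and approximate kernels\<close>

text \<open>The value of a solution as a function of the instance, the parameter and the solution.\<close>

type_synonym min_problem = "data \<Rightarrow> nat \<Rightarrow> data \<Rightarrow> ereal"

text \<open>As usual, every word of length at most \<open>size I + k\<close> is a solution; infeasible ones have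
  value \<open>\<infinity>\<close>. There are finitely many, so the infimum below is a minimum.\<close>

definition solutions :: "data \<times> nat \<Rightarrow> data set" where
  "solutions = (\<lambda>(I, k). {s. size s \<le> size I + k})"

definition val :: "min_problem \<Rightarrow> data \<times> nat \<Rightarrow> data \<Rightarrow> ereal" where
  "val \<Pi> = (\<lambda>(I, k). \<Pi> I k)"

definition opt :: "min_problem \<Rightarrow> data \<times> nat \<Rightarrow> ereal" where
  "opt \<Pi> x = (INF s\<in>solutions x. val \<Pi> x s)"

text \<open>
  The quotient of a value \<open>v\<close> by an optimum \<open>m\<close>, with the conventions needed when \<open>m\<close> is \<open>0\<close> or
  infinite: an optimal solution has ratio \<open>1\<close>, and a non-optimal one has ratio \<open>\<infinity>\<close> (for \<open>m = 0\<close>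
  this is already the value of \<open>v / m\<close>). In \<^typ>\<open>ereal\<close>, \<open>0 / 0\<close> and \<open>\<infinity> / \<infinity>\<close> are \<open>0\<close>.
\<close>

definition approx_ratio :: "ereal \<Rightarrow> ereal \<Rightarrow> ereal" where
  "approx_ratio v m = (if v = m then 1 else if \<bar>m\<bar> = \<infinity> then \<infinity> else v / m)"

text \<open>The parameter is written in unary: running times are measured in \<open>size I + k\<close>.\<close>

fun unary :: "nat \<Rightarrow> data" where
  "unary 0 = Leaf"
| "unary (Suc n) = Node Leaf (unary n)"

definition enc_inst :: "data \<times> nat \<Rightarrow> data" where
  "enc_inst = (\<lambda>(I, k). Node I (unary k))"

definition enc_lift :: "(data \<times> nat) \<times> (data \<times> nat) \<times> data \<Rightarrow> data" where
  "enc_lift = (\<lambda>(x, x', s'). Node (enc_inst x) (Node (enc_inst x') s'))"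

definition approx_preprocessing :: "real \<Rightarrow> min_problem \<Rightarrow> (data \<times> nat \<Rightarrow> data \<times> nat) \<Rightarrow>
    ((data \<times> nat) \<times> (data \<times> nat) \<times> data \<Rightarrow> data) \<Rightarrow> bool" where
  "approx_preprocessing \<alpha> \<Pi> red lift \<longleftrightarrow>
    poly_time_on enc_inst enc_inst UNIV red \<and>
    poly_time_on enc_lift (\<lambda>s. s) {(x, x', s'). x' = red x \<and> s' \<in> solutions x'} lift \<and>
    (\<forall>x. \<forall>s' \<in> solutions (red x).
      lift (x, red x, s') \<in> solutions x \<and>
      approx_ratio (val \<Pi> x (lift (x, red x, s'))) (opt \<Pi> x)
        \<le> ereal \<alpha> * approx_ratio (val \<Pi> (red x) s') (opt \<Pi> (red x)))"

definition has_poly_approx_kernel :: "real \<Rightarrow> min_problem \<Rightarrow> bool" where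
  "has_poly_approx_kernel \<alpha> \<Pi> \<longleftrightarrow>
    (\<exists>red lift. approx_preprocessing \<alpha> \<Pi> red lift \<and>
      (\<exists>q :: nat poly. \<forall>I k. size (fst (red (I, k))) + snd (red (I, k)) \<le> poly q k))"

definition admits_PSAKS :: "min_problem \<Rightarrow> bool" where
  "admits_PSAKS \<Pi> \<longleftrightarrow> (\<forall>\<alpha>>1. has_poly_approx_kernel \<alpha> \<Pi>)"


section \<open>Steiner trees\<close>

text \<open>Finite simple undirected graphs, given by a vertex set and a set of two-element edges.\<close>

type_synonym 'v graph = "'v set \<times> 'v set set"

definition simple_graph :: "'v graph \<Rightarrow> bool" where
  "simple_graph = (\<lambda>(V, E). finite V \<and> (\<forall>e\<in>E. e \<subseteq> V \<and> card e = 2))"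

definition subgraph :: "'v graph \<Rightarrow> 'v graph \<Rightarrow> bool" where
  "subgraph H G \<longleftrightarrow> simple_graph H \<and> fst H \<subseteq> fst G \<and> snd H \<subseteq> snd G"

definition connected_graph :: "'v graph \<Rightarrow> bool" where
  "connected_graph = (\<lambda>(V, E). V \<noteq> {} \<and> (\<forall>u\<in>V. \<forall>v\<in>V. (u, v) \<in> {(x, y). {x, y} \<in> E}\<^sup>*))"

definition is_cycle :: "'v graph \<Rightarrow> 'v list \<Rightarrow> bool" where
  "is_cycle = (\<lambda>(V, E) c. 3 \<le> length c \<and> distinct c \<and>
    (\<forall>i<length c. {c ! i, c ! (Suc i mod length c)} \<in> E))"

definition is_tree :: "'v graph \<Rightarrow> bool" where
  "is_tree T \<longleftrightarrow> connected_graph T \<and> \<not> (\<exists>c. is_cycle T c)"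

definition is_steiner_tree :: "'v graph \<Rightarrow> 'v set \<Rightarrow> 'v graph \<Rightarrow> bool" where
  "is_steiner_tree G R T \<longleftrightarrow> subgraph T G \<and> is_tree T \<and> R \<subseteq> fst T"

definition ST :: "'v graph \<Rightarrow> 'v set \<Rightarrow> ('v set \<Rightarrow> nat) \<Rightarrow> nat \<Rightarrow> 'v graph \<Rightarrow> ereal" where
  "ST G R w k T =
    (if card R > k then -\<infinity>
     else if \<not> is_steiner_tree G R T then \<infinity>
     else ereal (real (\<Sum>e\<in>snd T. w e)))"


section \<open>Steiner Tree as a problem on encoded instances\<close>

text \<open>
  Trees are read as lists along their right spine, and as numbers in binary, least significant bit
  first. All readings are total; a number or a set may have several codes.
\<close>

fun to_list :: "data \<Rightarrow> data list" where
  "to_list Leaf = []"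
| "to_list (Node a d) = a # to_list d"

fun to_nat :: "data \<Rightarrow> nat" where
  "to_nat Leaf = 0"
| "to_nat (Node b d) = of_bool (b \<noteq> Leaf) + 2 * to_nat d"

definition to_nat_set :: "data \<Rightarrow> nat set" where
  "to_nat_set d = to_nat ` set (to_list d)"

definition to_edge :: "data \<Rightarrow> nat set" where
  "to_edge d = {to_nat (left d), to_nat (right d)}"

text \<open>An instance is a triple: vertices, terminals, and a list of edges with their weights.\<close>

definition inst_edges :: "data \<Rightarrow> (nat set \<times> nat) list" where
  "inst_edges I = map (\<lambda>d. (to_edge (left d), to_nat (right d))) (to_list (right (right I)))"

definition inst_graph :: "data \<Rightarrow> nat graph" where
  "inst_graph I = (to_nat_set (left I), fst ` set (inst_edges I))"

definition inst_terminals :: "data \<Rightarrow> nat set" where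
  "inst_terminals I = to_nat_set (left (right I))"

definition inst_weight :: "data \<Rightarrow> nat set \<Rightarrow> nat" where
  "inst_weight I e = the (map_of (inst_edges I) e)"

text \<open>No loops, all end points and terminals are vertices, and each edge is listed only once.\<close>

definition valid_inst :: "data \<Rightarrow> bool" where
  "valid_inst I \<longleftrightarrow> simple_graph (inst_graph I) \<and> inst_terminals I \<subseteq> fst (inst_graph I) \<and>
    distinct (map fst (inst_edges I))"

text \<open>
  A solution is a pair: the vertices and the edges of the tree. If these are copied without
  repetition from the code of the instance \<open>I\<close>, the result has size at most \<open>size I\<close>. So
  \<^const>\<open>solutions\<close> contains a code of every Steiner tree of the instance.
\<close>

definition sol_graph :: "data \<Rightarrow> nat graph" where
  "sol_graph s = (to_nat_set (left s), to_edge ` set (to_list (right s)))"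

text \<open>Words that do not encode an instance have no feasible solution.\<close>

definition steiner_tree_problem :: min_problem where
  "steiner_tree_problem I k s =
    (if valid_inst I
     then ST (inst_graph I) (inst_terminals I) (inst_weight I) k (sol_graph s)
     else \<infinity>)"

end

theory Submission
  imports Defs
begin

text \<open>
  Let \<open>d\<close> be the shortest path metric and \<open>R\<close> the set of terminals. Borchers and Du showed that an
  optimal Steiner tree can be cut into pieces which are binary trees of bounded depth \<open>s\<close> with terminals
  as leaves, such that optimal trees for the pieces still connect \<open>R\<close> and cost at most a factor
  \<open>1 + 2 / s\<close> more. There are polynomially many choices of the leaves of a piece, and for fixed \<open>s\<close> an
  optimal piece is found by brute force in polynomial time. The kernel is the complete graph on \<open>R\<close> and
  the inner nodes of one optimal piece for every choice. Its weights are the distances, rounded relative to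
  the sum of the distances from one terminal to all others, which exceeds the optimum at most by the factor
  \<open>card R\<close>. A solution is lifted by replacing each edge by a shortest path and taking a spanning tree.

  Polynomial time is established by closure properties of the class of functions on encoded types that
  are computed with polynomial cost; the central one is iteration over a list with a polynomial bound on
  the size of the accumulator.
\<close>


section \<open>Polynomial time functions between encoded types\<close>

text \<open>The size of the kernel may depend on \<open>k\<close> and \<open>s\<close> only, which
  forbids long weights as well as an unrestricted choice of Steiner vertices. For fixed
  \<open>s\<close> a piece has \<open>2 ^ s\<close> leaves, so at most
  \<open>length (terms x) ^ (2 ^ s)\<close> tuples of leaves have to be served, each from every
  terminal from which the piece may hang. Cutting exchanges an inner node for a terminal, and the
  path between the two is paid twice, once for the piece above and once for the piece below; this is
  the \<open>2\<close> in \<open>1 + 2 / s\<close>. Rounding costs another \<open>1 / s\<close>, so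
  any \<open>s\<close> with \<open>1 + 3 / s \<le> \<alpha>\<close> works. Two conventions shape the
  rest: the code of a solution may not be longer than \<open>size I + k\<close>, and an instance
  without terminals still requires a vertex, so the kernel has the parameter \<open>k + 1\<close>.
  Whether a Steiner tree exists is never tested: without one, all solutions have the same value and
  hence ratio 1.\<close>

class enc =
  fixes enc :: "'a \<Rightarrow> data"

instantiation data :: enc
begin
definition enc_data :: "data \<Rightarrow> data" where [simp]: "enc_data x = x"
instance ..
end

instantiation bool :: enc
begin
definition enc_bool :: "bool \<Rightarrow> data" where "enc_bool b = (if b then Node Leaf Leaf else Leaf)"
instance ..
end

instantiation prod :: (enc, enc) enc
begin
definition enc_prod :: "'a \<times> 'b \<Rightarrow> data" where
  "enc_prod z = Node (enc (fst z)) (enc (snd z))"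
instance ..
end

instantiation list :: (enc) enc
begin
primrec enc_list :: "'a list \<Rightarrow> data" where
  "enc_list [] = Leaf"
| "enc_list (x # xs) = Node (enc x) (enc_list xs)"
instance ..
end

lemma enc_pair [simp]: "enc (a, b) = Node (enc a) (enc b)"
  by (simp add: enc_prod_def)

lemma enc_bool_simps [simp]: "enc True = Node Leaf Leaf" "enc False = Leaf"
  by (simp_all add: enc_bool_def)

lemma enc_bool_Leaf_iff [simp]: "enc b = Leaf \<longleftrightarrow> \<not> b"
  by (cases b) auto

section \<open>Polynomial bounds\<close>

lemma poly_mono_nat: "m \<le> n \<Longrightarrow> poly (p :: nat poly) m \<le> poly p n"
  by (induction p) (auto intro!: mult_mono)

text \<open>A bound is a function of the argument and not only of its size, so that costs may
  mention intermediate values; a polynomial is extracted only when needed.\<close>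

definition poly_bounded :: "('a::enc \<Rightarrow> nat) \<Rightarrow> bool" where
  "poly_bounded g \<longleftrightarrow> (\<exists>q :: nat poly. \<forall>x. g x \<le> poly q (size (enc x)))"

definition polytime :: "('a::enc \<Rightarrow> 'b::enc) \<Rightarrow> bool" where
  "polytime f \<longleftrightarrow> (\<exists>P g. poly_bounded g \<and> (\<forall>x. \<exists>t\<le>g x. exec P (enc x) t (enc (f x))))"

named_theorems poly_bounded_intros
named_theorems polytime_intros

lemma poly_bounded_le: "poly_bounded h \<Longrightarrow> (\<And>x. g x \<le> h x) \<Longrightarrow> poly_bounded g"
  unfolding poly_bounded_def by (meson order_trans)

lemma poly_bounded_const [poly_bounded_intros]: "poly_bounded (\<lambda>x. c)"
  unfolding poly_bounded_def by (rule exI[of _ "[:c:]"]) auto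

lemma poly_bounded_size_enc: "poly_bounded (\<lambda>x. size (enc x))"
  unfolding poly_bounded_def by (rule exI[of _ "[:0, 1:]"]) auto

lemma poly_bounded_add [poly_bounded_intros]: "poly_bounded f \<Longrightarrow> poly_bounded g \<Longrightarrow> poly_bounded (\<lambda>x. f x + g x)"
  unfolding poly_bounded_def
proof clarify
  fix p q :: "nat poly"
  assume "\<forall>x. f x \<le> poly p (size (enc x))" "\<forall>x. g x \<le> poly q (size (enc x))"
  then show "\<exists>q :: nat poly. \<forall>x. f x + g x \<le> poly q (size (enc x))"
    by (intro exI[of _ "p + q"]) (auto intro!: add_mono)
qed

lemma poly_bounded_mult [poly_bounded_intros]: "poly_bounded f \<Longrightarrow> poly_bounded g \<Longrightarrow> poly_bounded (\<lambda>x. f x * g x)"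
  unfolding poly_bounded_def
proof clarify
  fix p q :: "nat poly"
  assume "\<forall>x. f x \<le> poly p (size (enc x))" "\<forall>x. g x \<le> poly q (size (enc x))"
  then show "\<exists>q :: nat poly. \<forall>x. f x * g x \<le> poly q (size (enc x))"
    by (intro exI[of _ "p * q"]) (auto intro!: mult_mono)
qed

lemma poly_bounded_Suc [poly_bounded_intros]: "poly_bounded f \<Longrightarrow> poly_bounded (\<lambda>x. Suc (f x))"
  using poly_bounded_add[OF poly_bounded_const[of 1]] by fastforce

lemma poly_bounded_poly [poly_bounded_intros]: "poly_bounded f \<Longrightarrow> poly_bounded (\<lambda>x. poly q (f x))"
  unfolding poly_bounded_def
proof clarify
  fix p :: "nat poly"
  assume "\<forall>x. f x \<le> poly p (size (enc x))"
  \<comment> \<open>Natural coefficients make \<open>q\<close> monotone, so it may be applied to the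
    bound \<open>poly p\<close> of \<open>f x\<close>.\<close>
  then show "\<exists>q' :: nat poly. \<forall>x. poly q (f x) \<le> poly q' (size (enc x))"
    by (intro exI[of _ "pcompose q p"]) (auto simp: poly_pcompose intro!: poly_mono_nat)
qed

lemma poly_bounded_comp_size: "poly_bounded g \<Longrightarrow> poly_bounded (\<lambda>x. size (enc (f x))) \<Longrightarrow> poly_bounded (\<lambda>x. g (f x))"
proof -
  assume "poly_bounded g" and *: "poly_bounded (\<lambda>x. size (enc (f x)))"
  then obtain q :: "nat poly" where "\<And>y. g y \<le> poly q (size (enc y))" unfolding poly_bounded_def by blast
  with poly_bounded_poly[OF *] show ?thesis by (rule poly_bounded_le)
qed

section \<open>Closure properties: composition, pairs and case distinctions\<close>

lemmas exec_intros = exec.intros[simplified]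

lemma polytimeI: "poly_bounded g \<Longrightarrow> (\<And>x. \<exists>t\<le>g x. exec P (enc x) t (enc (f x))) \<Longrightarrow> polytime f"
  unfolding polytime_def by blast

lemma polytimeI_exec: "poly_bounded g \<Longrightarrow> (\<And>x. exec P (enc x) (g x) (enc (f x))) \<Longrightarrow> polytime f"
  unfolding polytime_def by blast

lemma polytimeE:
  assumes "polytime f"
  obtains P g where "poly_bounded g" "\<And>x. \<exists>t\<le>g x. exec P (enc x) t (enc (f x))"
  using assms unfolding polytime_def by blast

text \<open>Since writing is charged, the cost bounds the output. Composition depends on this: the
  second program runs on an input of size polynomial in the first.\<close>

lemma polytime_size: "polytime f \<Longrightarrow> poly_bounded (\<lambda>x. size (enc (f x)))"
proof (erule polytimeE)
  fix P g
  assume "poly_bounded g" "\<And>x. \<exists>t\<le>g x. exec P (enc x) t (enc (f x))"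
  then show ?thesis by (elim poly_bounded_le) (blast dest: exec_size_le order_trans)
qed

lemma poly_bounded_comp: "poly_bounded g \<Longrightarrow> polytime f \<Longrightarrow> poly_bounded (\<lambda>x. g (f x))"
  by (rule poly_bounded_comp_size[OF _ polytime_size])

text \<open>Programs see only codes, so conversions between types that keep the code are
  free.\<close>

lemma polytime_recode: "polytime f \<Longrightarrow> (\<And>x. enc (g x) = enc (f x)) \<Longrightarrow> polytime g"
  unfolding polytime_def by simp

lemma polytime_id [polytime_intros]: "polytime (\<lambda>x. x)"
  by (rule polytimeI_exec[of _ PId, OF _ exec_Id]) (intro poly_bounded_intros poly_bounded_size_enc)

lemma polytime_const [polytime_intros]: "polytime (\<lambda>x. c)"
  by (rule polytimeI_exec[of _ "PConst (enc c)", OF _ exec_Const]) (intro poly_bounded_intros poly_bounded_size_enc)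

lemma polytime_comp: "polytime f \<Longrightarrow> polytime g \<Longrightarrow> polytime (\<lambda>x. f (g x))"
proof -
  assume f: "polytime f" and g: "polytime g"
  obtain P p Q q where
    *: "poly_bounded p" "\<And>x. \<exists>t\<le>p x. exec P (enc x) t (enc (f x))"
    "poly_bounded q" "\<And>x. \<exists>t\<le>q x. exec Q (enc x) t (enc (g x))"
    by (rule polytimeE[OF f], rule polytimeE[OF g]) blast
  show ?thesis
  proof (rule polytimeI[of "\<lambda>x. 1 + q x + p (g x)" "PSeq Q P"])
    show "poly_bounded (\<lambda>x. 1 + q x + p (g x))"
      by (intro poly_bounded_intros * poly_bounded_comp g)
    show "\<exists>t\<le>1 + q x + p (g x). exec (PSeq Q P) (enc x) t (enc (f (g x)))" for x
    proof -
      obtain s t where "s \<le> q x" "exec Q (enc x) s (enc (g x))"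
        "t \<le> p (g x)" "exec P (enc (g x)) t (enc (f (g x)))" using * by meson
      then show ?thesis by (intro exI[of _ "1 + s + t"]) (auto intro: exec_intros)
    qed
  qed
qed

lemma polytime_fst [polytime_intros]:
  assumes "polytime f" shows "polytime (\<lambda>x. fst (f x))"
proof -
  have "polytime (fst :: 'b::enc \<times> 'c::enc \<Rightarrow> 'b)"
  proof (rule polytimeI_exec)
    show "exec PLeft (enc x) (1 + size (enc x)) (enc (fst x))" for x :: "'b \<times> 'c"
      using exec_Left[of "enc x"] by (simp add: enc_prod_def)
  qed (intro poly_bounded_intros poly_bounded_size_enc)
  from polytime_comp[OF this assms] show ?thesis .
qed

lemma polytime_snd [polytime_intros]:
  assumes "polytime f" shows "polytime (\<lambda>x. snd (f x))"
proof -
  have "polytime (snd :: 'b::enc \<times> 'c::enc \<Rightarrow> 'c)"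
  proof (rule polytimeI_exec)
    show "exec PRight (enc x) (1 + size (enc x)) (enc (snd x))" for x :: "'b \<times> 'c"
      using exec_Right[of "enc x"] by (simp add: enc_prod_def)
  qed (intro poly_bounded_intros poly_bounded_size_enc)
  from polytime_comp[OF this assms] show ?thesis .
qed

lemma polytime_left [polytime_intros]:
  assumes "polytime f" shows "polytime (\<lambda>x. left (f x))"
proof -
  have "polytime left"
  proof (rule polytimeI_exec)
    show "exec PLeft (enc x) (1 + size (enc x)) (enc (left x))" for x
      using exec_Left[of "enc x"] by simp
  qed (intro poly_bounded_intros poly_bounded_size_enc)
  from polytime_comp[OF this assms] show ?thesis .
qed

lemma polytime_right [polytime_intros]:
  assumes "polytime f" shows "polytime (\<lambda>x. right (f x))"
proof -
  have "polytime right"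
  proof (rule polytimeI_exec)
    show "exec PRight (enc x) (1 + size (enc x)) (enc (right x))" for x
      using exec_Right[of "enc x"] by simp
  qed (intro poly_bounded_intros poly_bounded_size_enc)
  from polytime_comp[OF this assms] show ?thesis .
qed

lemma polytime_Pair [polytime_intros]:
  assumes "polytime f" "polytime g" shows "polytime (\<lambda>x. (f x, g x))"
proof -
  obtain P p Q q where
    *: "poly_bounded p" "\<And>x. \<exists>t\<le>p x. exec P (enc x) t (enc (f x))"
    "poly_bounded q" "\<And>x. \<exists>t\<le>q x. exec Q (enc x) t (enc (g x))"
    by (rule polytimeE[OF assms(1)], rule polytimeE[OF assms(2)]) blast
  show ?thesis
  proof (rule polytimeI[of "\<lambda>x. 1 + size (enc x) + p x + q x" "PFork P Q"])
    show "poly_bounded (\<lambda>x. 1 + size (enc x) + p x + q x)"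
      by (intro poly_bounded_intros * poly_bounded_size_enc)
    show "\<exists>t\<le>1 + size (enc x) + p x + q x. exec (PFork P Q) (enc x) t (enc (f x, g x))" for x
    proof -
      obtain s t where "s \<le> p x" "exec P (enc x) s (enc (f x))"
        "t \<le> q x" "exec Q (enc x) t (enc (g x))" using * by meson
      then show ?thesis
        by (intro exI[of _ "1 + size (enc x) + s + t"]) (auto intro: exec_intros)
    qed
  qed
qed

lemma polytime_Node [polytime_intros]:
  assumes "polytime f" "polytime g" shows "polytime (\<lambda>x. Node (f x) (g x))"
  by (rule polytime_recode[OF polytime_Pair[OF assms]]) simp

lemma polytime_Cons [polytime_intros]:
  assumes "polytime f" "polytime g" shows "polytime (\<lambda>x. f x # g x)"
  by (rule polytime_recode[OF polytime_Pair[OF assms]]) simp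

lemma polytime_enc [polytime_intros]: "polytime f \<Longrightarrow> polytime (\<lambda>x. enc (f x))"
  by (erule polytime_recode) simp

lemma enc_to_list [simp]: "enc (to_list d) = d"
  by (induction d rule: to_list.induct) auto

lemma to_list_enc [simp]: "to_list (enc xs) = map enc xs"
  by (induction xs) auto

lemma polytime_to_list [polytime_intros]: "polytime f \<Longrightarrow> polytime (\<lambda>x. to_list (f x))"
  by (erule polytime_recode) simp

lemma polytime_Let [polytime_intros]:
  assumes "polytime f" "polytime (\<lambda>z. g (fst z) (snd z))"
  shows "polytime (\<lambda>x. let a = f x in g x a)"
  using polytime_comp[OF assms(2) polytime_Pair[OF polytime_id assms(1)]] by simp

text \<open>A nonempty list counts as true and has the code of the pair of its head and tail, so the
  list itself is the test and \<open>R\<close> runs directly on the code of \<open>(x, l x)\<close>.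
  The bound of \<open>R\<close> is turned into \<open>poly r'\<close> because \<open>y\<close> and
  \<open>ys\<close> exist only in one of the cases.\<close>

lemma polytime_case_list [polytime_intros]:
  assumes "polytime l" "polytime f" "polytime (\<lambda>z. g (fst z) (fst (snd z)) (snd (snd z)))"
  shows "polytime (\<lambda>x. case l x of [] \<Rightarrow> f x | y # ys \<Rightarrow> g x y ys)"
proof -
  obtain P p Q q R r S s where
    *: "poly_bounded p" "\<And>x. \<exists>t\<le>p x. exec P (enc x) t (enc (l x))"
    "poly_bounded q" "\<And>x. \<exists>t\<le>q x. exec Q (enc x) t (enc (f x))"
    "poly_bounded r" "\<And>x. \<exists>t\<le>r x. exec R (enc x) t (enc (g (fst x) (fst (snd x)) (snd (snd x))))"
    "poly_bounded s" "\<And>x. \<exists>t\<le>s x. exec S (enc x) t (enc (x, l x))"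
    by (rule polytimeE[OF assms(1)], rule polytimeE[OF assms(2)], rule polytimeE[OF assms(3)],
        rule polytimeE[OF polytime_Pair[OF polytime_id assms(1)]]) blast
  obtain r' where r': "\<And>x. r x \<le> poly r' (size (enc x))"
    using \<open>poly_bounded r\<close> unfolding poly_bounded_def by blast
  let ?b = "\<lambda>x. 1 + size (enc x) + p x + q x + (1 + s x + poly r' (1 + size (enc x) + size (enc (l x))))"
  show ?thesis
  proof (rule polytimeI[of ?b "PIf P (PSeq S R) Q"])
    show "poly_bounded ?b" by (intro poly_bounded_intros * poly_bounded_size_enc polytime_size assms)
    fix x
    obtain tp tq ts where t: "tp \<le> p x" "exec P (enc x) tp (enc (l x))"
      "tq \<le> q x" "exec Q (enc x) tq (enc (f x))"
      "ts \<le> s x" "exec S (enc x) ts (enc (x, l x))"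
      using * by meson
    show "\<exists>t\<le>?b x. exec (PIf P (PSeq S R) Q) (enc x) t
        (enc (case l x of [] \<Rightarrow> f x | y # ys \<Rightarrow> g x y ys))"
    proof (cases "l x")
      case Nil
      with t show ?thesis
        by (intro exI[of _ "1 + size (enc x) + tp + tq"]) (auto intro: exec_intros)
    next
      case (Cons y ys)
      obtain tr where tr: "tr \<le> r (x, y, ys)" "exec R (enc (x, y, ys)) tr (enc (g x y ys))"
        using *(6)[of "(x, y, ys)"] by auto
      have "enc (x, y, ys) = enc (x, l x)" using Cons by simp
      moreover have "tr \<le> poly r' (1 + size (enc x) + size (enc (l x)))"
        using order_trans[OF tr(1) r'] Cons by (simp add: ac_simps)
      moreover from this have "exec (PIf P (PSeq S R) Q) (enc x)
          (1 + size (enc x) + tp + (1 + ts + tr)) (enc (g x y ys))"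
        using exec_If_true[OF t(2) _ exec_Seq[OF t(6)]] tr(2) Cons by simp
      ultimately show ?thesis using t tr Cons
        by (intro exI[of _ "1 + size (enc x) + tp + (1 + ts + tr)"]) auto
    qed
  qed
qed

text \<open>A Boolean has the code of a list of length at most one.\<close>

lemma polytime_if [polytime_intros]:
  assumes "polytime c" "polytime f" "polytime g"
  shows "polytime (\<lambda>x. if c x then f x else g x)"
proof -
  define l where "l x = (if c x then [Leaf] else [])" for x
  have "polytime l" by (rule polytime_recode[OF assms(1)]) (simp add: l_def)
  from polytime_case_list[OF this assms(3), of "\<lambda>x y ys. f x"] assms(2)
  have "polytime (\<lambda>x. case l x of [] \<Rightarrow> g x | y # ys \<Rightarrow> f x)"
    by (simp add: polytime_comp polytime_fst polytime_id)
  then show ?thesis by (rule polytime_recode) (simp add: l_def)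
qed

lemma polytime_not [polytime_intros]: "polytime c \<Longrightarrow> polytime (\<lambda>x. \<not> c x)"
  by (rule polytime_recode[OF polytime_if[OF _ polytime_const[of False] polytime_const[of True]]]) auto

lemma polytime_conj [polytime_intros]: "polytime c \<Longrightarrow> polytime d \<Longrightarrow> polytime (\<lambda>x. c x \<and> d x)"
  by (rule polytime_recode[OF polytime_if[OF _ _ polytime_const[of False], of c d]]) auto

lemma polytime_disj [polytime_intros]: "polytime c \<Longrightarrow> polytime d \<Longrightarrow> polytime (\<lambda>x. c x \<or> d x)"
  by (rule polytime_recode[OF polytime_if[OF _ polytime_const[of True], of c d]]) auto

lemma polytime_bool_eq: "polytime c \<Longrightarrow> polytime d \<Longrightarrow> polytime (\<lambda>x. c x \<longleftrightarrow> d x)"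
  by (rule polytime_recode[OF polytime_if[OF _ _ polytime_not, of c d d]]) auto

lemma polytime_Nil_eq [polytime_intros]: "polytime l \<Longrightarrow> polytime (\<lambda>x. l x = [])"
  by (rule polytime_recode[OF polytime_case_list[OF _ polytime_const[of True] polytime_const[of False], of l]])
    (auto split: list.split)

lemma polytime_Leaf_eq [polytime_intros]: "polytime f \<Longrightarrow> polytime (\<lambda>x. f x = Leaf)"
proof (rule polytime_recode[OF polytime_Nil_eq[OF polytime_to_list], of f])
  show "enc (f x = Leaf) = enc (to_list (f x) = [])" for x by (cases "f x") auto
qed

lemma polytime_tl [polytime_intros]: "polytime l \<Longrightarrow> polytime (\<lambda>x. tl (l x))"
  by (rule polytime_recode[OF polytime_case_list[OF _ polytime_const[of "[]"], of l "\<lambda>x y ys. ys"]])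
    (simp_all add: polytime_intros split: list.split)

section \<open>Iteration over a list\<close>

lemma length_le_size_enc: "length xs \<le> size (enc xs)"
  by (induction xs) auto

lemma size_enc_mem: "x \<in> set xs \<Longrightarrow> size (enc x) \<le> size (enc xs)"
  by (induction xs) auto

lemma size_enc_append [simp]: "size (enc (xs @ ys)) = size (enc xs) + size (enc ys)"
  by (induction xs) auto

lemma size_enc_rev [simp]: "size (enc (rev xs)) = size (enc xs)"
  by (induction xs) auto

lemma size_enc_list_le:
  assumes "\<And>x. x \<in> set xs \<Longrightarrow> size (enc x) \<le> S"
  shows "size (enc xs) \<le> length xs * Suc S"
  using assms
proof (induction xs)
  case (Cons a xs)
  then have "size (enc a) \<le> S" "size (enc xs) \<le> length xs * Suc S" by auto
  then show ?case by simp
qed simp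

lemma poly_bounded_length [poly_bounded_intros]: "polytime l \<Longrightarrow> poly_bounded (\<lambda>x. length (l x))"
  by (rule poly_bounded_le[OF polytime_size]) (auto intro: length_le_size_enc)

text \<open>The bound \<open>H\<close> on all intermediate accumulators is essential: a
  polynomial-time step may double the size, and iterating it would be exponential. The state carries
  the parameter \<open>x\<close>, the accumulator and the rest of the list, which is also the loop
  test.\<close>

lemma foldl_loop:
  fixes F :: "'c::enc \<Rightarrow> 'b::enc \<Rightarrow> 'a::enc \<Rightarrow> 'b"
  assumes "polytime (\<lambda>z. F (fst z) (fst (snd z)) (snd (snd z)))"
  shows "\<exists>W. \<exists>q :: nat poly. \<forall>x b l H. (\<forall>n. size (enc (foldl (F x) b (take n l))) \<le> H) \<longrightarrow>
      (\<exists>t\<le>Suc (length l) * poly q (size (enc x) + H + size (enc l)).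
        exec W (enc (x, b, l)) t (enc (x, foldl (F x) b l, [] :: 'a list)))"
proof -
  define body :: "'c \<times> 'b \<times> 'a \<times> 'a list \<Rightarrow> 'c \<times> 'b \<times> 'a list" where
    "body = (\<lambda>z. (fst z, F (fst z) (fst (snd z)) (fst (snd (snd z))), snd (snd (snd z))))"
  define test :: "'c \<times> 'b \<times> 'a list \<Rightarrow> data" where "test z = enc (snd (snd z))" for z
  have "polytime (\<lambda>z :: 'c \<times> 'b \<times> 'a \<times> 'a list. F (fst z) (fst (snd z)) (fst (snd (snd z))))"
    using polytime_comp[OF assms, of "\<lambda>z :: 'c \<times> 'b \<times> 'a \<times> 'a list. (fst z, fst (snd z), fst (snd (snd z)))"]
    by (simp add: polytime_intros)
  then have "polytime body" unfolding body_def by (intro polytime_intros)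
  then obtain P p where P: "poly_bounded p" "\<And>x. \<exists>t\<le>p x. exec P (enc x) t (enc (body x))"
    by (elim polytimeE) blast
  have "polytime test" unfolding test_def by (intro polytime_intros)
  then obtain B b' where B: "poly_bounded b'" "\<And>x. \<exists>t\<le>b' x. exec B (enc x) t (enc (test x))"
    by (elim polytimeE) blast
  obtain p1 where p1: "\<And>x. p x \<le> poly p1 (size (enc x))" using P(1) unfolding poly_bounded_def by blast
  obtain b1 where b1: "\<And>x. b' x \<le> poly b1 (size (enc x))" using B(1) unfolding poly_bounded_def by blast
  \<comment> \<open>The summands pay for the loop itself, the test and the body; the
    \<open>2\<close> counts the two pair nodes of the state.\<close>
  define q :: "nat poly" where "q = [:1:] + [:2, 1:] + pcompose b1 [:2, 1:] + pcompose p1 [:2, 1:]"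
  have q: "poly q N = 1 + (2 + N) + poly b1 (2 + N) + poly p1 (2 + N)" for N
    by (simp add: q_def poly_pcompose)
  \<comment> \<open>\<open>N\<close> stays fixed while the list shrinks, so every round costs at
    most \<open>poly q N\<close>; the final failing test is the additional round.\<close>
  have "\<exists>t\<le>Suc (length l) * poly q N. exec (PWhile B P) (enc (x, b, l)) t (enc (x, foldl (F x) b l, [] :: 'a list))"
    if "\<And>n. size (enc (foldl (F x) b (take n l))) \<le> H" and "size (enc x) + H + size (enc l) \<le> N" for x b l H N
    using that
  proof (induction l arbitrary: b)
    case Nil
    obtain tb where tb: "tb \<le> b' (x, b, [])" "exec B (enc (x, b, [] :: 'a list)) tb Leaf"
      using B(2)[of "(x, b, [])"] unfolding test_def by auto
    have sz: "size (enc (x, b, [] :: 'a list)) \<le> 2 + N" using Nil(1)[of 0] Nil(2) by simp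
    have "tb \<le> poly b1 (2 + N)"
      by (rule order_trans[OF tb(1)], rule order_trans[OF b1], rule poly_mono_nat[OF sz])
    with tb sz show ?case
      by (intro exI[of _ "1 + size (enc (x, b, [] :: 'a list)) + tb"] conjI)
        (auto simp del: enc_pair simp: q intro: exec_While_false[simplified])
  next
    case (Cons a l)
    obtain tb where tb: "tb \<le> b' (x, b, a # l)" "exec B (enc (x, b, a # l)) tb (enc (a # l))"
      using B(2)[of "(x, b, a # l)"] unfolding test_def by auto
    obtain tp where tp: "tp \<le> p (x, b, a, l)" "exec P (enc (x, b, a # l)) tp (enc (x, F x b a, l))"
      using P(2)[of "(x, b, a, l)"] unfolding body_def by auto
    have "size (enc (foldl (F x) (F x b a) (take n l))) \<le> H" for n
      using Cons.prems(1)[of "Suc n"] by simp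
    from Cons.IH[OF this] Cons.prems(2) obtain t where
      t: "t \<le> Suc (length l) * poly q N"
      "exec (PWhile B P) (enc (x, F x b a, l)) t (enc (x, foldl (F x) (F x b a) l, [] :: 'a list))"
      by auto
    have sz: "size (enc (x, b, a # l)) \<le> 2 + N" using Cons.prems(1)[of 0] Cons.prems(2) by simp
    have "tb \<le> poly b1 (2 + N)"
      by (rule order_trans[OF tb(1)], rule order_trans[OF b1], rule poly_mono_nat[OF sz])
    moreover have "size (enc (x, b, a, l)) \<le> 2 + N" using sz by simp
    then have "tp \<le> poly p1 (2 + N)"
      by (intro order_trans[OF tp(1)] order_trans[OF p1] poly_mono_nat)
    moreover have "exec (PWhile B P) (enc (x, b, a # l))
        (1 + size (enc (x, b, a # l)) + tb + tp + t) (enc (x, foldl (F x) b (a # l), [] :: 'a list))"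
      using exec_While_true[OF tb(2) _ tp(2) t(2)] by simp
    ultimately show ?case using sz t(1)
      by (intro exI[of _ "1 + size (enc (x, b, a # l)) + tb + tp + t"] conjI)
        (auto simp del: enc_pair simp: q)
  qed
  then show ?thesis by (intro exI[of _ "PWhile B P"] exI[of _ q]) blast
qed

lemma polytime_foldl:
  fixes F :: "'c::enc \<Rightarrow> 'b::enc \<Rightarrow> 'a::enc \<Rightarrow> 'b"
  assumes "polytime i" "polytime l" and F: "polytime (\<lambda>z. F (fst z) (fst (snd z)) (snd (snd z)))"
    and h: "poly_bounded h" "\<And>x n. size (enc (foldl (F x) (i x) (take n (l x)))) \<le> h x"
  shows "polytime (\<lambda>x. foldl (F x) (i x) (l x))"
proof -
  obtain W q where W: "\<forall>x b l H. (\<forall>n. size (enc (foldl (F x) b (take n l))) \<le> H) \<longrightarrow>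
      (\<exists>t\<le>Suc (length l) * poly q (size (enc x) + H + size (enc l)).
        exec W (enc (x, b, l)) t (enc (x, foldl (F x) b l, [] :: 'a list)))"
    using foldl_loop[OF F] by auto
  let ?g = "\<lambda>x. Suc (length (l x)) * poly q (size (enc x) + h x + size (enc (l x)))"
  have "polytime (\<lambda>x. (x, i x, l x))" using assms by (intro polytime_intros)
  then obtain P p where P: "poly_bounded p" "\<And>x. \<exists>t\<le>p x. exec P (enc x) t (enc (x, i x, l x))"
    by (elim polytimeE) blast
  have "polytime (\<lambda>x. (x, foldl (F x) (i x) (l x), [] :: 'a list))"
  proof (rule polytimeI[of "\<lambda>x. 1 + p x + ?g x" "PSeq P W"])
    show "poly_bounded (\<lambda>x. 1 + p x + ?g x)"
      by (intro poly_bounded_intros P h poly_bounded_size_enc polytime_size assms)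
    show "\<exists>t\<le>1 + p x + ?g x. exec (PSeq P W) (enc x) t (enc (x, foldl (F x) (i x) (l x), [] :: 'a list))" for x
    proof -
      obtain s t where "s \<le> p x" "exec P (enc x) s (enc (x, i x, l x))"
        "t \<le> ?g x" "exec W (enc (x, i x, l x)) t (enc (x, foldl (F x) (i x) (l x), [] :: 'a list))"
        using P(2)[of x] W[rule_format, of x "i x" "l x" "h x"] h(2)[of x] by auto
      then show ?thesis by (intro exI[of _ "1 + s + t"]) (auto intro: exec_intros)
    qed
  qed
  from polytime_fst[OF polytime_snd[OF this]] show ?thesis by simp
qed

text \<open>As an introduction rule, composition with an arbitrary function would match every goal. So every
  function gets its own rule, obtained from a fact about tuples.\<close>

lemma polytime_lift2:
  assumes "polytime (\<lambda>z. f (fst z) (snd z))"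
    and "polytime a" "polytime b"
  shows "polytime (\<lambda>x. f (a x) (b x))"
  using polytime_comp[OF assms(1) polytime_Pair[OF assms(2,3)]] by simp

lemma polytime_lift3:
  assumes "polytime (\<lambda>z. f (fst z) (fst (snd z)) (snd (snd z)))"
    and "polytime a" "polytime b" "polytime c"
  shows "polytime (\<lambda>x. f (a x) (b x) (c x))"
  using polytime_comp[OF assms(1) polytime_Pair[OF assms(2) polytime_Pair[OF assms(3,4)]]] by simp


section \<open>List functions as iterations\<close>

lemma size_enc_take_le: "size (enc (take n xs)) \<le> size (enc xs)"
  by (metis append_take_drop_id le_add1 size_enc_append)

lemma size_enc_concat_le: "size (enc (concat xs)) \<le> size (enc xs)"
  by (induction xs) auto

lemma foldl_Cons_eq: "foldl (\<lambda>acc a. f a # acc) ys xs = rev (map f xs) @ ys"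
  by (induction xs arbitrary: ys) auto

lemma polytime_rev_map:
  assumes "polytime l" and f: "polytime (\<lambda>z. f (fst z) (snd z))"
  shows "polytime (\<lambda>x. rev (map (f x) (l x)))"
proof -
  obtain q :: "nat poly" where q: "\<And>x a. size (enc (f x a)) \<le> poly q (size (enc (x, a)))"
    using polytime_size[OF f] unfolding poly_bounded_def by force
  let ?h = "\<lambda>x. length (l x) * Suc (poly q (1 + size (enc x) + size (enc (l x))))"
  have "polytime (\<lambda>x. foldl (\<lambda>acc a. f x a # acc) [] (l x))"
  proof (rule polytime_foldl)
    show "polytime (\<lambda>z. f (fst z) (snd (snd z)) # fst (snd z))"
      using polytime_comp[OF f polytime_Pair[OF polytime_fst[OF polytime_id] polytime_snd[OF polytime_snd[OF polytime_id]]]]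
      by (intro polytime_intros) simp
    show "poly_bounded ?h" by (intro poly_bounded_intros polytime_intros poly_bounded_size_enc polytime_size assms)
    fix x n
    have "size (enc (map (f x) (take n (l x)))) \<le> length (take n (l x)) *
      Suc (poly q (1 + size (enc x) + size (enc (l x))))"
    proof (rule order_trans[OF size_enc_list_le[of _ "poly q (1 + size (enc x) + size (enc (l x)))"]])
      fix y assume "y \<in> set (map (f x) (take n (l x)))"
      then obtain a where a: "a \<in> set (l x)" "y = f x a" by (auto dest: in_set_takeD)
      have "size (enc (x, a)) \<le> 1 + size (enc x) + size (enc (l x))"
        using size_enc_mem[OF a(1)] by simp
      then show "size (enc y) \<le> poly q (1 + size (enc x) + size (enc (l x)))"
        unfolding a(2) by (intro order_trans[OF q] poly_mono_nat)
    qed simp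
    also have "\<dots> \<le> ?h x" by (intro mult_right_mono) auto
    finally show "size (enc (foldl (\<lambda>acc a. f x a # acc) [] (take n (l x)))) \<le> ?h x"
      by (simp add: foldl_Cons_eq)
  qed (intro polytime_intros assms)+
  then show ?thesis by (simp add: foldl_Cons_eq)
qed

lemma polytime_rev [polytime_intros]: "polytime l \<Longrightarrow> polytime (\<lambda>x. rev (l x))"
  using polytime_rev_map[of l "\<lambda>x a. a"] by (simp add: polytime_intros)

lemma polytime_map [polytime_intros]:
  "polytime l \<Longrightarrow> polytime (\<lambda>z. f (fst z) (snd z)) \<Longrightarrow> polytime (\<lambda>x. map (f x) (l x))"
  using polytime_rev[OF polytime_rev_map] by simp

lemma polytime_append [polytime_intros]:
  assumes "polytime l" "polytime m"
  shows "polytime (\<lambda>x. l x @ m x)"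
proof -
  have "polytime (\<lambda>x. foldl (\<lambda>acc a. a # acc) (m x) (rev (l x)))"
  proof (rule polytime_foldl[where h = "\<lambda>x. size (enc (rev (l x))) + size (enc (m x))"])
    show "size (enc (foldl (\<lambda>acc a. a # acc) (m x) (take n (rev (l x)))))
        \<le> size (enc (rev (l x))) + size (enc (m x))" for x n
      using size_enc_take_le[of n "rev (l x)"] by (simp add: foldl_Cons_eq[of "\<lambda>a. a", simplified])
  qed (intro polytime_intros poly_bounded_intros polytime_size assms)+
  then show ?thesis by (simp add: foldl_Cons_eq[of "\<lambda>a. a", simplified])
qed

lemma polytime_concat [polytime_intros]:
  assumes "polytime l"
  shows "polytime (\<lambda>x. concat (l x))"
proof -
  have *: "foldl (@) ys xs = ys @ concat xs" for ys :: "'b list" and xs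
    by (induction xs arbitrary: ys) auto
  have "polytime (\<lambda>x. foldl (\<lambda>acc a. acc @ a) [] (l x))"
  proof (rule polytime_foldl[where h = "\<lambda>x. size (enc (l x))"])
    show "size (enc (foldl (\<lambda>acc a. acc @ a) [] (take n (l x)))) \<le> size (enc (l x))" for x n
      using order_trans[OF size_enc_concat_le size_enc_take_le[of n "l x"]] by (simp add: *)
  qed (intro polytime_intros poly_bounded_intros polytime_size assms)+
  then show ?thesis by (simp add: *)
qed

lemma polytime_filter [polytime_intros]:
  assumes "polytime l" "polytime (\<lambda>z. P (fst z) (snd z))"
  shows "polytime (\<lambda>x. filter (P x) (l x))"
proof -
  have "polytime (\<lambda>x. concat (map (\<lambda>a. if P x a then [a] else []) (l x)))"
    by (intro polytime_intros assms)
  moreover have "concat (map (\<lambda>a. if Q a then [a] else []) xs) = filter Q xs" for Q and xs :: "'b list"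
    by (induction xs) auto
  ultimately show ?thesis by simp
qed

lemma polytime_Bex [polytime_intros]:
  assumes "polytime l" "polytime (\<lambda>z. P (fst z) (snd z))"
  shows "polytime (\<lambda>x. \<exists>a\<in>set (l x). P x a)"
  by (rule polytime_recode[OF polytime_not[OF polytime_Nil_eq[OF polytime_filter[OF assms]]]]) (auto simp: filter_empty_conv)


section \<open>Arithmetic in polynomial time\<close>

fun bits :: "nat \<Rightarrow> bool list" where
  "bits n = (if n = 0 then [] else odd n # bits (n div 2))"

declare bits.simps [simp del]

primrec unbits :: "bool list \<Rightarrow> nat" where
  "unbits [] = 0"
| "unbits (b # bs) = of_bool b + 2 * unbits bs"

instantiation nat :: enc
begin
definition enc_nat :: "nat \<Rightarrow> data" where "enc_nat n = enc (bits n)"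
instance ..
end

lemma bits_0 [simp]: "bits 0 = []"
  by (subst bits.simps) simp

lemma unbits_bits [simp]: "unbits (bits n) = n"
proof (induction n rule: bits.induct)
  case (1 n)
  show ?case
  proof (cases "n = 0")
    case False
    then show ?thesis using 1 by (subst bits.simps) (auto simp: odd_two_times_div_two_succ)
  qed simp
qed

lemma bits_step: "bits (of_bool b + 2 * n) = (if n = 0 \<and> \<not> b then [] else b # bits n)"
  by (subst bits.simps) auto

lemma to_nat_eq_unbits: "to_nat d = unbits (map (\<lambda>x. x \<noteq> Leaf) (to_list d))"
  by (induction d) auto

lemma to_nat_enc [simp]: "to_nat (enc (n :: nat)) = n"
  unfolding to_nat_eq_unbits enc_nat_def by (simp add: comp_def)

lemma polytime_bits: "polytime f \<Longrightarrow> polytime (\<lambda>x. bits (f x))"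
  by (erule polytime_recode) (simp add: enc_nat_def)

lemma polytime_of_bits: "polytime (\<lambda>x. bits (f x)) \<Longrightarrow> polytime f"
  by (erule polytime_recode) (simp add: enc_nat_def)

text \<open>Here \<open>bs\<close> starts with the most significant bit, so dropping
  \<open>False\<close> while nothing has been kept removes exactly the leading zeros.\<close>

lemma bits_unbits_rev:
  "foldl (\<lambda>r b. if r = [] \<and> \<not> b then [] else b # r) [] bs = bits (unbits (rev bs))"
proof (induction bs rule: rev_induct)
  case (snoc b bs)
  have "bits (unbits (rev bs)) = [] \<longleftrightarrow> unbits (rev bs) = 0"
    by (metis bits_0 unbits.simps(1) unbits_bits)
  with snoc show ?case by (simp add: bits_step)
qed simp

lemma polytime_unbits [polytime_intros]:
  assumes "polytime l"
  shows "polytime (\<lambda>x. unbits (l x))"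
proof (rule polytime_of_bits)
  have "polytime (\<lambda>x. foldl (\<lambda>r b. if r = [] \<and> \<not> b then [] else b # r) [] (rev (l x)))"
  proof (rule polytime_foldl[where h = "\<lambda>x. size (enc (l x))"])
    fix x n
    have "size (enc (foldl (\<lambda>r b. if r = [] \<and> \<not> b then [] else b # r) [] bs)) \<le> size (enc bs)" for bs
      by (induction bs rule: rev_induct) auto
    from order_trans[OF this size_enc_take_le]
    show "size (enc (foldl (\<lambda>r b. if r = [] \<and> \<not> b then [] else b # r) [] (take n (rev (l x))))) \<le> size (enc (l x))"
      unfolding size_enc_rev[of "l x", symmetric] .
  qed (intro polytime_intros polytime_size assms)+
  then show "polytime (\<lambda>x. bits (unbits (l x)))" by (simp add: bits_unbits_rev)
qed

lemma polytime_to_nat [polytime_intros]: "polytime f \<Longrightarrow> polytime (\<lambda>x. to_nat (f x))"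
  unfolding to_nat_eq_unbits by (intro polytime_intros)

definition hd_bit :: "bool list \<Rightarrow> bool" where
  "hd_bit bs = (case bs of [] \<Rightarrow> False | b # _ \<Rightarrow> b)"

lemma polytime_hd_bit: "polytime l \<Longrightarrow> polytime (\<lambda>x. hd_bit (l x))"
  unfolding hd_bit_def by (intro polytime_intros)

lemma unbits_hd_tl: "unbits bs = of_bool (hd_bit bs) + 2 * unbits (tl bs)"
  by (cases bs) (auto simp: hd_bit_def)

text \<open>A full adder: the state is the carry, the rest of the second summand and the sum bits,
  latest first. The nested equivalence is the parity of three bits.\<close>

definition add_step :: "bool \<times> bool list \<times> bool list \<Rightarrow> bool \<Rightarrow> bool \<times> bool list \<times> bool list" where
  "add_step s a = (let c = fst s; b = hd_bit (fst (snd s)) in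
     ((a \<and> b) \<or> (c \<and> (a \<or> b)), tl (fst (snd s)), ((a \<longleftrightarrow> b) \<longleftrightarrow> c) # snd (snd s)))"

lemma add_step_simp: "add_step (c, bs, out) a =
    ((a \<and> hd_bit bs) \<or> (c \<and> (a \<or> hd_bit bs)), tl bs, ((a \<longleftrightarrow> hd_bit bs) \<longleftrightarrow> c) # out)"
  by (simp add: add_step_def Let_def)

lemma unbits_map_False [simp]: "unbits (map (\<lambda>_. False) xs) = 0"
  by (induction xs) auto

lemma unbits_append: "unbits (xs @ ys) = unbits xs + 2 ^ length xs * unbits ys"
  by (induction xs) auto

lemma unbits_less: "unbits bs < 2 ^ length bs"
  by (induction bs) auto

text \<open>What is not yet written is the carry and the rests of both summands, shifted by the
  number of bits written.\<close>

lemma add_step_invariant: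
  "foldl add_step (c, bs, out) as = (c', bs', out') \<Longrightarrow>
    unbits (rev out') + 2 ^ length out' * (of_bool c' + unbits bs') =
      unbits (rev out) + 2 ^ length out * (of_bool c + unbits as + unbits bs)
    \<and> length out' = length out + length as"
proof (induction as arbitrary: c bs out)
  case (Cons a as)
  let ?b = "hd_bit bs"
  let ?c = "(a \<and> ?b) \<or> (c \<and> (a \<or> ?b))" and ?o = "(a \<longleftrightarrow> ?b) \<longleftrightarrow> c"
  have "foldl add_step (?c, tl bs, ?o # out) as = (c', bs', out')"
    using Cons.prems by (simp add: add_step_simp)
  from Cons.IH[OF this] show ?case
    unfolding unbits_hd_tl[of bs]
    by (cases a; cases c; cases "?b") (simp_all add: unbits_append algebra_simps)
qed auto

lemma snd_snd_foldl_add_step: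
  assumes "length xs + length ys < length as" "unbits as = unbits xs"
  shows "unbits (rev (snd (snd (foldl add_step (False, ys, []) as)))) = unbits xs + unbits ys"
proof -
  obtain c' bs' out' where *: "foldl add_step (False, ys, []) as = (c', bs', out')"
    by (metis prod_cases3)
  have "length out' = length as" using add_step_invariant[OF *] by simp
  with add_step_invariant[OF *] assms
  have eq: "unbits (rev out') + 2 ^ length as * (of_bool c' + unbits bs') = unbits xs + unbits ys"
    by (metis add_0 list.size(3) mult_1 of_bool_eq(1) power_0 rev.simps(1) unbits.simps(1))
  have "unbits xs + unbits ys < 2 ^ length xs + 2 ^ length ys"
    using unbits_less[of xs] unbits_less[of ys] by simp
  also have "\<dots> \<le> 2 ^ (length xs + length ys) + 2 ^ (length xs + length ys)"
    by (intro add_mono power_increasing) auto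
  also have "\<dots> = 2 ^ Suc (length xs + length ys)" by simp
  also have "\<dots> \<le> (2 :: nat) ^ length as" using assms(1) by (intro power_increasing) auto
  finally have less: "unbits xs + unbits ys < 2 ^ length as" .
  \<comment> \<open>Anything left over would count at least \<open>2 ^ length as\<close>, which
    exceeds the sum.\<close>
  have "of_bool c' + unbits bs' = 0"
  proof (rule ccontr)
    assume "of_bool c' + unbits bs' \<noteq> 0"
    then have "2 ^ length as * 1 \<le> 2 ^ length as * (of_bool c' + unbits bs')"
      by (intro mult_le_mono2) linarith
    with eq less show False by linarith
  qed
  with eq * show ?thesis by simp
qed

lemma size_enc_bits_le: "size (enc (bs :: bool list)) \<le> 2 * length bs"
  using size_enc_list_le[of bs 1] by (force simp: enc_bool_def)

lemma foldl_add_step_size: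
  "size (enc (foldl add_step (c, bs, out) as)) \<le> 3 + 2 * length bs + 2 * length out + 2 * length as"
proof -
  obtain c' bs' out' where *: "foldl add_step (c, bs, out) as = (c', bs', out')"
    by (metis prod_cases3)
  have "length bs' \<le> length bs"
    using *
  proof (induction as arbitrary: c bs out)
    case (Cons a as)
    from Cons.IH[OF Cons.prems[unfolded foldl_Cons add_step_simp]] show ?case by simp
  qed simp
  then show ?thesis
    using add_step_invariant[OF *] size_enc_bits_le[of bs'] size_enc_bits_le[of out']
    by (simp add: * enc_bool_def)
qed

lemma polytime_add [polytime_intros]:
  fixes f g :: "'a::enc \<Rightarrow> nat"
  assumes "polytime f" "polytime g"
  shows "polytime (\<lambda>x. f x + g x)"
proof -
  \<comment> \<open>The zeros keep the loop running until the second summand is consumed and the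
    carry is absorbed.\<close>
  define as where "as x = bits (f x) @ map (\<lambda>_. False) (bits (g x)) @ [False]" for x
  have as: "polytime as" unfolding as_def by (intro polytime_intros polytime_bits assms)
  have "polytime (\<lambda>x. foldl add_step (False, bits (g x), []) (as x))"
  proof (rule polytime_foldl[where h = "\<lambda>x. 3 + 2 * length (bits (g x)) + 2 * length (as x)"])
    show "size (enc (foldl add_step (False, bits (g x), []) (take n (as x))))
        \<le> 3 + 2 * length (bits (g x)) + 2 * length (as x)" for x n
      by (rule order_trans[OF foldl_add_step_size]) simp
    show "polytime (\<lambda>z. add_step (fst (snd z)) (snd (snd z)))"
      unfolding add_step_def by (intro polytime_intros polytime_hd_bit polytime_bool_eq)
  qed (intro polytime_intros poly_bounded_intros polytime_bits assms as)+
  then have "polytime (\<lambda>x. unbits (rev (snd (snd (foldl add_step (False, bits (g x), []) (as x))))))"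
    by (intro polytime_intros)
  moreover have "unbits (rev (snd (snd (foldl add_step (False, bits (g x), []) (as x))))) = f x + g x" for x
    using snd_snd_foldl_add_step[of "bits (f x)" "bits (g x)" "as x"]
    by (simp add: as_def unbits_append)
  ultimately show ?thesis by simp
qed

text \<open>Going up from the least significant bit, the last position where the bits differ
  decides.\<close>

definition le_step :: "bool \<times> bool list \<Rightarrow> bool \<Rightarrow> bool \<times> bool list" where
  "le_step s a = (let b = hd_bit (snd s) in (if a \<longleftrightarrow> b then fst s else b, tl (snd s)))"

lemma le_step_simp:
  "le_step (le, bs) a = (if a \<longleftrightarrow> hd_bit bs then le else hd_bit bs, tl bs)"
  by (simp add: le_step_def Let_def)

lemma fst_foldl_le_step:
  "length bs \<le> length as \<Longrightarrow> fst (foldl le_step (le, bs) as) =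
    (if unbits as = unbits bs then le else unbits as < unbits bs)"
proof (induction as arbitrary: le bs)
  case (Cons a as)
  let ?b = "hd_bit bs"
  have "fst (foldl le_step (le, bs) (a # as)) =
      (if unbits as = unbits (tl bs) then if a \<longleftrightarrow> ?b then le else ?b else unbits as < unbits (tl bs))"
    using Cons.IH[of "tl bs"] Cons.prems by (simp add: le_step_simp)
  then show ?case unfolding unbits_hd_tl[of bs] by (auto simp: of_bool_def split: if_splits)
qed simp

lemma polytime_le [polytime_intros]:
  fixes f g :: "'a::enc \<Rightarrow> nat"
  assumes "polytime f" "polytime g"
  shows "polytime (\<lambda>x. f x \<le> g x)"
proof -
  define as where "as x = bits (f x) @ map (\<lambda>_. False) (bits (g x))" for x
  have as: "polytime as" unfolding as_def by (intro polytime_intros polytime_bits assms)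
  have "polytime (\<lambda>x. foldl le_step (True, bits (g x)) (as x))"
  proof (rule polytime_foldl[where h = "\<lambda>x. 2 + 2 * length (bits (g x))"])
    fix x n
    have "length (snd (foldl le_step (c, bs) xs)) \<le> length bs" for c bs xs
    proof (induction xs arbitrary: c bs)
      case (Cons a xs)
      show ?case unfolding foldl_Cons le_step_simp by (rule order_trans[OF Cons.IH]) simp
    qed simp
    from order_trans[OF size_enc_bits_le mult_le_mono2[OF this]]
    have *: "size (enc (snd (foldl le_step (True, bits (g x)) (take n (as x))))) \<le> 2 * length (bits (g x))" .
    have **: "size (enc b) \<le> 1" for b :: bool by (cases b) auto
    show "size (enc (foldl le_step (True, bits (g x)) (take n (as x)))) \<le> 2 + 2 * length (bits (g x))"
      using * **[of "fst (foldl le_step (True, bits (g x)) (take n (as x)))"] by (simp add: enc_prod_def)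
    show "polytime (\<lambda>z. le_step (fst (snd z)) (snd (snd z)))"
      unfolding le_step_def by (intro polytime_intros polytime_hd_bit polytime_bool_eq)
  qed (intro polytime_intros poly_bounded_intros polytime_bits assms as)+
  then have "polytime (\<lambda>x. fst (foldl le_step (True, bits (g x)) (as x)))"
    by (intro polytime_intros)
  moreover have "unbits (as x) = f x" for x
    unfolding as_def by (simp add: unbits_append)
  ultimately show ?thesis
    by (subst (asm) fst_foldl_le_step) (auto simp: as_def le_less elim!: polytime_recode)
qed

lemma polytime_less [polytime_intros]:
  fixes f g :: "'a::enc \<Rightarrow> nat"
  shows "polytime f \<Longrightarrow> polytime g \<Longrightarrow> polytime (\<lambda>x. f x < g x)"
  using polytime_not[OF polytime_le[of g f]] by (simp add: not_le)

lemma polytime_eq [polytime_intros]: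
  fixes f g :: "'a::enc \<Rightarrow> nat"
  shows "polytime f \<Longrightarrow> polytime g \<Longrightarrow> polytime (\<lambda>x. f x = g x)"
  using polytime_conj[OF polytime_le[of f g] polytime_le[of g f]] by (simp add: eq_iff)

lemma polytime_mem [polytime_intros]:
  fixes f :: "'a::enc \<Rightarrow> nat"
  assumes "polytime f" "polytime l"
  shows "polytime (\<lambda>x. f x \<in> set (l x))"
proof -
  have "polytime (\<lambda>x. \<exists>a\<in>set (l x). a = f x)"
    by (intro polytime_intros assms polytime_comp[OF assms(1) polytime_fst])
  then show ?thesis by simp
qed

section \<open>Lengths of binary numbers and sums of lists\<close>

lemma length_bits_le: "n < 2 ^ k \<Longrightarrow> length (bits n) \<le> k"
proof (induction k arbitrary: n)
  case (Suc k)
  then show ?case by (subst bits.simps) auto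
qed simp

lemma length_bits_add: "length (bits (m + n)) \<le> Suc (max (length (bits m)) (length (bits n)))"
proof (rule length_bits_le)
  have "m < 2 ^ max (length (bits m)) (length (bits n))" "n < 2 ^ max (length (bits m)) (length (bits n))"
    using unbits_less[of "bits m"] unbits_less[of "bits n"]
    by (simp_all add: less_le_trans power_increasing)
  then show "m + n < 2 ^ Suc (max (length (bits m)) (length (bits n)))" by simp
qed

text \<open>An addition lengthens the longer summand by at most one bit, which the list node of the
  new summand pays for.\<close>

lemma length_bits_sum_list: "length (bits (sum_list ns)) \<le> size (enc ns)"
proof (induction ns)
  case (Cons n ns)
  have "length (bits n) \<le> size (enc n)" by (simp add: enc_nat_def length_le_size_enc)
  with Cons length_bits_add[of n "sum_list ns"] show ?case by simp
qed simp

lemma size_enc_nat_le: "size (enc (n :: nat)) \<le> 2 * length (bits n)"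
  by (simp add: enc_nat_def size_enc_bits_le)

lemma size_enc_nat_le_double: "size (enc (n :: nat)) \<le> 2 * n"
  using size_enc_nat_le[of n] length_bits_le[of n n] by (simp add: less_exp)

lemma polytime_sum_list [polytime_intros]:
  fixes l :: "'a::enc \<Rightarrow> nat list"
  assumes "polytime l"
  shows "polytime (\<lambda>x. sum_list (l x))"
proof -
  have *: "foldl (+) m ns = m + sum_list ns" for m :: nat and ns
    by (induction ns arbitrary: m) auto
  have "polytime (\<lambda>x. foldl (+) 0 (l x))"
  proof (rule polytime_foldl[where h = "\<lambda>x. 2 * size (enc (l x))"])
    fix x n
    have "size (enc (sum_list (take n (l x)))) \<le> 2 * length (bits (sum_list (take n (l x))))"
      by (rule size_enc_nat_le)
    also have "\<dots> \<le> 2 * size (enc (l x))"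
      using order_trans[OF length_bits_sum_list size_enc_take_le[of n "l x"]] by simp
    finally show "size (enc (foldl (+) 0 (take n (l x)))) \<le> 2 * size (enc (l x))" by (simp add: *)
  qed (intro polytime_intros poly_bounded_intros polytime_size assms)+
  then show ?thesis by (simp add: *)
qed

lemma polytime_length [polytime_intros]:
  assumes "polytime l"
  shows "polytime (\<lambda>x. length (l x))"
proof -
  have "polytime (\<lambda>x. sum_list (map (\<lambda>_. 1 :: nat) (l x)))" by (intro polytime_intros assms)
  then show ?thesis by (simp add: sum_list_triv)
qed


section \<open>The algorithms\<close>

subsection \<open>Selection and removal of duplicates\<close>

text \<open>A list of length at most one replaces an option, so that the result can be appended to a
  table.\<close>

definition select_min :: "('a \<Rightarrow> nat) \<Rightarrow> 'a list \<Rightarrow> 'a list" where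
  "select_min f xs =
    foldl (\<lambda>m y. case m of [] \<Rightarrow> [y] | z # _ \<Rightarrow> if f y < f z then [y] else m) [] xs"

lemma select_min_Nil [simp]: "select_min f [] = []"
  by (simp add: select_min_def)

lemma select_min_cases:
  "xs \<noteq> [] \<Longrightarrow> \<exists>y\<in>set xs. select_min f xs = [y] \<and> (\<forall>z\<in>set xs. f y \<le> f z)"
proof (induction xs rule: rev_induct)
  case (snoc x xs)
  show ?case
  proof (cases "xs = []")
    case False
    with snoc.IH obtain y where "y \<in> set xs" "select_min f xs = [y]" "\<forall>z\<in>set xs. f y \<le> f z" by blast
    then show ?thesis by (cases "f x < f y") (auto simp: select_min_def intro: order_trans less_imp_le)
  qed (simp add: select_min_def)
qed simp

lemma set_select_min: "set (select_min f xs) \<subseteq> set xs"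
  using select_min_cases[of xs f] by (cases "xs = []") auto

lemma length_select_min: "length (select_min f xs) \<le> 1"
  using select_min_cases[of xs f] by (cases "xs = []") auto

lemma polytime_select_min [polytime_intros]:
  assumes "polytime l" and f: "polytime (\<lambda>z. f (fst z) (snd z))"
  shows "polytime (\<lambda>x. select_min (f x) (l x))"
  unfolding select_min_def
proof (rule polytime_foldl[where h = "\<lambda>x. size (enc (l x))"])
  fix x n
  have mem: "y \<in> set xs \<Longrightarrow> Suc (size (enc y)) \<le> size (enc xs)" for y and xs :: "'b list"
    by (induction xs) auto
  have "size (enc (select_min (f x) xs)) \<le> size (enc xs)" for xs
    using select_min_cases[of xs "f x"] mem by (cases "xs = []") auto
  from order_trans[OF this size_enc_take_le]
  show "size (enc (foldl (\<lambda>m y. case m of [] \<Rightarrow> [y] | z # _ \<Rightarrow> if f x y < f x z then [y] else m)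
      [] (take n (l x)))) \<le> size (enc (l x))"
    unfolding select_min_def .
  show "polytime (\<lambda>z. case fst (snd z) of [] \<Rightarrow> [snd (snd z)]
      | v # _ \<Rightarrow> if f (fst z) (snd (snd z)) < f (fst z) v then [snd (snd z)] else fst (snd z))"
    by (intro polytime_intros polytime_lift2[of f, OF f])
qed (intro polytime_intros polytime_size assms)+

definition dedup :: "'a list \<Rightarrow> 'a list" where
  "dedup xs = foldl (\<lambda>acc a. if a \<in> set acc then acc else a # acc) [] xs"

lemma dedup_snoc: "dedup (xs @ [x]) = (if x \<in> set (dedup xs) then dedup xs else x # dedup xs)"
  by (simp add: dedup_def)

lemma set_dedup [simp]: "set (dedup xs) = set xs"
  by (induction xs rule: rev_induct) (auto simp: dedup_snoc, auto simp: dedup_def)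

lemma distinct_dedup [simp]: "distinct (dedup xs)"
  by (induction xs rule: rev_induct) (auto simp: dedup_snoc, auto simp: dedup_def)

lemma length_dedup_le: "length (dedup xs) \<le> length xs"
  by (induction xs rule: rev_induct) (auto simp: dedup_snoc, auto simp: dedup_def)

lemma length_dedup: "length (dedup xs) = card (set xs)"
  by (metis distinct_card distinct_dedup set_dedup)

lemma size_enc_dedup_le: "size (enc (dedup xs)) \<le> size (enc xs)"
  by (induction xs rule: rev_induct) (auto simp: dedup_snoc, auto simp: dedup_def)

lemma polytime_dedup [polytime_intros]:
  fixes l :: "'a::enc \<Rightarrow> nat list"
  assumes "polytime l"
  shows "polytime (\<lambda>x. dedup (l x))"
  unfolding dedup_def
proof (rule polytime_foldl[where h = "\<lambda>x. size (enc (l x))"])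
  show "size (enc (foldl (\<lambda>acc a. if a \<in> set acc then acc else a # acc) [] (take n (l x))))
      \<le> size (enc (l x))" for x n
    using order_trans[OF size_enc_dedup_le size_enc_take_le[of n "l x"]] unfolding dedup_def .
qed (intro polytime_intros polytime_size assms)+


subsection \<open>Shortest paths\<close>

text \<open>An arc is a triple of a source, a target and a length. Paths are stored backwards: the first
  arc of the list is the last one of the path.\<close>

type_synonym arc = "nat \<times> nat \<times> nat"

abbreviation src :: "arc \<Rightarrow> nat" where "src c \<equiv> fst c"
abbreviation tgt :: "arc \<Rightarrow> nat" where "tgt c \<equiv> fst (snd c)"
abbreviation len :: "arc \<Rightarrow> nat" where "len c \<equiv> snd (snd c)"

definition path_len :: "arc list \<Rightarrow> nat" where
  "path_len p = sum_list (map len p)"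

lemma polytime_path_len [polytime_intros]: "polytime f \<Longrightarrow> polytime (\<lambda>x. path_len (f x))"
  by (erule polytime_comp[rotated], unfold path_len_def[abs_def], intro polytime_intros)

definition crossing :: "arc list \<Rightarrow> (nat \<times> arc list) list \<Rightarrow> (nat \<times> arc list) list" where
  "crossing A tbl = concat (map (\<lambda>e. map (\<lambda>c. (tgt c, c # snd e))
    (filter (\<lambda>c. src c = fst e \<and> tgt c \<notin> set (map fst tbl)) A)) tbl)"

lemma polytime_crossing [polytime_intros]: "polytime f \<Longrightarrow> polytime g \<Longrightarrow> polytime (\<lambda>x. crossing (f x) (g x))"
proof (rule polytime_lift2[of crossing])
  show "polytime (\<lambda>z. crossing (fst z) (snd z))"
    unfolding crossing_def by (intro polytime_intros)
qed

lemma set_crossing: "set (crossing A tbl) =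
    {(tgt c, c # p) |c v p. (v, p) \<in> set tbl \<and> c \<in> set A \<and> src c = v \<and> tgt c \<notin> fst ` set tbl}"
  unfolding crossing_def by force

text \<open>Dijkstra's algorithm from \<open>r\<close>. The list \<open>V\<close> only counts the rounds.\<close>

definition grow :: "arc list \<Rightarrow> nat \<Rightarrow> nat list \<Rightarrow> (nat \<times> arc list) list" where
  "grow A r V =
    foldl (\<lambda>tbl _. select_min (\<lambda>e. path_len (snd e)) (crossing A tbl) @ tbl) [(r, [])] V"

lemma grow_Nil [simp]: "grow A r [] = [(r, [])]"
  by (simp add: grow_def)

lemma grow_snoc: "grow A r (V @ [v]) =
    select_min (\<lambda>e. path_len (snd e)) (crossing A (grow A r V)) @ grow A r V"
  by (simp add: grow_def)

lemma length_grow: "length (grow A r V) \<le> Suc (length V)"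
proof (induction V rule: rev_induct)
  case (snoc v V)
  have "length (grow A r (V @ [v])) \<le> 1 + length (grow A r V)"
    unfolding grow_snoc length_append by (intro add_right_mono length_select_min)
  with snoc show ?case by simp
qed simp

lemma grow_entry:
  "e \<in> set (grow A r V) \<Longrightarrow>
    fst e \<in> insert r (tgt ` set A) \<and> set (snd e) \<subseteq> set A \<and> length (snd e) \<le> length V"
proof (induction V arbitrary: e rule: rev_induct)
  case (snoc v V)
  from snoc.prems consider "e \<in> set (crossing A (grow A r V))" | "e \<in> set (grow A r V)"
    using set_select_min by (fastforce simp: grow_snoc)
  then show ?case
  proof cases
    case 1
    then obtain c v p where "(v, p) \<in> set (grow A r V)" "c \<in> set A" "e = (tgt c, c # p)"
      by (auto simp: set_crossing)
    with snoc.IH[of "(v, p)"] show ?thesis by simp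
  next
    case 2
    from snoc.IH[OF this] show ?thesis by simp
  qed
qed simp

lemma polytime_grow [polytime_intros]: "polytime f \<Longrightarrow> polytime g \<Longrightarrow> polytime h \<Longrightarrow> polytime (\<lambda>x. grow (f x) (g x) (h x))"
proof (rule polytime_lift3[of grow])
  \<comment> \<open>\<open>?E\<close> bounds one table entry: its vertex is the root or the target
    of an arc, and its path has at most one arc per round.\<close>
  let ?E = "\<lambda>z :: arc list \<times> nat \<times> nat list. 1 + (size (enc (fst (snd z))) + size (enc (fst z))) +
    length (snd (snd z)) * Suc (size (enc (fst z)))"
  let ?h = "\<lambda>z. Suc (length (snd (snd z))) * Suc (?E z)"
  show "polytime (\<lambda>z. grow (fst z) (fst (snd z)) (snd (snd z)))"
    unfolding grow_def
  proof (rule polytime_foldl[where h = ?h])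
    show "poly_bounded ?h" by (intro poly_bounded_intros polytime_size polytime_intros)
    fix z :: "arc list \<times> nat \<times> nat list" and n
    obtain A r V where z: "z = (A, r, V)" by (metis prod_cases3)
    have "size (enc (grow A r (take n V))) \<le> length (grow A r (take n V)) * Suc (?E z)"
    proof (rule size_enc_list_le)
      fix e assume e: "e \<in> set (grow A r (take n V))"
      have "size (enc (tgt c)) \<le> size (enc A)" if "c \<in> set A" for c
        using size_enc_mem[OF that] by (simp add: enc_prod_def)
      with grow_entry[OF e] have 1: "size (enc (fst e)) \<le> size (enc r) + size (enc A)"
        by (auto intro: trans_le_add2)
      have "size (enc (snd e)) \<le> length (snd e) * Suc (size (enc A))"
        using grow_entry[OF e] by (intro size_enc_list_le) (auto intro: size_enc_mem)
      also have "\<dots> \<le> length V * Suc (size (enc A))"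
        using grow_entry[OF e] by (intro mult_le_mono1) auto
      finally show "size (enc e) \<le> ?E z"
        using 1 by (simp add: enc_prod_def z)
    qed
    also have "\<dots> \<le> Suc (length V) * Suc (?E z)"
      using length_grow[of A r "take n V"] by (intro mult_le_mono1) auto
    finally show "size (enc (foldl (\<lambda>tbl _. select_min (\<lambda>e. path_len (snd e)) (crossing (fst z) tbl) @ tbl)
        [(fst (snd z), [])] (take n (snd (snd z))))) \<le> ?h z"
      by (simp add: z grow_def)
  qed (intro polytime_intros)+
qed

section \<open>Distances in an instance\<close>

definition arcs :: "data \<Rightarrow> arc list" where
  "arcs I = concat (map (\<lambda>d. let a = to_nat (left (left d)); b = to_nat (right (left d)); w = to_nat (right d)
    in [(a, b, w), (b, a, w)]) (to_list (right (right I))))"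

definition verts :: "data \<Rightarrow> nat list" where
  "verts I = map to_nat (to_list (left I))"

text \<open>The table has at most one entry for \<open>v\<close>, so nothing is really concatenated;
  for an unreachable \<open>v\<close> the path is empty and the distance 0.\<close>

definition shortest_path :: "data \<Rightarrow> nat \<Rightarrow> nat \<Rightarrow> arc list" where
  "shortest_path I u v = concat (map snd (filter (\<lambda>e. fst e = v) (grow (arcs I) u (verts I))))"

definition distance :: "data \<Rightarrow> nat \<Rightarrow> nat \<Rightarrow> nat" where
  "distance I u v = path_len (shortest_path I u v)"

lemma polytime_arcs [polytime_intros]: "polytime f \<Longrightarrow> polytime (\<lambda>x. arcs (f x))"
  by (erule polytime_comp[rotated], unfold arcs_def[abs_def], intro polytime_intros)

lemma polytime_verts [polytime_intros]: "polytime f \<Longrightarrow> polytime (\<lambda>x. verts (f x))"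
  by (erule polytime_comp[rotated], unfold verts_def[abs_def], intro polytime_intros)

lemma polytime_shortest_path [polytime_intros]:
  "polytime f \<Longrightarrow> polytime g \<Longrightarrow> polytime h \<Longrightarrow> polytime (\<lambda>x. shortest_path (f x) (g x) (h x))"
proof (rule polytime_lift3[of shortest_path])
  show "polytime (\<lambda>z. shortest_path (fst z) (fst (snd z)) (snd (snd z)))"
    unfolding shortest_path_def by (intro polytime_intros)
qed

lemma polytime_distance [polytime_intros]:
  "polytime f \<Longrightarrow> polytime g \<Longrightarrow> polytime h \<Longrightarrow> polytime (\<lambda>x. distance (f x) (g x) (h x))"
  unfolding distance_def by (intro polytime_intros)


subsection \<open>The reduction\<close>

text \<open>An instance \<open>(I, k)\<close> is represented by \<open>(I, ks)\<close> with a list \<open>ks\<close> of length \<open>k\<close>.\<close>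

type_synonym instance_code = "data \<times> data list"

text \<open>If there are no terminals, a Steiner tree still has to contain some vertex, so the first one
  is made a terminal.\<close>

definition terms :: "instance_code \<Rightarrow> nat list" where
  "terms x = (let R = dedup (map to_nat (to_list (left (right (fst x))))) in
    if R = [] then (case verts (fst x) of [] \<Rightarrow> [] | v # _ \<Rightarrow> [v])
    else if length R \<le> length (snd x) then R else [])"

definition root :: "instance_code \<Rightarrow> nat" where
  "root x = (case terms x of [] \<Rightarrow> 0 | r # _ \<Rightarrow> r)"

text \<open>Unreachable vertices have the default distance 0 and would look like excellent inner
  nodes, so the search is confined to this component.\<close>

definition component :: "instance_code \<Rightarrow> nat list" where
  "component x = map fst (grow (arcs (fst x)) (root x) (verts (fst x)))"

text \<open>A list of terminals at the leaves of a perfect binary tree of depth \<open>j\<close> is written as a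
  \<^typ>\<open>data\<close> of that shape. \<open>best j x v t\<close> is the length of a shortest binary tree of depth \<open>j\<close>
  with these leaves that hangs from \<open>v\<close>, together with the list of its inner nodes.\<close>

primrec best :: "nat \<Rightarrow> instance_code \<Rightarrow> nat \<Rightarrow> data \<Rightarrow> nat \<times> nat list" where
  "best 0 x v t = (distance (fst x) v (to_nat t), [])"
| "best (Suc j) x v t =
    (case select_min fst (map (\<lambda>u. let p = best j x u (left t); q = best j x u (right t) in
        (distance (fst x) v u + fst p + fst q, u # snd p @ snd q)) (component x)) of
      [] \<Rightarrow> (0, []) | y # _ \<Rightarrow> y)"

text \<open>Repeated leaves are allowed, so that smaller or unbalanced pieces can be padded to one
  fixed shape.\<close>

primrec shapes :: "nat \<Rightarrow> instance_code \<Rightarrow> data list" where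
  "shapes 0 x = map enc (terms x)"
| "shapes (Suc j) x = concat (map (\<lambda>a. map (\<lambda>b. Node a b) (shapes j x)) (shapes j x))"

definition kverts :: "nat \<Rightarrow> instance_code \<Rightarrow> nat list" where
  "kverts s x = dedup (terms x @
    concat (map (\<lambda>r. concat (map (\<lambda>t. snd (best s x r t)) (shapes s x))) (terms x)))"

text \<open>The vertices of the kernel are renamed, since their codes may be long.\<close>

definition name :: "nat \<Rightarrow> instance_code \<Rightarrow> nat \<Rightarrow> nat" where
  "name s x v = length (filter (\<lambda>u. u < v) (kverts s x))"

definition total :: "instance_code \<Rightarrow> nat" where
  "total x = sum_list (map (distance (fst x) (root x)) (terms x))"

text \<open>Lengths are multiplied by \<open>length (scale s x) / total x\<close> and rounded down. This loses at most
  \<open>total x / length (scale s x)\<close> for each of the at most \<open>(length (kverts s x))\<^sup>2\<close> edges, in sum at most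
  \<open>total x / (length (terms x) * s)\<close>, which is at most a fraction \<open>1 / s\<close> of the optimum.\<close>

definition scale :: "nat \<Rightarrow> instance_code \<Rightarrow> data list" where
  "scale s x = concat (map (\<lambda>_. concat (map (\<lambda>_. concat (map (\<lambda>_. replicate s Leaf) (terms x)))
    (kverts s x))) (kverts s x))"

text \<open>By the lemma \<open>distance_K_le\<close>, the distances in the kernel are at most
  \<open>(2 + 4 * 2 ^ s) * total x\<close>.\<close>

definition cap :: "nat \<Rightarrow> instance_code \<Rightarrow> data list" where
  "cap s x = concat (map (\<lambda>_. scale s x) (replicate (2 + 4 * 2 ^ s) Leaf))"

text \<open>Instead of dividing, the multiples of \<^term>\<open>total x\<close> are counted. If \<^term>\<open>total x\<close> is \<open>0\<close>, the
  result is the useless value \<^term>\<open>length (cap s x)\<close>, but then all distances are \<open>0\<close>.\<close>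

definition scaled :: "nat \<Rightarrow> instance_code \<Rightarrow> nat \<Rightarrow> nat" where
  "scaled s x d = length (foldl (\<lambda>c y. if sum_list (map (\<lambda>_. total x) (y # c)) \<le>
      sum_list (map (\<lambda>_. d) (scale s x)) then y # c else c) [] (cap s x))"

definition kedges :: "nat \<Rightarrow> instance_code \<Rightarrow> ((nat \<times> nat) \<times> nat) list" where
  "kedges s x = concat (map (\<lambda>u. map (\<lambda>v. ((name s x u, name s x v), scaled s x (distance (fst x) u v)))
    (filter (\<lambda>v. u < v) (kverts s x))) (kverts s x))"

definition kernel :: "nat \<Rightarrow> instance_code \<Rightarrow> nat list \<times> nat list \<times> ((nat \<times> nat) \<times> nat) list" where
  "kernel s x = (map (name s x) (kverts s x), map (name s x) (terms x), kedges s x)"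

lemma polytime_terms [polytime_intros]: "polytime f \<Longrightarrow> polytime (\<lambda>x. terms (f x))"
  by (erule polytime_comp[rotated], unfold terms_def[abs_def], intro polytime_intros)

lemma polytime_root [polytime_intros]: "polytime f \<Longrightarrow> polytime (\<lambda>x. root (f x))"
  by (erule polytime_comp[rotated], unfold root_def[abs_def], intro polytime_intros)

lemma polytime_component [polytime_intros]: "polytime f \<Longrightarrow> polytime (\<lambda>x. component (f x))"
  by (erule polytime_comp[rotated], unfold component_def[abs_def], intro polytime_intros)

lemma polytime_best [polytime_intros]:
  "polytime f \<Longrightarrow> polytime g \<Longrightarrow> polytime h \<Longrightarrow> polytime (\<lambda>x. best j (f x) (g x) (h x))"
proof (rule polytime_lift3[of "best j"])
  show "polytime (\<lambda>z. best j (fst z) (fst (snd z)) (snd (snd z)))"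
  proof (induction j)
    case (Suc j)
    show ?case unfolding best.simps by (intro polytime_intros polytime_lift3[OF Suc])
  qed (simp only: best.simps, intro polytime_intros)
qed

lemma polytime_shapes [polytime_intros]: "polytime f \<Longrightarrow> polytime (\<lambda>x. shapes j (f x))"
proof (erule polytime_comp[rotated], induction j)
  case (Suc j)
  then show ?case unfolding shapes.simps[abs_def] by (intro polytime_intros polytime_comp[OF Suc])
qed (unfold shapes.simps[abs_def], intro polytime_intros)

lemma polytime_kverts [polytime_intros]: "polytime f \<Longrightarrow> polytime (\<lambda>x. kverts s (f x))"
  by (erule polytime_comp[rotated], unfold kverts_def[abs_def], intro polytime_intros)

lemma polytime_name [polytime_intros]: "polytime f \<Longrightarrow> polytime g \<Longrightarrow> polytime (\<lambda>x. name s (f x) (g x))"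
proof (rule polytime_lift2[of "name s"])
  show "polytime (\<lambda>z. name s (fst z) (snd z))"
    unfolding name_def by (intro polytime_intros)
qed

lemma polytime_total [polytime_intros]: "polytime f \<Longrightarrow> polytime (\<lambda>x. total (f x))"
  by (erule polytime_comp[rotated], unfold total_def[abs_def], intro polytime_intros)

lemma polytime_scale [polytime_intros]: "polytime f \<Longrightarrow> polytime (\<lambda>x. scale s (f x))"
  by (erule polytime_comp[rotated], unfold scale_def[abs_def], intro polytime_intros)

lemma polytime_cap [polytime_intros]: "polytime f \<Longrightarrow> polytime (\<lambda>x. cap s (f x))"
  by (erule polytime_comp[rotated], unfold cap_def[abs_def], intro polytime_intros)

lemma polytime_scaled [polytime_intros]: "polytime f \<Longrightarrow> polytime g \<Longrightarrow> polytime (\<lambda>x. scaled s (f x) (g x))"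
proof (rule polytime_lift2[of "scaled s"])
  have sub: "size (enc (foldl (\<lambda>c y. if P c y then y # c else c) [] ys)) \<le> size (enc ys)"
    for P and ys :: "data list"
    by (induction ys rule: rev_induct) auto
  have "polytime (\<lambda>z. foldl (\<lambda>c y. if sum_list (map (\<lambda>_. total (fst z)) (y # c)) \<le>
      sum_list (map (\<lambda>_. snd z) (scale s (fst z))) then y # c else c) [] (cap s (fst z)))"
  proof (rule polytime_foldl[where h = "\<lambda>z. size (enc (cap s (fst z)))"])
    show "size (enc (foldl (\<lambda>c y. if sum_list (map (\<lambda>_. total (fst z)) (y # c)) \<le>
        sum_list (map (\<lambda>_. snd z) (scale s (fst z))) then y # c else c) [] (take n (cap s (fst z)))))
        \<le> size (enc (cap s (fst z)))" for z n
      by (rule order_trans[OF sub size_enc_take_le])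
  qed (intro polytime_intros polytime_size)+
  then show "polytime (\<lambda>z. scaled s (fst z) (snd z))"
    unfolding scaled_def by (intro polytime_intros)
qed

lemma polytime_kedges [polytime_intros]: "polytime f \<Longrightarrow> polytime (\<lambda>x. kedges s (f x))"
  by (erule polytime_comp[rotated], unfold kedges_def[abs_def], intro polytime_intros)

lemma polytime_kernel [polytime_intros]: "polytime f \<Longrightarrow> polytime (\<lambda>x. kernel s (f x))"
  by (erule polytime_comp[rotated], unfold kernel_def[abs_def], intro polytime_intros)


subsection \<open>Solution lifting\<close>

text \<open>The code of a tree may give an edge in either direction and repeatedly; running over the
  pairs with \<open>u < v\<close> takes each edge once.\<close>

definition used_arcs :: "nat \<Rightarrow> instance_code \<Rightarrow> data \<Rightarrow> arc list" where
  "used_arcs s x t = concat (map (\<lambda>u. concat (map (\<lambda>v. shortest_path (fst x) u v)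
    (filter (\<lambda>v. u < v \<and> (\<exists>e\<in>set (to_list (right t)).
        to_nat (left e) = name s x u \<and> to_nat (right e) = name s x v \<or>
        to_nat (left e) = name s x v \<and> to_nat (right e) = name s x u))
      (kverts s x)))) (kverts s x))"

definition both_ways :: "arc list \<Rightarrow> arc list" where
  "both_ways F = F @ map (\<lambda>c. (tgt c, src c, len c)) F"

text \<open>The last arcs of the stored paths form the predecessor tree of the search.\<close>

definition tree_edges :: "(nat \<times> arc list) list \<Rightarrow> (nat \<times> nat) list" where
  "tree_edges tbl = concat (map (\<lambda>e. case snd e of [] \<Rightarrow> [] | c # _ \<Rightarrow> [(src c, tgt c)]) tbl)"

text \<open>The code of a tree is copied from the code of the instance, so that it is not longer. The case
  of \<^term>\<open>Leaf\<close> is special as there the result has to have size 0.\<close>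

definition encode_tree :: "data \<Rightarrow> nat list \<Rightarrow> (nat \<times> nat) list \<Rightarrow> data" where
  "encode_tree I vs es = (if I = Leaf then Leaf else
    Node (enc (filter (\<lambda>c. to_nat c \<in> set vs) (to_list (left I))))
      (enc (map left (filter (\<lambda>d. \<exists>e\<in>set es.
        to_nat (left (left d)) = fst e \<and> to_nat (right (left d)) = snd e \<or>
        to_nat (left (left d)) = snd e \<and> to_nat (right (left d)) = fst e)
      (to_list (right (right I)))))))"

text \<open>\<open>grow\<close> serves here as the search for a spanning tree of the component of
  the root in the union of the paths.\<close>

definition lifted :: "nat \<Rightarrow> instance_code \<Rightarrow> data \<Rightarrow> data" where
  "lifted s x t = (let tbl = grow (both_ways (used_arcs s x t)) (root x) (verts (fst x)) in
    encode_tree (fst x) (map fst tbl) (tree_edges tbl))"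

lemma polytime_used_arcs [polytime_intros]: "polytime f \<Longrightarrow> polytime g \<Longrightarrow> polytime (\<lambda>x. used_arcs s (f x) (g x))"
proof (rule polytime_lift2[of "used_arcs s"])
  show "polytime (\<lambda>z. used_arcs s (fst z) (snd z))"
    unfolding used_arcs_def by (intro polytime_intros)
qed

lemma polytime_both_ways [polytime_intros]: "polytime f \<Longrightarrow> polytime (\<lambda>x. both_ways (f x))"
  by (erule polytime_comp[rotated], unfold both_ways_def[abs_def], intro polytime_intros)

lemma polytime_tree_edges [polytime_intros]: "polytime f \<Longrightarrow> polytime (\<lambda>x. tree_edges (f x))"
  by (erule polytime_comp[rotated], unfold tree_edges_def[abs_def], intro polytime_intros)

lemma polytime_encode_tree [polytime_intros]:
  "polytime f \<Longrightarrow> polytime g \<Longrightarrow> polytime h \<Longrightarrow> polytime (\<lambda>x. encode_tree (f x) (g x) (h x))"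
proof (rule polytime_lift3[of encode_tree])
  show "polytime (\<lambda>z. encode_tree (fst z) (fst (snd z)) (snd (snd z)))"
    unfolding encode_tree_def by (intro polytime_intros)
qed

lemma polytime_lifted [polytime_intros]: "polytime f \<Longrightarrow> polytime g \<Longrightarrow> polytime (\<lambda>x. lifted s (f x) (g x))"
proof (rule polytime_lift2[of "lifted s"])
  show "polytime (\<lambda>z. lifted s (fst z) (snd z))"
    unfolding lifted_def by (intro polytime_intros)
qed


section \<open>Correctness of the shortest path algorithm\<close>

primrec walk :: "arc set \<Rightarrow> nat \<Rightarrow> arc list \<Rightarrow> nat \<Rightarrow> bool" where
  "walk A r [] v \<longleftrightarrow> v = r"
| "walk A r (c # p) v \<longleftrightarrow> c \<in> A \<and> tgt c = v \<and> walk A r p (src c)"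

lemma walk_append: "walk A u q v \<Longrightarrow> walk A r p u \<Longrightarrow> walk A r (q @ p) v"
  by (induction q arbitrary: v) auto

lemma walk_mono: "walk A r p v \<Longrightarrow> A \<subseteq> B \<Longrightarrow> walk B r p v"
  by (induction p arbitrary: v) auto

lemma path_len_simps [simp]:
  "path_len [] = 0" "path_len (c # p) = len c + path_len p" "path_len (p @ q) = path_len p + path_len q"
  by (simp_all add: path_len_def)

definition flip :: "arc \<Rightarrow> arc" where
  "flip c = (tgt c, src c, len c)"

lemma flip_simps [simp]: "src (flip c) = tgt c" "tgt (flip c) = src c" "len (flip c) = len c"
  by (simp_all add: flip_def)

lemma walk_reverse:
  assumes "\<And>c. c \<in> A \<Longrightarrow> flip c \<in> A"
  shows "walk A r p v \<Longrightarrow> walk A v (rev (map flip p)) r"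
proof (induction p arbitrary: v)
  case (Cons c p)
  then have "walk A (src c) (rev (map flip p)) r" "walk A v [flip c] (src c)"
    using assms by auto
  from walk_append[OF this] show ?case by simp
qed simp

lemma path_len_reverse: "path_len (rev (map flip p)) = path_len p"
  by (induction p) auto

text \<open>The cut argument for Dijkstra's algorithm, with \<open>K\<close> the reached vertices: a
  competing walk has to use a crossing arc, and the rest of the walk has nonnegative length.\<close>

lemma walk_leaves:
  "walk A r q v \<Longrightarrow> r \<in> K \<Longrightarrow> v \<notin> K \<Longrightarrow>
    \<exists>c q'. c \<in> A \<and> src c \<in> K \<and> tgt c \<notin> K \<and> walk A r q' (src c) \<and> path_len (c # q') \<le> path_len q"
proof (induction q arbitrary: v)
  case (Cons c q)
  show ?case
  proof (cases "src c \<in> K")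
    case True
    then show ?thesis using Cons.prems by (intro exI[of _ c] exI[of _ q]) auto
  next
    case False
    with Cons.IH[of "src c"] Cons.prems obtain c' q' where
      "c' \<in> A" "src c' \<in> K" "tgt c' \<notin> K" "walk A r q' (src c')" "path_len (c' # q') \<le> path_len q"
      by auto
    then show ?thesis by (intro exI[of _ c'] exI[of _ q']) auto
  qed
qed auto

lemma in_crossing:
  "(src c, p) \<in> set tbl \<Longrightarrow> c \<in> set A \<Longrightarrow> tgt c \<notin> fst ` set tbl \<Longrightarrow> (tgt c, c # p) \<in> set (crossing A tbl)"
  unfolding set_crossing by (intro CollectI exI[of _ c] exI[of _ "src c"] exI[of _ p]) simp

lemma grow_cases:
  obtains "crossing A (grow A r V) = []" "grow A r (V @ [v]) = grow A r V"
  | c p where "(src c, p) \<in> set (grow A r V)" "c \<in> set A" "tgt c \<notin> fst ` set (grow A r V)"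
    "grow A r (V @ [v]) = (tgt c, c # p) # grow A r V"
    "\<And>e. e \<in> set (crossing A (grow A r V)) \<Longrightarrow> path_len (c # p) \<le> path_len (snd e)"
proof (cases "crossing A (grow A r V) = []")
  case True
  with that(1) show ?thesis by (simp add: grow_snoc)
next
  case False
  from select_min_cases[OF this] obtain e where e: "e \<in> set (crossing A (grow A r V))"
    "select_min (\<lambda>e. path_len (snd e)) (crossing A (grow A r V)) = [e]"
    "\<forall>z\<in>set (crossing A (grow A r V)). path_len (snd e) \<le> path_len (snd z)" by blast
  from e(1) obtain c p where "(src c, p) \<in> set (grow A r V)" "c \<in> set A"
    "tgt c \<notin> fst ` set (grow A r V)" "e = (tgt c, c # p)"
    by (auto simp: set_crossing)
  with e that(2) show ?thesis by (simp add: grow_snoc)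
qed

lemma grow_walk: "(v, p) \<in> set (grow A r V) \<Longrightarrow> walk (set A) r p v"
proof (induction V arbitrary: v p rule: rev_induct)
  case (snoc w V)
  then show ?case by (cases rule: grow_cases[of A r V w]) auto
qed auto

lemma root_in_grow: "r \<in> fst ` set (grow A r V)"
  by (induction V rule: rev_induct) (auto simp: grow_snoc image_Un)

lemma distinct_grow: "distinct (map fst (grow A r V))"
proof (induction V rule: rev_induct)
  case (snoc w V)
  then show ?case by (cases rule: grow_cases[of A r V w]) auto
qed auto

lemma grow_shortest:
  "(v, p) \<in> set (grow A r V) \<Longrightarrow> walk (set A) r q v \<Longrightarrow> path_len p \<le> path_len q"
proof (induction V arbitrary: v p q rule: rev_induct)
  case (snoc w V)
  show ?case
  proof (cases rule: grow_cases[of A r V w])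
    case 1
    then show ?thesis using snoc by auto
  next
    case (2 c p')
    show ?thesis
    proof (cases "(v, p) \<in> set (grow A r V)")
      case False
      then have vp: "v = tgt c" "p = c # p'" using 2 snoc.prems(1) by auto
      then have "v \<notin> fst ` set (grow A r V)" using 2(3) by simp
      \<comment> \<open>The competing walk leaves the table by an arc \<open>b\<close>. The stored
        path to \<open>src b\<close> is shortest by induction, and \<open>c\<close> was selected as
        no worse than the crossing by \<open>b\<close>.\<close>
      from walk_leaves[OF snoc.prems(2) root_in_grow this]
      obtain b q' where b: "b \<in> set A" "src b \<in> fst ` set (grow A r V)" "tgt b \<notin> fst ` set (grow A r V)"
        "walk (set A) r q' (src b)" "path_len (b # q') \<le> path_len q" by blast
      then obtain p'' where p'': "(src b, p'') \<in> set (grow A r V)" by auto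
      then have "(tgt b, b # p'') \<in> set (crossing A (grow A r V))"
        using b by (intro in_crossing)
      from 2(5)[OF this] have "path_len p \<le> len b + path_len p''" by (simp add: vp)
      with snoc.IH[OF p'' b(4)] b(5) show ?thesis by simp
    qed (use snoc in blast)
  qed
qed auto

text \<open>A round that finds no crossing leaves the table unchanged for good. So a crossing at the
  end means that every round has added an entry.\<close>

lemma length_grow_if_crossing:
  "crossing A (grow A r V) \<noteq> [] \<Longrightarrow> length (grow A r V) = Suc (length V)"
proof (induction V rule: rev_induct)
  case (snoc w V)
  show ?case
  proof (cases rule: grow_cases[of A r V w])
    case (2 c p)
    from in_crossing[OF 2(1-3)] have "crossing A (grow A r V) \<noteq> []" by auto
    with snoc 2(4) show ?thesis by simp
  qed (use snoc in simp)
qed auto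

text \<open>Otherwise all \<open>length V\<close> rounds would have succeeded, and together with the
  root there would be more distinct entries than vertices.\<close>

lemma grow_closed:
  assumes "tgt ` set A \<subseteq> set V" "r \<in> set V" "c \<in> set A" "src c \<in> fst ` set (grow A r V)"
  shows "tgt c \<in> fst ` set (grow A r V)"
proof (rule ccontr)
  assume "\<not> ?thesis"
  moreover obtain p where "(src c, p) \<in> set (grow A r V)" using assms(4) by auto
  ultimately have "(tgt c, c # p) \<in> set (crossing A (grow A r V))"
    using assms(3) by (intro in_crossing)
  then have "crossing A (grow A r V) \<noteq> []" by auto
  then have "Suc (length V) = length (grow A r V)" by (simp add: length_grow_if_crossing)
  also have "\<dots> = card (fst ` set (grow A r V))"
    using distinct_card[OF distinct_grow, of A r V] by simp
  also have "\<dots> \<le> card (set V)"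
  proof (intro card_mono subsetI)
    fix v assume "v \<in> fst ` set (grow A r V)"
    then obtain e where "e \<in> set (grow A r V)" "v = fst e" by auto
    with grow_entry[of e A r V] assms(1,2) show "v \<in> set V" by auto
  qed simp
  also have "\<dots> \<le> length V" by (rule card_length)
  finally show False by simp
qed

lemma grow_complete:
  assumes "tgt ` set A \<subseteq> set V" "r \<in> set V"
  shows "walk (set A) r q v \<Longrightarrow> v \<in> fst ` set (grow A r V)"
proof (induction q arbitrary: v)
  case Nil
  then show ?case using root_in_grow by simp
next
  case (Cons c q)
  then show ?case using grow_closed[OF assms, of c] by auto
qed

lemma shortest_path_correct:
  assumes "tgt ` set (arcs I) \<subseteq> set (verts I)" "u \<in> set (verts I)" "walk (set (arcs I)) u q v"
  shows "walk (set (arcs I)) u (shortest_path I u v) v" "distance I u v \<le> path_len q"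
proof -
  let ?t = "grow (arcs I) u (verts I)"
  from grow_complete[OF assms] obtain p where p: "(v, p) \<in> set ?t" by auto
  have "concat (map snd (filter (\<lambda>e. fst e = v) t)) = p" if "(v, p) \<in> set t" "distinct (map fst t)" for t
    using that
  proof (induction t)
    case (Cons e t)
    show ?case
    proof (cases "fst e = v")
      case True
      with Cons.prems(2) have *: "v \<notin> fst ` set t" by auto
      then have "filter (\<lambda>e. fst e = v) t = []" by (auto simp: filter_empty_conv)
      moreover have "e = (v, p)" using Cons.prems(1) * by force
      ultimately show ?thesis by simp
    next
      case False
      with Cons show ?thesis by auto
    qed
  qed simp
  from this[OF p distinct_grow] have "shortest_path I u v = p" by (simp add: shortest_path_def)
  with grow_walk[OF p] grow_shortest[OF p assms(3)]
  show "walk (set (arcs I)) u (shortest_path I u v) v" "distance I u v \<le> path_len q"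
    by (simp_all add: distance_def)
qed


section \<open>Spanning trees\<close>

definition edge_set :: "(nat \<times> nat) set \<Rightarrow> nat set set" where
  "edge_set es = (\<lambda>e. {fst e, snd e}) ` es"

lemma is_tree_single: "is_tree ({r}, {})"
  by (auto simp: is_tree_def connected_graph_def is_cycle_def intro!: exI[of _ 0])

text \<open>The new vertex \<open>b\<close> is a leaf: a cycle through it would need two different
  neighbours of \<open>b\<close>, but \<open>a\<close> is the only one.\<close>

lemma is_tree_extend:
  assumes tree: "is_tree (V, E)" and E: "\<And>e. e \<in> E \<Longrightarrow> e \<subseteq> V" and ab: "a \<in> V" "b \<notin> V"
  shows "is_tree (insert b V, insert {a, b} E)"
  unfolding is_tree_def
proof
  let ?r = "{(x, y). {x, y} \<in> E}" and ?r' = "{(x, y). {x, y} \<in> insert {a, b} E}"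
  have mono: "?r\<^sup>* \<subseteq> ?r'\<^sup>*" by (rule rtrancl_mono) auto
  have conn: "(u, v) \<in> ?r\<^sup>*" if "u \<in> V" "v \<in> V" for u v
    using tree that unfolding is_tree_def connected_graph_def by auto
  have ab': "(a, b) \<in> ?r'\<^sup>*" "(b, a) \<in> ?r'\<^sup>*" by (auto intro!: r_into_rtrancl simp: insert_commute)
  have a: "(u, a) \<in> ?r'\<^sup>* \<and> (a, u) \<in> ?r'\<^sup>*" if "u \<in> insert b V" for u
  proof (cases "u = b")
    case False
    with that ab(1) have "(u, a) \<in> ?r\<^sup>*" "(a, u) \<in> ?r\<^sup>*" using conn by auto
    with mono show ?thesis by blast
  qed (use ab' in simp)
  have "(u, v) \<in> ?r'\<^sup>*" if "u \<in> insert b V" "v \<in> insert b V" for u v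
    using a[OF that(1)] a[OF that(2)] rtrancl_trans by fast
  then show "connected_graph (insert b V, insert {a, b} E)" by (auto simp: connected_graph_def)
  show "\<nexists>c. is_cycle (insert b V, insert {a, b} E) c"
  proof
    assume "\<exists>c. is_cycle (insert b V, insert {a, b} E) c"
    then obtain c where c: "3 \<le> length c" "distinct c"
      "\<And>i. i < length c \<Longrightarrow> {c ! i, c ! (Suc i mod length c)} \<in> insert {a, b} E"
      by (auto simp: is_cycle_def)
    show False
    proof (cases "b \<in> set c")
      case False
      have "{c ! i, c ! (Suc i mod length c)} \<in> E" if "i < length c" for i
      proof -
        have "c ! i \<in> set c" "c ! (Suc i mod length c) \<in> set c"
          using that by (auto intro!: nth_mem mod_less_divisor)
        with False have "{c ! i, c ! (Suc i mod length c)} \<noteq> {a, b}" by (metis insertCI insertE singletonD)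
        with c(3)[OF that] show ?thesis by blast
      qed
      with c have "is_cycle (V, E) c" by (auto simp: is_cycle_def)
      with tree show False by (auto simp: is_tree_def)
    next
      case True
      then obtain i where i: "i < length c" "c ! i = b" by (auto simp: in_set_conv_nth)
      \<comment> \<open>\<open>k\<close> and \<open>j\<close> are the cyclic successor and
        predecessor of \<open>i\<close>; they differ because the cycle has length at least
        3.\<close>
      define k where "k = (if Suc i = length c then 0 else Suc i)"
      define j where "j = (if i = 0 then length c - 1 else i - 1)"
      have kj: "k < length c" "j < length c" "k \<noteq> j" "Suc i mod length c = k" "Suc j mod length c = i"
        using i(1) c(1) by (auto simp: k_def j_def)
      have "{b, c ! k} \<in> insert {a, b} E" "{c ! j, b} \<in> insert {a, b} E"
        using c(3)[OF i(1)] c(3)[OF kj(2)] kj i(2) by auto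
      moreover have "{b, c ! k} \<notin> E" "{c ! j, b} \<notin> E" using E ab(2) by (meson insertCI subsetD)+
      ultimately have "{b, c ! k} = {a, b}" "{c ! j, b} = {a, b}" by simp_all
      then have "c ! k = a" "c ! j = a" using ab by (auto simp: doubleton_eq_iff)
      with kj c(2) show False by (auto simp: nth_eq_iff_index_eq)
    qed
  qed
qed

lemma tree_edges_Cons: "tree_edges ((v, c # p) # tbl) = (src c, tgt c) # tree_edges tbl"
  by (simp add: tree_edges_def)

lemma grow_tree:
  defines "G \<equiv> \<lambda>A r V. (fst ` set (grow A r V), edge_set (set (tree_edges (grow A r V))))"
  shows "is_tree (G A r V) \<and> (\<forall>e\<in>snd (G A r V). e \<subseteq> fst (G A r V))
    \<and> snd (G A r V) \<subseteq> edge_set ((\<lambda>c. (src c, tgt c)) ` set A)"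
proof (induction V rule: rev_induct)
  case Nil
  show ?case by (simp add: G_def tree_edges_def edge_set_def is_tree_single)
next
  case (snoc w V)
  show ?case
  proof (cases rule: grow_cases[of A r V w])
    case 1
    then show ?thesis using snoc by (simp add: G_def)
  next
    case (2 c p)
    obtain VV E where VE: "G A r V = (VV, E)" by fastforce
    from 2(4) have *: "G A r (V @ [w]) = (insert (tgt c) VV, insert {src c, tgt c} E)"
      using VE by (simp add: G_def tree_edges_Cons edge_set_def)
    have "src c \<in> VV" "tgt c \<notin> VV" using 2(1,3) VE by (force simp: G_def)+
    moreover have "{src c, tgt c} \<in> edge_set ((\<lambda>c. (src c, tgt c)) ` set A)"
      unfolding edge_set_def image_image using 2(2) by (intro image_eqI[of _ _ c]) auto
    ultimately show ?thesis
      using snoc is_tree_extend[of VV E "src c" "tgt c"] unfolding * VE by auto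
  qed
qed

lemma set_both_ways: "set (both_ways F) = set F \<union> flip ` set F"
  by (auto simp: both_ways_def flip_def)

lemma edge_set_both_ways:
  "edge_set ((\<lambda>c. (src c, tgt c)) ` set (both_ways F)) = edge_set ((\<lambda>c. (src c, tgt c)) ` set F)"
  unfolding edge_set_def set_both_ways image_Un image_image flip_simps
  by (auto simp: insert_commute)

text \<open>Overlaps of paths only help: the tree pays once for an edge that the list may contain
  several times.\<close>

lemma sum_edge_set_le:
  fixes w :: "nat set \<Rightarrow> nat"
  assumes "E \<subseteq> edge_set ((\<lambda>c. (src c, tgt c)) ` set F)"
  shows "sum w E \<le> sum_list (map (\<lambda>c. w {src c, tgt c}) F)"
proof -
  have "sum w E \<le> sum w ((\<lambda>c. {src c, tgt c}) ` set F)"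
    using assms by (intro sum_mono2) (auto simp: edge_set_def image_image)
  also have "\<dots> \<le> (\<Sum>c\<in>set F. w {src c, tgt c})"
    by (rule order_trans[OF sum_image_le]) auto
  also have "\<dots> \<le> sum_list (map (\<lambda>c. w {src c, tgt c}) F)"
  proof (induction F)
    case (Cons c F)
    then show ?case by (cases "c \<in> set F") (simp_all add: insert_absorb)
  qed simp
  finally show ?thesis .
qed


section \<open>The metric of a feasible instance\<close>

lemma dedup_Nil_iff: "dedup xs = [] \<longleftrightarrow> xs = []"
  by (metis set_dedup set_empty)

locale valid_code =
  fixes I :: data and ks :: "data list"
  assumes valid: "valid_inst I"
    and terms_nonempty: "terms (I, ks) \<noteq> []"
begin

abbreviation "A \<equiv> set (arcs I)"
abbreviation "R \<equiv> set (terms (I, ks))"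
abbreviation "U \<equiv> set (component (I, ks))"
abbreviation "r0 \<equiv> root (I, ks)"
abbreviation "w \<equiv> inst_weight I"
abbreviation "d \<equiv> distance I"
abbreviation "P \<equiv> shortest_path I"

lemma fst_inst_graph: "fst (inst_graph I) = set (verts I)"
  by (simp add: inst_graph_def verts_def to_nat_set_def)

lemma edge_valid:
  assumes "e \<in> snd (inst_graph I)"
  shows "e \<subseteq> set (verts I)" "card e = 2"
proof -
  have "simple_graph (inst_graph I)" using valid by (simp add: valid_inst_def)
  with assms show "e \<subseteq> set (verts I)" "card e = 2"
    by (auto simp: simple_graph_def case_prod_beta fst_inst_graph)
qed

text \<open>Each edge is listed only once, so the weight in a list entry is the one that
  \<open>inst_weight\<close> looks up.\<close>

lemma in_arcs_iff: "c \<in> A \<longleftrightarrow> {src c, tgt c} \<in> snd (inst_graph I) \<and> len c = w {src c, tgt c}"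
proof -
  let ?L = "to_list (right (right I))"
  have dist: "distinct (map fst (inst_edges I))" using valid by (simp add: valid_inst_def)
  have w: "w (to_edge (left e)) = to_nat (right e)" if "e \<in> set ?L" for e
  proof -
    have "(to_edge (left e), to_nat (right e)) \<in> set (inst_edges I)"
      using that by (auto simp: inst_edges_def)
    then show ?thesis using map_of_is_SomeI[OF dist] by (simp add: inst_weight_def)
  qed
  have E: "snd (inst_graph I) = (\<lambda>e. to_edge (left e)) ` set ?L"
    by (simp add: inst_graph_def inst_edges_def image_image)
  have "c \<in> A \<longleftrightarrow> (\<exists>e\<in>set ?L. to_edge (left e) = {src c, tgt c} \<and> len c = to_nat (right e))"
    by (cases c) (auto simp: arcs_def Let_def to_edge_def doubleton_eq_iff)
  also have "\<dots> \<longleftrightarrow> (\<exists>e\<in>set ?L. to_edge (left e) = {src c, tgt c} \<and> len c = w {src c, tgt c})"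
    using w by metis
  finally show ?thesis unfolding E by auto
qed

lemma flip_in_arcs: "c \<in> A \<Longrightarrow> flip c \<in> A"
  by (auto simp: in_arcs_iff insert_commute)

lemma tgt_arcs: "tgt ` A \<subseteq> set (verts I)"
  using edge_valid(1) by (fastforce simp: in_arcs_iff)

lemma terms_verts: "R \<subseteq> set (verts I)"
proof -
  have "to_nat_set (left (right I)) \<subseteq> set (verts I)"
    using valid by (simp add: valid_inst_def inst_terminals_def fst_inst_graph)
  then show ?thesis
    by (cases "verts I") (auto simp: terms_def Let_def to_nat_set_def dedup_Nil_iff split: if_splits)
qed

lemma root_in_terms: "r0 \<in> R"
  using terms_nonempty by (auto simp: root_def split: list.splits)

lemma component_eq: "U = fst ` set (grow (arcs I) r0 (verts I))"
  by (simp add: component_def)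

lemma component_iff: "u \<in> U \<longleftrightarrow> (\<exists>q. walk A r0 q u)"
  using grow_complete[OF tgt_arcs, of r0] root_in_terms terms_verts grow_walk
  unfolding component_eq by fastforce

lemma component_verts: "U \<subseteq> set (verts I)"
  using grow_entry[of _ "arcs I" r0 "verts I"] root_in_terms terms_verts tgt_arcs
  unfolding component_eq by fastforce

end

text \<open>This is the form in which the existence of a Steiner tree enters. On \<open>U\<close>
  all paths exist, and the distances form a pseudometric.\<close>

locale feasible = valid_code +
  assumes terms_component: "R \<subseteq> U"
begin

lemma terms_in_component: "v \<in> R \<Longrightarrow> v \<in> U"
  using terms_component by auto

lemma root_in_component: "r0 \<in> U"
  using root_in_terms terms_in_component by blast

lemma path_walk:
  assumes "u \<in> U" "v \<in> U"
  shows "walk A u (P u v) v"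
proof -
  obtain p q where "walk A r0 p u" "walk A r0 q v" using assms component_iff by auto
  then have "walk A u (q @ rev (map flip p)) v"
    using walk_append walk_reverse flip_in_arcs by blast
  then show ?thesis
    using shortest_path_correct(1)[OF tgt_arcs] assms component_verts by auto
qed

lemma distance_le: "u \<in> U \<Longrightarrow> walk A u q v \<Longrightarrow> d u v \<le> path_len q"
  using shortest_path_correct(2)[OF tgt_arcs] component_verts by auto

lemma distance_refl: "u \<in> U \<Longrightarrow> d u u = 0"
  using distance_le[of u "[]" u] by simp

lemma distance_tri:
  assumes "u \<in> U" "v \<in> U" "x \<in> U"
  shows "d u x \<le> d u v + d v x"
proof -
  have "walk A u (P v x @ P u v) x"
    using path_walk assms walk_append by blast
  from distance_le[OF assms(1) this] show ?thesis by (simp add: distance_def)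
qed

lemma distance_sym:
  assumes "u \<in> U" "v \<in> U"
  shows "d u v = d v u"
proof (rule antisym)
  have *: "d a b \<le> d b a" if "a \<in> U" "b \<in> U" for a b
    using distance_le[OF that(1) walk_reverse[OF flip_in_arcs path_walk[OF that(2,1)]]]
    by (simp add: path_len_reverse distance_def)
  show "d u v \<le> d v u" "d v u \<le> d u v" using * assms by auto
qed

lemma edge_distance:
  assumes "{a, b} \<in> snd (inst_graph I)" "a \<in> U"
  shows "b \<in> U" "d a b \<le> w {a, b}"
proof -
  have c: "(a, b, w {a, b}) \<in> A" using assms(1) by (simp add: in_arcs_iff)
  obtain q where "walk A r0 q a" using assms(2) component_iff by auto
  with c have "walk A r0 ((a, b, w {a, b}) # q) b" by simp
  then show "b \<in> U" using component_iff by blast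
  have "walk A a [(a, b, w {a, b})] b" using c by simp
  from distance_le[OF assms(2) this] show "d a b \<le> w {a, b}" by simp
qed


subsection \<open>Trees of bounded depth\<close>

abbreviation "C j v t \<equiv> fst (best j (I, ks) v t)"
abbreviation "inner j v t \<equiv> set (snd (best j (I, ks) v t))"
abbreviation "Sh j \<equiv> set (shapes j (I, ks))"

primrec shape_tips :: "nat \<Rightarrow> data \<Rightarrow> nat set" where
  "shape_tips 0 t = {to_nat t}"
| "shape_tips (Suc j) t = shape_tips j (left t) \<union> shape_tips j (right t)"

lemma best_Suc:
  obtains u where "u \<in> U" "C (Suc j) v t = d v u + C j u (left t) + C j u (right t)"
    "inner (Suc j) v t = insert u (inner j u (left t) \<union> inner j u (right t))"
    "\<And>u'. u' \<in> U \<Longrightarrow> C (Suc j) v t \<le> d v u' + C j u' (left t) + C j u' (right t)"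
proof -
  define f where "f u = (d v u + C j u (left t) + C j u (right t),
      u # snd (best j (I, ks) u (left t)) @ snd (best j (I, ks) u (right t)))" for u
  have "map f (component (I, ks)) \<noteq> []" using root_in_component by auto
  from select_min_cases[OF this, of fst] obtain u where u: "u \<in> U"
    "select_min fst (map f (component (I, ks))) = [f u]" "\<forall>u'\<in>U. fst (f u) \<le> fst (f u')" by auto
  have "best (Suc j) (I, ks) v t = f u"
    using u(2) by (simp add: Let_def f_def[abs_def])
  with u that[of u] show ?thesis by (auto simp: f_def)
qed

lemma C_Suc_le:
  "u \<in> U \<Longrightarrow> C (Suc j) v t \<le> d v u + C j u (left t) + C j u (right t)"
  using best_Suc[of j v t] by metis

lemma shapes_Suc_cases:
  assumes "t \<in> Sh (Suc j)"
  obtains a b where "t = Node a b" "a \<in> Sh j" "b \<in> Sh j"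
  using assms by auto

lemma Node_in_shapes: "a \<in> Sh j \<Longrightarrow> b \<in> Sh j \<Longrightarrow> Node a b \<in> Sh (Suc j)"
  by auto

lemma shape_tips_terms: "t \<in> Sh j \<Longrightarrow> shape_tips j t \<subseteq> R"
  by (induction j arbitrary: t) (auto elim!: shapes_Suc_cases simp del: shapes.simps(2), auto)

text \<open>Only the edge from the hanging point to the first inner node changes. This is the price
  of moving a piece to another vertex.\<close>

lemma C_lipschitz:
  assumes "t \<in> Sh j" "v \<in> U" "u \<in> U"
  shows "C j v t \<le> d v u + C j u t"
proof (cases j)
  case 0
  then have "to_nat t \<in> U" using shape_tips_terms[OF assms(1)] terms_in_component by auto
  with distance_tri assms 0 show ?thesis by simp
next
  case (Suc i)
  obtain u' where u': "u' \<in> U" "C (Suc i) u t = d u u' + C i u' (left t) + C i u' (right t)"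
    by (rule best_Suc)
  from C_Suc_le[OF u'(1), of i v t] distance_tri[OF assms(2,3) u'(1)] u'(2) Suc
  show ?thesis by simp
qed

text \<open>With \<open>v\<close> at every inner node only the \<open>2 ^ j\<close> leaf edges cost
  anything.\<close>

lemma C_le:
  assumes "v \<in> U" "\<And>y. y \<in> shape_tips j t \<Longrightarrow> d v y \<le> D"
  shows "C j v t \<le> 2 ^ j * D"
  using assms(2)
proof (induction j arbitrary: t)
  case (Suc j)
  have "C j v (left t) \<le> 2 ^ j * D" "C j v (right t) \<le> 2 ^ j * D"
    using Suc by auto
  with C_Suc_le[OF assms(1), of j v t] distance_refl[OF assms(1)] show ?case by simp
qed simp

lemma inner_bound: "v \<in> U \<Longrightarrow> y \<in> inner j v t \<Longrightarrow> y \<in> U \<and> d v y \<le> C j v t"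
proof (induction j arbitrary: v t)
  case (Suc j)
  obtain u where u: "u \<in> U" "C (Suc j) v t = d v u + C j u (left t) + C j u (right t)"
    "inner (Suc j) v t = insert u (inner j u (left t) \<union> inner j u (right t))"
    by (rule best_Suc)
  from Suc.prems u(3) consider "y = u" | "y \<in> inner j u (left t)" | "y \<in> inner j u (right t)"
    by blast
  then show ?case
  proof cases
    case 2
    from Suc.IH[OF u(1) this] distance_tri[OF Suc.prems(1) u(1), of y] u(2) show ?thesis by simp
  next
    case 3
    from Suc.IH[OF u(1) this] distance_tri[OF Suc.prems(1) u(1), of y] u(2) show ?thesis by simp
  qed (use u in simp)
qed simp

text \<open>What a single leaf becomes when the next cut is still \<open>j\<close> levels away: a
  piece of cost 0.\<close>

primrec full :: "nat \<Rightarrow> nat \<Rightarrow> data" where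
  "full 0 y = enc y"
| "full (Suc j) y = Node (full j y) (full j y)"

lemma full_shape: "y \<in> R \<Longrightarrow> full j y \<in> Sh j"
  by (induction j) auto

lemma shape_tips_full: "shape_tips j (full j y) = {y}"
  by (induction j) auto

lemma C_full: "y \<in> U \<Longrightarrow> C j y (full j y) = 0"
  using C_le[of y j "full j y" 0] by (simp add: shape_tips_full distance_refl)

text \<open>Each leaf is replaced by an inner node at the same vertex with two copies of the leaf
  below it, at cost 0.\<close>

lemma pad_shape:
  "t \<in> Sh j \<Longrightarrow> \<exists>t'\<in>Sh (Suc j). shape_tips (Suc j) t' = shape_tips j t \<and> (\<forall>v. C (Suc j) v t' \<le> C j v t)"
proof (induction j arbitrary: t)
  case 0
  then have "to_nat t \<in> U" using shape_tips_terms[OF 0] terms_in_component by auto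
  with C_Suc_le[OF this, of 0 _ "Node t t"] 0 show ?case
    by (intro bexI[of _ "Node t t"]) (auto simp del: best.simps(2) simp: distance_refl)
next
  case (Suc j)
  obtain a b where ab: "t = Node a b" "a \<in> Sh j" "b \<in> Sh j"
    using Suc.prems by (rule shapes_Suc_cases)
  obtain a' b' where ab': "a' \<in> Sh (Suc j)" "shape_tips (Suc j) a' = shape_tips j a" "\<forall>v. C (Suc j) v a' \<le> C j v a"
    "b' \<in> Sh (Suc j)" "shape_tips (Suc j) b' = shape_tips j b" "\<forall>v. C (Suc j) v b' \<le> C j v b"
    using Suc.IH[OF ab(2)] Suc.IH[OF ab(3)] by blast
  have "C (Suc (Suc j)) v (Node a' b') \<le> C (Suc j) v t" for v
  proof -
    obtain u where u: "u \<in> U" "C (Suc j) v t = d v u + C j u (left t) + C j u (right t)"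
      by (rule best_Suc)
    have "C (Suc (Suc j)) v (Node a' b') \<le> d v u + C (Suc j) u a' + C (Suc j) u b'"
      using C_Suc_le[OF u(1), of "Suc j" v "Node a' b'"] by (simp only: data.sel)
    also have "\<dots> \<le> d v u + C j u a + C j u b" using ab' by (intro add_mono) auto
    finally show ?thesis using u(2) ab(1) by simp
  qed
  moreover have "shape_tips (Suc (Suc j)) (Node a' b') = shape_tips (Suc j) t"
    using ab ab' by (simp only: shape_tips.simps data.sel)
  ultimately show ?case using Node_in_shapes[OF ab'(1,4)] by blast
qed

lemma pad_shape_to:
  assumes "t \<in> Sh i" "i \<le> s"
  shows "\<exists>t'\<in>Sh s. shape_tips s t' = shape_tips i t \<and> (\<forall>v. C s v t' \<le> C i v t)"
  using assms(2)
proof (induction s rule: dec_induct)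
  case (step s)
  then obtain t' where t': "t' \<in> Sh s" "shape_tips s t' = shape_tips i t" "\<forall>v. C s v t' \<le> C i v t"
    by blast
  from pad_shape[OF t'(1)] obtain t'' where
    "t'' \<in> Sh (Suc s)" "shape_tips (Suc s) t'' = shape_tips s t'" "\<forall>v. C (Suc s) v t'' \<le> C s v t'"
    by blast
  with t' show ?case by (metis order_trans)
qed (use assms(1) in blast)

end


subsection \<open>Connections inside a set of vertices\<close>

locale kernelized = feasible +
  fixes s :: nat
  assumes s: "0 < s"
begin

abbreviation "K \<equiv> set (kverts s (I, ks))"

lemma terms_K: "R \<subseteq> K"
  by (auto simp: kverts_def)

lemma inner_K: "r \<in> R \<Longrightarrow> t \<in> Sh s \<Longrightarrow> inner s r t \<subseteq> K"
  by (force simp: kverts_def)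

lemma K_U: "K \<subseteq> U"
  using terms_in_component inner_bound by (auto simp: kverts_def) blast

definition links :: "(nat \<times> nat) list \<Rightarrow> nat" where
  "links F = sum_list (map (\<lambda>e. d (fst e) (snd e)) F)"

text \<open>The links are a list, so that connections can be joined by appending and their costs
  simply add, whether or not they overlap.\<close>

definition con :: "nat set \<Rightarrow> nat \<Rightarrow> bool" where
  "con X c \<longleftrightarrow> X \<subseteq> K \<and>
    (\<exists>F. set F \<subseteq> K \<times> K \<and> X \<times> X \<subseteq> (set F \<union> (set F)\<inverse>)\<^sup>* \<and> links F \<le> c)"

lemma con_mono: "con X c \<Longrightarrow> Y \<subseteq> X \<Longrightarrow> c \<le> c' \<Longrightarrow> con Y c'"
  unfolding con_def by (meson Sigma_mono order_trans)

lemma con_edge: "u \<in> K \<Longrightarrow> v \<in> K \<Longrightarrow> con {u, v} (d u v)"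
  unfolding con_def by (auto intro!: exI[of _ "[(u, v)]"] simp: links_def)

lemma con_union:
  assumes "con X c" "con Y c'" "z \<in> X" "z \<in> Y"
  shows "con (X \<union> Y) (c + c')"
proof -
  obtain F G where F: "set F \<subseteq> K \<times> K" "X \<times> X \<subseteq> (set F \<union> (set F)\<inverse>)\<^sup>*" "links F \<le> c"
    and G: "set G \<subseteq> K \<times> K" "Y \<times> Y \<subseteq> (set G \<union> (set G)\<inverse>)\<^sup>*" "links G \<le> c'"
    using assms(1,2) unfolding con_def by auto
  let ?H = "set (F @ G) \<union> (set (F @ G))\<inverse>"
  have "(set F \<union> (set F)\<inverse>)\<^sup>* \<subseteq> ?H\<^sup>*" "(set G \<union> (set G)\<inverse>)\<^sup>* \<subseteq> ?H\<^sup>*"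
    by (intro rtrancl_mono; auto)+
  then have z: "(x, z) \<in> ?H\<^sup>* \<and> (z, x) \<in> ?H\<^sup>*" if "x \<in> X \<union> Y" for x
    using that F(2) G(2) assms(3,4) by blast
  have "(X \<union> Y) \<times> (X \<union> Y) \<subseteq> ?H\<^sup>*"
  proof clarify
    fix a b assume "a \<in> X \<union> Y" "b \<in> X \<union> Y"
    with z[of a] z[of b] show "(a, b) \<in> ?H\<^sup>*" by (meson rtrancl_trans)
  qed
  moreover have "links (F @ G) \<le> c + c'" using F(3) G(3) by (simp add: links_def)
  moreover have "X \<union> Y \<subseteq> K" using assms unfolding con_def by blast
  ultimately show ?thesis unfolding con_def using F(1) G(1) by (intro conjI exI[of _ "F @ G"]) auto
qed

text \<open>Turns a piece into links of the kernel. The condition on inner nodes is met by pieces of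
  depth \<open>s\<close> that hang from a terminal.\<close>

lemma con_best:
  "v \<in> K \<Longrightarrow> inner j v t \<subseteq> K \<Longrightarrow> shape_tips j t \<subseteq> K \<Longrightarrow> con (insert v (shape_tips j t)) (C j v t)"
proof (induction j arbitrary: v t)
  case 0
  then show ?case using con_edge by simp
next
  case (Suc j)
  obtain u where u: "u \<in> U" "C (Suc j) v t = d v u + C j u (left t) + C j u (right t)"
    "inner (Suc j) v t = insert u (inner j u (left t) \<union> inner j u (right t))"
    by (rule best_Suc)
  then have "u \<in> K" "inner j u (left t) \<subseteq> K" "inner j u (right t) \<subseteq> K" using Suc.prems by auto
  moreover have "shape_tips j (left t) \<subseteq> K" "shape_tips j (right t) \<subseteq> K" using Suc.prems by auto
  ultimately have "con ({v, u} \<union> insert u (shape_tips j (left t)) \<union> insert u (shape_tips j (right t)))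
      (d v u + C j u (left t) + C j u (right t))"
    by (intro con_union[where z = u] con_edge Suc.IH Suc.prems) auto
  then show ?case unfolding u(2) by (rule con_mono) auto
qed


end


subsection \<open>Cutting a Steiner tree into small pieces\<close>

text \<open>This is the argument of Borchers and Du. Every inner node of a binary tree gets a path to a
  leaf: first to the right child and then always to the left. These paths are edge-disjoint, so for
  one of the residues modulo \<open>s\<close>, the paths of the nodes whose depth has this residue cost at most a
  fraction \<open>1 / s\<close> of the tree. The tree is cut at these nodes, and the paths connect the pieces again.\<close>

datatype btree = Tip nat | Branch nat btree btree

primrec top :: "btree \<Rightarrow> nat" where
  "top (Tip y) = y"
| "top (Branch v l r) = v"

primrec tips :: "btree \<Rightarrow> nat set" where
  "tips (Tip y) = {y}"
| "tips (Branch v l r) = tips l \<union> tips r"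

primrec nodes :: "btree \<Rightarrow> nat set" where
  "nodes (Tip y) = {y}"
| "nodes (Branch v l r) = insert v (nodes l \<union> nodes r)"

primrec left_tip :: "btree \<Rightarrow> nat" where
  "left_tip (Tip y) = y"
| "left_tip (Branch v l r) = left_tip l"

primrec portal :: "btree \<Rightarrow> nat" where
  "portal (Tip y) = y"
| "portal (Branch v l r) = left_tip r"

lemma top_in_nodes: "top t \<in> nodes t"
  by (cases t) auto

lemma tips_subset_nodes: "tips t \<subseteq> nodes t"
  by (induction t) auto

lemma left_tip_in_tips: "left_tip t \<in> tips t"
  by (induction t) auto

lemma portal_in_tips: "portal t \<in> tips t"
  using left_tip_in_tips by (cases t) auto

context kernelized
begin

primrec cost :: "btree \<Rightarrow> nat" where
  "cost (Tip y) = 0"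
| "cost (Branch v l r) = d v (top l) + d v (top r) + cost l + cost r"

primrec spine :: "btree \<Rightarrow> nat" where
  "spine (Tip y) = 0"
| "spine (Branch v l r) = d v (top l) + spine l"

primrec detour :: "btree \<Rightarrow> nat" where
  "detour (Tip y) = 0"
| "detour (Branch v l r) = d v (top r) + spine r"

text \<open>The cost of the paths of all nodes at the depths \<open>i\<close>, \<open>i + s\<close>, \<open>i + 2 * s\<close> and so on.\<close>

primrec level :: "btree \<Rightarrow> nat \<Rightarrow> nat" where
  "level (Tip y) i = 0"
| "level (Branch v l r) i = (if i = 0 then detour (Branch v l r) + level l (s - 1) + level r (s - 1)
    else level l (i - 1) + level r (i - 1))"

text \<open>Counting from depth \<open>s\<close> instead of \<open>0\<close> omits just the path of
  the root.\<close>

lemma level_0: "level t 0 = detour t + level t s"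
  using s by (cases t) auto

text \<open>The paths are edge-disjoint and none of them uses the leftmost branch from the root.
  Keeping this branch as \<open>spine t\<close> leaves room for the path that an ancestor may send
  through it.\<close>

lemma sum_level: "(\<Sum>i<s. level t i) + spine t \<le> cost t"
proof (induction t)
  case (Branch v l r)
  obtain m where m: "s = Suc m" using s by (cases s) auto
  then have m': "s - Suc 0 = m" by simp
  \<comment> \<open>Passing to a child lowers the residue by one cyclically, \<open>0\<close>
    becoming \<open>m\<close>. So the sum over all residues is again one over all residues of the
    children.\<close>
  have last: "(\<Sum>i<s. f i) = f m + (\<Sum>i<m. f i)" for f :: "nat \<Rightarrow> nat" by (subst m) simp
  have first: "(\<Sum>i<s. f i) = f 0 + (\<Sum>i<m. f (Suc i))" for f :: "nat \<Rightarrow> nat"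
    by (subst m) (rule sum.lessThan_Suc_shift)
  have "(\<Sum>i<s. level (Branch v l r) i) =
      detour (Branch v l r) + (\<Sum>i<s. level l i) + (\<Sum>i<s. level r i)"
    unfolding first[of "level (Branch v l r)"] last[of "level l"] last[of "level r"]
    by (simp add: m' sum.distrib)
  with Branch show ?case by simp
qed simp

lemma distance_left_tip: "nodes t \<subseteq> U \<Longrightarrow> d (top t) (left_tip t) \<le> spine t"
proof (induction t)
  case (Branch v l r)
  then have "v \<in> U" "top l \<in> U" "left_tip l \<in> U"
    using top_in_nodes[of l] left_tip_in_tips[of l] tips_subset_nodes[of l] by auto
  from distance_tri[OF this] Branch show ?case by simp
qed (simp add: distance_refl)

lemma distance_portal:
  assumes "nodes t \<subseteq> U"
  shows "d (top t) (portal t) \<le> detour t"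
proof (cases t)
  case (Branch v l r)
  with assms have "v \<in> U" "top r \<in> U" "left_tip r \<in> U"
    using top_in_nodes[of r] left_tip_in_tips[of r] tips_subset_nodes[of r] by auto
  from distance_tri[OF this] distance_left_tip[of r] assms Branch show ?thesis by simp
qed (use assms in \<open>simp add: distance_refl\<close>)

text \<open>\<open>i\<close> is the number of levels down to the next cut and \<open>\<tau>\<close>
  the unfinished piece at the top, still to be hung from something. The pieces below cost
  \<open>c'\<close> and connect all tips once the leaves of \<open>\<tau>\<close> are connected; the
  arbitrary \<open>X\<close> lets decompositions be chained.\<close>

definition decomposes :: "nat \<Rightarrow> btree \<Rightarrow> bool" where
  "decomposes i t \<longleftrightarrow> (\<exists>\<tau>\<in>Sh i. \<exists>c'.
    (\<forall>X c. con X c \<longrightarrow> shape_tips i \<tau> \<subseteq> X \<longrightarrow> con (X \<union> tips t) (c + c')) \<and>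
    C i (top t) \<tau> + c' \<le> cost t + 2 * level t i)"

text \<open>The cut: above, the portal replaces \<open>top t\<close> as a leaf; below, the finished
  piece is hung from the portal instead of \<open>top t\<close>. Each change costs at most
  \<open>detour t\<close>, whence the factor 2 in front of \<open>level\<close>.\<close>

lemma decomposes_0:
  assumes "decomposes s t" "nodes t \<subseteq> U" "tips t \<subseteq> R"
  shows "decomposes 0 t"
proof -
  obtain \<tau> c' where \<tau>: "\<tau> \<in> Sh s" "C s (top t) \<tau> + c' \<le> cost t + 2 * level t s"
    "\<And>X c. con X c \<Longrightarrow> shape_tips s \<tau> \<subseteq> X \<Longrightarrow> con (X \<union> tips t) (c + c')"
    using assms(1) unfolding decomposes_def by blast
  let ?p = "portal t"
  have p: "?p \<in> R" using portal_in_tips assms(3) by blast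
  then have pU: "?p \<in> U" and tU: "top t \<in> U"
    using terms_in_component top_in_nodes assms(2) by auto
  have piece: "con (insert ?p (shape_tips s \<tau>)) (C s ?p \<tau>)"
    using p terms_K inner_K[OF p \<tau>(1)] shape_tips_terms[OF \<tau>(1)] by (intro con_best) auto
  have "con (X \<union> tips t) (c + (C s ?p \<tau> + c'))" if "con X c" "?p \<in> X" for X c
  proof -
    have "con (X \<union> insert ?p (shape_tips s \<tau>)) (c + C s ?p \<tau>)"
      by (rule con_union[OF that(1) piece that(2)]) simp
    from \<tau>(3)[OF this] show ?thesis by (rule con_mono) auto
  qed
  moreover have "C 0 (top t) (enc ?p) + (C s ?p \<tau> + c') \<le> cost t + 2 * level t 0"
    using distance_portal[OF assms(2)] C_lipschitz[OF \<tau>(1) pU tU] \<tau>(2) distance_sym[OF pU tU]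
    by (simp add: level_0)
  moreover have "enc ?p \<in> Sh 0" using p by simp
  ultimately show ?thesis unfolding decomposes_def
    by (intro bexI[of _ "enc ?p"] exI[of _ "C s ?p \<tau> + c'"]) auto
qed

lemma decomposes_Suc:
  assumes "decomposes i l" "decomposes i r" "nodes (Branch v l r) \<subseteq> U"
  shows "decomposes (Suc i) (Branch v l r)"
proof -
  obtain \<tau>1 c1 where 1: "\<tau>1 \<in> Sh i" "C i (top l) \<tau>1 + c1 \<le> cost l + 2 * level l i"
    "\<And>X c. con X c \<Longrightarrow> shape_tips i \<tau>1 \<subseteq> X \<Longrightarrow> con (X \<union> tips l) (c + c1)"
    using assms(1) unfolding decomposes_def by blast
  obtain \<tau>2 c2 where 2: "\<tau>2 \<in> Sh i" "C i (top r) \<tau>2 + c2 \<le> cost r + 2 * level r i"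
    "\<And>X c. con X c \<Longrightarrow> shape_tips i \<tau>2 \<subseteq> X \<Longrightarrow> con (X \<union> tips r) (c + c2)"
    using assms(2) unfolding decomposes_def by blast
  have U: "v \<in> U" "top l \<in> U" "top r \<in> U" using assms(3) top_in_nodes by auto
  have "con (X \<union> tips (Branch v l r)) (c + (c1 + c2))"
    if "con X c" "shape_tips (Suc i) (Node \<tau>1 \<tau>2) \<subseteq> X" for X c
  proof -
    have "con (X \<union> tips l) (c + c1)" using that by (intro 1) auto
    then have "con (X \<union> tips l \<union> tips r) (c + c1 + c2)" using that by (intro 2) auto
    then show ?thesis by (simp add: Un_assoc add.assoc)
  qed
  \<comment> \<open>The inner node at the top of the joined piece is \<open>v\<close> itself, at
    distance 0.\<close>
  moreover have "C (Suc i) v (Node \<tau>1 \<tau>2) \<le> C i v \<tau>1 + C i v \<tau>2"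
    using C_Suc_le[OF U(1), of i v "Node \<tau>1 \<tau>2"] U(1) by (simp add: distance_refl del: best.simps)
  then have "C (Suc i) v (Node \<tau>1 \<tau>2) + (c1 + c2) \<le> cost (Branch v l r) + 2 * level (Branch v l r) (Suc i)"
    using C_lipschitz[OF 1(1) U(1,2)] C_lipschitz[OF 2(1) U(1,3)] 1(2) 2(2)
    by (simp del: best.simps)
  ultimately show ?thesis unfolding decomposes_def
    using Node_in_shapes[OF 1(1) 2(1)]
    by (intro bexI[of _ "Node \<tau>1 \<tau>2"] exI[of _ "c1 + c2"]) auto
qed

lemma decomposes:
  "nodes t \<subseteq> U \<Longrightarrow> tips t \<subseteq> R \<Longrightarrow> decomposes i t"
proof (induction t arbitrary: i)
  case (Tip y)
  then have "y \<in> R" by simp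
  moreover have "con X c \<Longrightarrow> shape_tips j (full j y) \<subseteq> X \<Longrightarrow> con (X \<union> tips (Tip y)) (c + 0)" for X c j
    by (simp add: shape_tips_full insert_absorb)
  ultimately show ?case unfolding decomposes_def
    using full_shape C_full[of y i] Tip by (intro bexI[of _ "full i y"] exI[of _ 0]) auto
next
  case (Branch v l r)
  have Suc: "decomposes (Suc i) (Branch v l r)" for i
    using Branch by (intro decomposes_Suc) auto
  \<comment> \<open>A cut at depth 0 needs the decomposition for depth \<open>s\<close>, which is
    positive and so already covered for a branch.\<close>
  obtain m where "s = Suc m" using s by (cases s) auto
  with Suc[of m] have "decomposes 0 (Branch v l r)" using Branch.prems by (intro decomposes_0) auto
  with Suc show ?case by (cases i) auto
qed

lemma con_terms:
  assumes "nodes t \<subseteq> U" "tips t = R"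
  shows "\<exists>c. con R c \<and> s * c \<le> (s + 2) * (d r0 (top t) + cost t)"
proof -
  \<comment> \<open>By \<open>sum_level\<close> the \<open>s\<close> possible offsets share the cost
    of the tree, so the cheapest is at most the average.\<close>
  have "\<exists>i<s. s * level t i \<le> cost t"
  proof (rule ccontr)
    assume "\<not> ?thesis"
    then have "(\<Sum>i<s. Suc (cost t)) \<le> (\<Sum>i<s. s * level t i)" by (intro sum_mono) auto
    also have "\<dots> = s * (\<Sum>i<s. level t i)" by (simp add: sum_distrib_left)
    also have "\<dots> \<le> s * cost t" using sum_level[of t] by (intro mult_le_mono2) simp
    finally show False using s by simp
  qed
  then obtain i where i: "i < s" "s * level t i \<le> cost t" by blast
  obtain \<tau> c' where \<tau>: "\<tau> \<in> Sh i" "C i (top t) \<tau> + c' \<le> cost t + 2 * level t i"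
    "\<And>X c. con X c \<Longrightarrow> shape_tips i \<tau> \<subseteq> X \<Longrightarrow> con (X \<union> tips t) (c + c')"
    using decomposes[of t i] assms unfolding decomposes_def by blast
  \<comment> \<open>The topmost piece has only depth \<open>i\<close>. It is padded because
    \<open>K\<close> is known to contain the inner nodes of pieces of depth
    \<open>s\<close>.\<close>
  obtain \<tau>' where \<tau>': "\<tau>' \<in> Sh s" "shape_tips s \<tau>' = shape_tips i \<tau>" "C s r0 \<tau>' \<le> C i r0 \<tau>"
    using pad_shape_to[OF \<tau>(1), of s] i(1) by auto
  have "con (insert r0 (shape_tips s \<tau>')) (C s r0 \<tau>')"
    using root_in_terms terms_K inner_K[OF root_in_terms \<tau>'(1)] shape_tips_terms[OF \<tau>'(1)]
    by (intro con_best) auto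
  then have "con (insert r0 (shape_tips s \<tau>') \<union> tips t) (C s r0 \<tau>' + c')"
    by (rule \<tau>(3)) (auto simp: \<tau>')
  then have "con R (C s r0 \<tau>' + c')" by (rule con_mono) (auto simp: assms)
  moreover have "C s r0 \<tau>' + c' \<le> d r0 (top t) + cost t + 2 * level t i"
    using \<tau>'(3) C_lipschitz[OF \<tau>(1) root_in_component, of "top t"] \<tau>(2) assms(1) top_in_nodes[of t]
    by auto
  then have "s * (C s r0 \<tau>' + c') \<le> s * (d r0 (top t) + cost t + 2 * level t i)" by simp
  then have "s * (C s r0 \<tau>' + c') \<le> (s + 2) * (d r0 (top t) + cost t)"
    using i(2) by (simp add: algebra_simps)
  ultimately show ?thesis by blast
qed

end


section \<open>Codes of trees\<close>

lemma size_left_right: "d \<noteq> Leaf \<Longrightarrow> size d = Suc (size (left d) + size (right d))"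
  by (cases d) auto

lemma size_left_le: "size (left d) \<le> size d" and size_right_le: "size (right d) \<le> size d"
  by (cases d; simp)+

lemma size_enc_filter_le: "size (enc (filter Q xs)) \<le> size (enc xs)"
  by (induction xs) auto

lemma size_enc_map_left_le: "size (enc (map left xs)) \<le> size (enc xs)"
  by (induction xs) (auto intro: add_mono size_left_le)

lemma size_encode_tree: "size (encode_tree J vs es) \<le> size J"
proof (cases "J = Leaf")
  case False
  have "size (enc (filter Q (to_list (left J)))) \<le> size (left J)" for Q
    using size_enc_filter_le[of Q "to_list (left J)"] by simp
  moreover have "size (enc (map left (filter Q (to_list (right (right J)))))) \<le> size (right J)" for Q
    using order_trans[OF size_enc_map_left_le size_enc_filter_le, of Q "to_list (right (right J))"]
      size_right_le[of "right J"] by simp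
  ultimately show ?thesis
    using size_left_right[OF False] False by (simp add: encode_tree_def add_mono)
qed (simp add: encode_tree_def)

lemma sol_graph_encode_tree:
  assumes "set vs \<subseteq> fst (inst_graph J)" "edge_set (set es) \<subseteq> snd (inst_graph J)"
  shows "sol_graph (encode_tree J vs es) = (set vs, edge_set (set es))"
proof -
  have enc_data: "(enc :: data \<Rightarrow> data) = (\<lambda>x. x)" by auto
  let ?V = "to_list (left J)" and ?E = "to_list (right (right J))"
  let ?Q = "\<lambda>d. \<exists>e\<in>set es. to_nat (left (left d)) = fst e \<and> to_nat (right (left d)) = snd e \<or>
        to_nat (left (left d)) = snd e \<and> to_nat (right (left d)) = fst e"
  have Q: "?Q d \<longleftrightarrow> to_edge (left d) \<in> edge_set (set es)" for d
    by (auto simp: edge_set_def to_edge_def doubleton_eq_iff)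
  have V: "to_nat ` {c \<in> set ?V. to_nat c \<in> set vs} = set vs"
    using assms(1) by (auto simp: inst_graph_def to_nat_set_def)
  have E: "to_edge ` left ` {c \<in> set ?E. to_edge (left c) \<in> edge_set (set es)} = edge_set (set es)"
    using assms(2) by (auto simp: inst_graph_def inst_edges_def image_image)
  show ?thesis
  proof (cases "J = Leaf")
    case True
    then have "set vs = {}" "edge_set (set es) = {}"
      using assms by (auto simp: inst_graph_def to_nat_set_def inst_edges_def)
    then show ?thesis by (simp add: encode_tree_def True sol_graph_def to_nat_set_def)
  next
    case False
    then have "sol_graph (encode_tree J vs es) = (to_nat ` {c \<in> set ?V. to_nat c \<in> set vs},
        to_edge ` left ` {c \<in> set ?E. ?Q c})"
      unfolding encode_tree_def sol_graph_def to_nat_set_def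
      by (simp only: if_False data.sel to_list_enc enc_data set_map set_filter image_ident)
    then show ?thesis unfolding Q V E .
  qed
qed

lemma edge_set_exists:
  assumes "finite E" "\<And>e. e \<in> E \<Longrightarrow> card e = 2"
  shows "\<exists>es. edge_set (set es) = E"
proof -
  have "\<forall>e\<in>E. \<exists>a b. e = {a, b}" using assms(2) by (meson card_2_iff)
  then obtain f g where "\<forall>e\<in>E. e = {f e, g e}" by metis
  then have *: "(\<lambda>e. {f e, g e}) ` E = E" by force
  obtain xs where "set xs = E" using finite_list[OF assms(1)] by blast
  with * have "edge_set (set (map (\<lambda>e. (f e, g e)) xs)) = E"
    by (simp add: edge_set_def image_image)
  then show ?thesis by blast
qed

text \<open>Ensures that the optimum over short codes is an optimum over all Steiner trees.\<close>

lemma tree_has_code: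
  assumes "subgraph T (inst_graph J)"
  shows "\<exists>s\<in>solutions (J, k). sol_graph s = T"
proof -
  obtain VT ET where T: "T = (VT, ET)" by fastforce
  have "finite VT" "VT \<subseteq> fst (inst_graph J)" "ET \<subseteq> snd (inst_graph J)"
    and ET: "\<And>e. e \<in> ET \<Longrightarrow> e \<subseteq> VT \<and> card e = 2"
    using assms by (auto simp: subgraph_def simple_graph_def T)
  moreover have "ET \<subseteq> Pow VT" using ET by auto
  then have "finite ET" using \<open>finite VT\<close> finite_subset by blast
  then obtain es where "edge_set (set es) = ET" using edge_set_exists[of ET] ET by auto
  moreover obtain vs where "set vs = VT" using finite_list[OF \<open>finite VT\<close>] by blast
  ultimately have "sol_graph (encode_tree J vs es) = T"
    by (simp add: sol_graph_encode_tree T)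
  moreover have "encode_tree J vs es \<in> solutions (J, k)"
    using size_encode_tree[of J vs es] by (simp add: solutions_def)
  ultimately show ?thesis by blast
qed


section \<open>Steiner trees as binary trees\<close>

definition edge_rel :: "nat set set \<Rightarrow> (nat \<times> nat) set" where
  "edge_rel E = {(a, b). {a, b} \<in> E}"

definition reach :: "nat set set \<Rightarrow> nat \<Rightarrow> nat set" where
  "reach E v = {y. (v, y) \<in> (edge_rel E)\<^sup>*}"

lemma sym_edge_rel: "sym ((edge_rel E)\<^sup>*)"
  by (rule sym_rtrancl) (auto simp: sym_def edge_rel_def insert_commute)

lemma edge_rel_mono: "E \<subseteq> F \<Longrightarrow> (edge_rel E)\<^sup>* \<subseteq> (edge_rel F)\<^sup>*"
  by (rule rtrancl_mono) (auto simp: edge_rel_def)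

lemma self_in_reach: "v \<in> reach E v"
  by (simp add: reach_def)

lemma reach_step: "y \<in> reach E v \<Longrightarrow> {y, z} \<in> E \<Longrightarrow> z \<in> reach E v"
  unfolding reach_def edge_rel_def by (auto intro: rtrancl_into_rtrancl)

lemma reach_eq: "y \<in> reach E v \<Longrightarrow> reach E y = reach E v"
  using sym_edge_rel[of E] unfolding reach_def sym_def by (blast intro: rtrancl_trans)

lemma reach_minus_edge:
  assumes "{v, u} \<in> E"
  shows "reach E v = reach (E - {{v, u}}) v \<union> reach (E - {{v, u}}) u" (is "_ = ?X \<union> ?Y")
proof
  show "reach E v \<subseteq> ?X \<union> ?Y"
  proof
    fix y assume "y \<in> reach E v"
    then have "(v, y) \<in> (edge_rel E)\<^sup>*" by (simp add: reach_def)
    then show "y \<in> ?X \<union> ?Y"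
    proof induction
      case (step y z)
      show ?case
      proof (cases "{y, z} = {v, u}")
        case True
        then show ?thesis using self_in_reach by (auto simp: doubleton_eq_iff)
      next
        case False
        then have "{y, z} \<in> E - {{v, u}}" using step.hyps(2) by (auto simp: edge_rel_def)
        then show ?thesis using step.IH reach_step by blast
      qed
    qed (simp add: self_in_reach)
  qed
  have "u \<in> reach E v" using assms self_in_reach reach_step by blast
  moreover have "reach (E - {{v, u}}) y \<subseteq> reach E y" for y
    using edge_rel_mono[of "E - {{v, u}}" E] by (auto simp: reach_def)
  ultimately show "?X \<union> ?Y \<subseteq> reach E v" using reach_eq by blast
qed

lemma reach_restrict: "reach {e \<in> E. e \<subseteq> reach E v} v = reach E v"
proof
  show "reach {e \<in> E. e \<subseteq> reach E v} v \<subseteq> reach E v"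
    using edge_rel_mono[of "{e \<in> E. e \<subseteq> reach E v}" E] by (auto simp: reach_def)
  show "reach E v \<subseteq> reach {e \<in> E. e \<subseteq> reach E v} v"
  proof
    fix y assume "y \<in> reach E v"
    then have "(v, y) \<in> (edge_rel E)\<^sup>*" by (simp add: reach_def)
    then show "y \<in> reach {e \<in> E. e \<subseteq> reach E v} v"
    proof induction
      case (step y z)
      then have "y \<in> reach E v" "{y, z} \<in> E" by (auto simp: reach_def edge_rel_def)
      then have "{y, z} \<in> {e \<in> E. e \<subseteq> reach E v}" using reach_step by auto
      with step.IH show ?case by (rule reach_step)
    qed (simp add: self_in_reach)
  qed
qed

context kernelized
begin

text \<open>Induction on the edges: removing an edge at \<open>v\<close> leaves a part at
  \<open>v\<close> and a part at its other end. As \<open>v\<close> may be split off repeatedly at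
  distance 0, any degree becomes binary; parts without terminals disappear, and the term
  \<open>d v (top t)\<close> allows shortcuts.\<close>

lemma tree_of_edges:
  assumes "finite E" "E \<subseteq> snd (inst_graph I)" "v \<in> U" "R \<inter> reach E v \<noteq> {}"
  shows "\<exists>t. tips t = R \<inter> reach E v \<and> nodes t \<subseteq> U \<and> d v (top t) + cost t \<le> sum w E"
  using assms
proof (induction "card E" arbitrary: E v rule: less_induct)
  case less
  show ?case
  proof (cases "\<exists>e\<in>E. v \<in> e")
    case False
    have "y = v" if "(v, y) \<in> (edge_rel E)\<^sup>*" for y
      using that False by (induction rule: rtrancl_induct) (auto simp: edge_rel_def)
    \<comment> \<open>The edges at \<open>v\<close> are used up. In this way a terminal inside the
      Steiner tree becomes a leaf.\<close>
    then have "reach E v = {v}" by (auto simp: reach_def)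
    with less.prems show ?thesis
      by (intro exI[of _ "Tip v"]) (auto simp: distance_refl)
  next
    case True
    then obtain e where e: "e \<in> E" "v \<in> e" by blast
    then have "card e = 2" using edge_valid(2) less.prems(2) by blast
    with e(2) obtain u where u: "e = {v, u}" "u \<noteq> v" by (auto simp: card_2_iff doubleton_eq_iff)
    have vu: "{v, u} \<in> snd (inst_graph I)" using e(1) u(1) less.prems(2) by auto
    note uU = edge_distance(1)[OF vu less.prems(3)] and du = edge_distance(2)[OF vu less.prems(3)]
    define E0 where "E0 = E - {{v, u}}"
    define X where "X = reach E0 v"
    define Y where "Y = reach E0 u"
    have XY: "reach E v = X \<union> Y"
      using reach_minus_edge[of v u E] e(1) u(1) by (simp add: X_def Y_def E0_def)
    have E0: "finite E0" "E0 \<subseteq> snd (inst_graph I)" "card E0 < card E"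
      using less.prems e(1) u(1) card_Diff1_less[of E "{v, u}"] by (auto simp: E0_def)
    have sumE: "sum w E = w {v, u} + sum w E0"
      using sum.remove[OF less.prems(1), of "{v, u}" w] e(1) u(1) by (simp add: E0_def)
    show ?thesis
    proof (cases "X \<inter> Y = {}")
      case False
      \<comment> \<open>The edge lies on a cycle, so dropping it does not change what is
        reachable.\<close>
      then have "X = Y" using reach_eq unfolding X_def Y_def by blast
      then have *: "reach E0 v = reach E v" using XY by (simp add: X_def)
      show ?thesis using less.hyps[OF E0(3,1,2) less.prems(3)] less.prems(4)
        unfolding * sumE by force
    next
      case True
      define E1 where "E1 = {e \<in> E0. e \<subseteq> X}"
      define E2 where "E2 = {e \<in> E0. e \<subseteq> Y}"
      have reach1: "reach E1 v = X" and reach2: "reach E2 u = Y"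
        unfolding E1_def E2_def X_def Y_def by (rule reach_restrict)+
      have fin: "finite E1" "finite E2" "E1 \<subseteq> snd (inst_graph I)" "E2 \<subseteq> snd (inst_graph I)"
        using E0 by (auto simp: E1_def E2_def)
      have "card E1 \<le> card E0" "card E2 \<le> card E0"
        using E0(1) by (auto simp: E1_def E2_def intro!: card_mono)
      then have less1: "card E1 < card E" "card E2 < card E" using E0(3) by auto
      have "E1 \<inter> E2 = {}"
      proof -
        have "e \<noteq> {}" if "e \<in> E0" for e using edge_valid(2)[of e] that E0(2) by auto
        then show ?thesis using True by (auto simp: E1_def E2_def)
      qed
      then have "sum w E1 + sum w E2 = sum w (E1 \<union> E2)" using fin by (simp add: sum.union_disjoint)
      also have "\<dots> \<le> sum w E0" using E0(1) by (intro sum_mono2) (auto simp: E1_def E2_def)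
      finally have sums: "w {v, u} + sum w E1 + sum w E2 \<le> sum w E" using sumE by simp
      note IH1 = less.hyps[OF less1(1) fin(1,3) less.prems(3), unfolded reach1]
        and IH2 = less.hyps[OF less1(2) fin(2,4) uU, unfolded reach2]
      consider "R \<inter> Y = {}" | "R \<inter> X = {}" "R \<inter> Y \<noteq> {}" | "R \<inter> X \<noteq> {}" "R \<inter> Y \<noteq> {}" by blast
      then show ?thesis
      proof cases
        case 1
        with IH1 less.prems(4) XY obtain t where
          "tips t = R \<inter> X" "nodes t \<subseteq> U" "d v (top t) + cost t \<le> sum w E1" by auto
        with 1 XY sums show ?thesis by (intro exI[of _ t]) auto
      next
        case 2
        with IH2 obtain t where
          t: "tips t = R \<inter> Y" "nodes t \<subseteq> U" "d u (top t) + cost t \<le> sum w E2" by auto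
        then have "top t \<in> U" using top_in_nodes by blast
        from distance_tri[OF less.prems(3) uU this] du t 2 XY sums show ?thesis
          by (intro exI[of _ t]) auto
      next
        case 3
        with IH1 IH2 obtain t1 t2 where
          t1: "tips t1 = R \<inter> X" "nodes t1 \<subseteq> U" "d v (top t1) + cost t1 \<le> sum w E1" and
          t2: "tips t2 = R \<inter> Y" "nodes t2 \<subseteq> U" "d u (top t2) + cost t2 \<le> sum w E2" by auto
        then have "top t2 \<in> U" using top_in_nodes by blast
        from distance_tri[OF less.prems(3) uU this] du t1 t2 XY sums less.prems(3) show ?thesis
          by (intro exI[of _ "Branch v t1 t2"]) (auto simp: distance_refl)
      qed
    qed
  qed
qed

lemma distance_top_tip: "nodes t \<subseteq> U \<Longrightarrow> y \<in> tips t \<Longrightarrow> d (top t) y \<le> cost t"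
proof (induction t)
  case (Branch v l r)
  then have U: "v \<in> U" "top l \<in> U" "top r \<in> U" "y \<in> U"
    using top_in_nodes[of l] top_in_nodes[of r] tips_subset_nodes[of l] tips_subset_nodes[of r] by auto
  from Branch.prems consider "y \<in> tips l" | "y \<in> tips r" by auto
  then show ?case
    using Branch distance_tri[OF U(1,2,4)] distance_tri[OF U(1,3,4)] by cases auto
qed (simp add: distance_refl)

lemma steiner_tree_btree:
  assumes "is_steiner_tree (inst_graph I) R T"
  obtains t where "tips t = R" "nodes t \<subseteq> U" "d r0 (top t) + cost t \<le> sum w (snd T)"
proof -
  obtain VT ET where T: "T = (VT, ET)" by fastforce
  have "finite VT" "ET \<subseteq> snd (inst_graph I)" "R \<subseteq> VT" "\<forall>e\<in>ET. e \<subseteq> VT"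
    and conn: "\<And>u v. u \<in> VT \<Longrightarrow> v \<in> VT \<Longrightarrow> v \<in> reach ET u"
    using assms by (auto simp: is_steiner_tree_def subgraph_def simple_graph_def T is_tree_def
      connected_graph_def reach_def edge_rel_def)
  moreover from this have "finite ET" by (meson PowI finite_Pow_iff finite_subset subsetI)
  moreover have "R \<inter> reach ET r0 = R" using calculation root_in_terms by blast
  ultimately show ?thesis
    using tree_of_edges[of ET r0] root_in_component root_in_terms terms_nonempty that T by auto
qed

lemma near_optimal_connection:
  assumes "is_steiner_tree (inst_graph I) R T"
  shows "\<exists>c. con R c \<and> s * c \<le> (s + 2) * sum w (snd T)"
proof -
  obtain t where t: "tips t = R" "nodes t \<subseteq> U" "d r0 (top t) + cost t \<le> sum w (snd T)"
    using steiner_tree_btree[OF assms] .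
  obtain c where "con R c" "s * c \<le> (s + 2) * (d r0 (top t) + cost t)"
    using con_terms[OF t(2,1)] by blast
  moreover have "(s + 2) * (d r0 (top t) + cost t) \<le> (s + 2) * sum w (snd T)"
    using t(3) by (rule mult_le_mono2)
  ultimately show ?thesis by (meson order_trans)
qed

lemma total_le:
  assumes "is_steiner_tree (inst_graph I) R T"
  shows "total (I, ks) \<le> length (terms (I, ks)) * sum w (snd T)"
proof -
  obtain t where t: "tips t = R" "nodes t \<subseteq> U" "d r0 (top t) + cost t \<le> sum w (snd T)"
    using steiner_tree_btree[OF assms] .
  have "d r0 y \<le> sum w (snd T)" if "y \<in> R" for y
    using distance_tri[OF root_in_component, of "top t" y] distance_top_tip[OF t(2), of y]
      t top_in_nodes[of t] terms_in_component that by fastforce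
  then show ?thesis
    unfolding total_def using sum_list_mono[of "terms (I, ks)" "d r0" "\<lambda>_. sum w (snd T)"]
    by (simp add: sum_list_triv)
qed

text \<open>Terminals are at most \<open>2 * total\<close> apart, so by \<open>C_le\<close> a piece
  has length at most \<open>2 ^ s * (2 * total)\<close>. One more \<open>total\<close> leads from
  the root to the terminal from which it hangs, and two vertices double the bound.\<close>

lemma distance_K_le:
  assumes "u \<in> K" "v \<in> K"
  shows "d u v \<le> (2 + 4 * 2 ^ s) * total (I, ks)"
proof -
  let ?A = "total (I, ks)"
  have R: "d r0 y \<le> ?A" if "y \<in> R" for y
    using that member_le_sum_list[of "d r0 y" "map (d r0) (terms (I, ks))"] by (simp add: total_def)
  have "d r0 y \<le> (1 + 2 * 2 ^ s) * ?A" if "y \<in> K" for y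
  proof (cases "y \<in> R")
    case True
    with R[OF True] show ?thesis by (simp add: trans_le_add1)
  next
    case False
    with that obtain r t where r: "r \<in> R" "t \<in> Sh s" "y \<in> inner s r t"
      by (auto simp: kverts_def)
    have rU: "r \<in> U" using r(1) terms_in_component by simp
    have "d r z \<le> 2 * ?A" if "z \<in> shape_tips s t" for z
    proof -
      have z: "z \<in> R" using that shape_tips_terms[OF r(2)] by blast
      show ?thesis
        using distance_tri[OF rU root_in_component terms_in_component[OF z]]
          distance_sym[OF rU root_in_component] R[OF z] R[OF r(1)] by simp
    qed
    from C_le[OF rU this] have "C s r t \<le> 2 ^ s * (2 * ?A)" .
    with inner_bound[OF rU r(3)] distance_tri[OF root_in_component rU, of y] R[OF r(1)]
    show ?thesis by (simp add: algebra_simps)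
  qed
  note bounds = this[OF assms(1)] this[OF assms(2)]
  have "u \<in> U" "v \<in> U" using assms K_U by auto
  with bounds distance_tri[of u r0 v] distance_sym[of u r0] root_in_component
  show ?thesis by (simp add: algebra_simps)
qed

end


section \<open>The kernel as an instance\<close>

text \<open>The \<open>Suc\<close> is for the artificial terminal, which occurs even if
  \<open>ks\<close> is empty.\<close>

lemma length_terms_le: "length (terms (I, ks)) \<le> Suc (length ks)"
  by (auto simp: terms_def Let_def split: list.split)

definition ordered_pairs :: "nat list \<Rightarrow> (nat \<times> nat) list" where
  "ordered_pairs xs = filter (\<lambda>e. fst e < snd e) (List.product xs xs)"

lemma set_ordered_pairs: "set (ordered_pairs xs) = {(u, v). u \<in> set xs \<and> v \<in> set xs \<and> u < v}"
  by (auto simp: ordered_pairs_def)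

lemma distinct_ordered_pairs: "distinct xs \<Longrightarrow> distinct (ordered_pairs xs)"
  by (simp add: ordered_pairs_def distinct_product)

lemma length_ordered_pairs_le: "length (ordered_pairs xs) \<le> length xs * length xs"
  unfolding ordered_pairs_def by (rule order_trans[OF length_filter_le]) (simp add: length_product)

text \<open>Turns the nested loops of \<open>kedges\<close> and \<open>used_arcs\<close> into maps
  over pairs, for which distinctness and sums are easy.\<close>

lemma concat_map_product:
  "concat (map (\<lambda>u. map (f u) (filter (\<lambda>v. Q u v) ys)) xs) =
    map (\<lambda>e. f (fst e) (snd e)) (filter (\<lambda>e. Q (fst e) (snd e)) (List.product xs ys))"
  by (induction xs) (auto simp: filter_map comp_def)

lemma concat_concat_map: "concat (map (\<lambda>u. concat (g u)) xs) = concat (concat (map g xs))"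
  by (induction xs) auto

lemma kedges_eq: "kedges s x = map (\<lambda>e. ((name s x (fst e), name s x (snd e)),
    scaled s x (distance (fst x) (fst e) (snd e)))) (ordered_pairs (kverts s x))"
  unfolding kedges_def ordered_pairs_def concat_map_product ..

lemma used_arcs_eq: "used_arcs s x t = concat (map (\<lambda>e. shortest_path (fst x) (fst e) (snd e))
    (filter (\<lambda>e. {name s x (fst e), name s x (snd e)} \<in> snd (sol_graph t)) (ordered_pairs (kverts s x))))"
proof -
  have *: "(\<exists>e\<in>set (to_list (right t)). to_nat (left e) = a \<and> to_nat (right e) = b \<or>
      to_nat (left e) = b \<and> to_nat (right e) = a) \<longleftrightarrow> {a, b} \<in> snd (sol_graph t)" for a b
    unfolding sol_graph_def to_edge_def snd_conv image_iff doubleton_eq_iff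
    by (intro bex_cong refl) blast
  let ?H = "\<lambda>u v. {name s x u, name s x v} \<in> snd (sol_graph t)"
  have "used_arcs s x t = concat (concat (map (\<lambda>u. map (shortest_path (fst x) u)
      (filter (\<lambda>v. u < v \<and> ?H u v) (kverts s x))) (kverts s x)))"
    unfolding used_arcs_def * by (rule concat_concat_map)
  also have "\<dots> = concat (map (\<lambda>e. shortest_path (fst x) (fst e) (snd e))
      (filter (\<lambda>e. fst e < snd e \<and> ?H (fst e) (snd e)) (List.product (kverts s x) (kverts s x))))"
    by (simp only: concat_map_product[of "shortest_path (fst x)" "\<lambda>u v. u < v \<and> ?H u v"])
  finally show ?thesis unfolding ordered_pairs_def filter_filter .
qed

text \<open>For \<open>a > 0\<close> the number \<open>m ys\<close> is \<open>b div a\<close>,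
  capped at \<open>length ys\<close>; for \<open>a = 0\<close> it is the cap.\<close>

lemma count_multiples:
  fixes a b :: nat
  defines "m \<equiv> \<lambda>ys. length (foldl (\<lambda>c y. if sum_list (map (\<lambda>_. a) (y # c)) \<le> b then y # c else c) [] ys)"
  shows "m ys \<le> length ys \<and> a * m ys \<le> b \<and> (m ys = length ys \<or> b < a * Suc (m ys))"
  unfolding m_def
proof (induction ys rule: rev_induct)
  case (snoc y ys)
  define c where "c = foldl (\<lambda>c y. if sum_list (map (\<lambda>_. a) (y # c)) \<le> b then y # c else c) [] ys"
  have "sum_list (map (\<lambda>_. a) (y # c)) = a * Suc (length c)" by (simp add: sum_list_triv)
  with snoc show ?case
    unfolding foldl_append foldl.simps c_def[symmetric] by (simp split: if_split) linarith
qed simp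

lemma length_filter_less:
  fixes u v :: nat
  assumes "u < v" "u \<in> set xs" "distinct xs"
  shows "length (filter (\<lambda>y. y < u) xs) < length (filter (\<lambda>y. y < v) xs)"
proof -
  have "card (set (filter (\<lambda>y. y < u) xs)) < card (set (filter (\<lambda>y. y < v) xs))"
    using assms by (intro psubset_card_mono) auto
  then show ?thesis
    unfolding distinct_card[OF distinct_filter[OF assms(3)]] .
qed

lemma image_pairs: "(\<lambda>e. f (fst e) (snd e)) ` {(u, v). Q u v} = {f u v |u v. Q u v}"
  by force

lemma path_len_concat: "path_len (concat ps) = sum_list (map path_len ps)"
  by (induction ps) auto

text \<open>Shortest paths are found in the whole instance, but the lifted solution may only use the
  arcs on the chosen ones.\<close>

lemma walk_own_arcs: "walk A u p v \<Longrightarrow> walk (set p) u p v"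
proof (induction p arbitrary: v)
  case (Cons c p)
  then have "walk (set p) u p (src c)" by simp
  then have "walk (set (c # p)) u p (src c)" by (rule walk_mono) auto
  with Cons.prems show ?case by simp
qed simp

context kernelized
begin

abbreviation "kv \<equiv> kverts s (I, ks)"
abbreviation "nm \<equiv> name s (I, ks)"
abbreviation "KI \<equiv> enc (kernel s (I, ks))"
abbreviation "\<omega> u v \<equiv> scaled s (I, ks) (d u v)"
abbreviation "tot \<equiv> total (I, ks)"
abbreviation "M \<equiv> length (scale s (I, ks))"

lemma distinct_kv: "distinct kv"
  by (simp add: kverts_def)

lemma M_eq: "M = length kv * (length kv * (length (terms (I, ks)) * s))"
  by (simp add: scale_def length_concat comp_def sum_list_triv)

lemma scaled_upper: "tot * \<omega> u v \<le> M * d u v"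
  using count_multiples[where a = tot and b = "M * d u v" and ys = "cap s (I, ks)"]
  by (simp add: scaled_def sum_list_triv)

lemma scaled_lower:
  assumes "u \<in> K" "v \<in> K"
  shows "M * d u v \<le> tot * Suc (\<omega> u v)"
proof -
  have "\<omega> u v = length (cap s (I, ks)) \<or> M * d u v < tot * Suc (\<omega> u v)"
    using count_multiples[where a = tot and b = "M * d u v" and ys = "cap s (I, ks)"]
    by (simp add: scaled_def sum_list_triv)
  \<comment> \<open>When the count reaches the cap, \<open>distance_K_le\<close> shows that rounding
    has lost nothing; this includes \<open>tot = 0\<close>, where the distance is 0.\<close>
  moreover have "M * d u v \<le> tot * \<omega> u v" if "\<omega> u v = length (cap s (I, ks))"
  proof -
    have "length (concat (map (\<lambda>_. scale s (I, ks)) (replicate n Leaf))) = n * M" for n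
      by (induction n) auto
    then have "\<omega> u v = (2 + 4 * 2 ^ s) * M" using that by (simp only: cap_def)
    moreover have "M * d u v \<le> M * ((2 + 4 * 2 ^ s) * tot)"
      by (rule mult_le_mono2[OF distance_K_le[OF assms]])
    ultimately show ?thesis by (simp only: ac_simps)
  qed
  ultimately show ?thesis by auto
qed

lemma name_less: "u \<in> K \<Longrightarrow> u < v \<Longrightarrow> nm u < nm v"
  unfolding name_def using length_filter_less distinct_kv by blast

lemma name_inj: "u \<in> K \<Longrightarrow> v \<in> K \<Longrightarrow> nm u = nm v \<longleftrightarrow> u = v"
  using name_less by (metis less_irrefl linorder_neqE_nat)

lemma name_edge_inj: "inj_on (\<lambda>e. {nm (fst e), nm (snd e)}) (set (ordered_pairs kv))"
proof (rule inj_onI)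
  fix e f assume "e \<in> set (ordered_pairs kv)" "f \<in> set (ordered_pairs kv)"
  then have K: "fst e \<in> K" "snd e \<in> K" "fst e < snd e" "fst f \<in> K" "snd f \<in> K" "fst f < snd f"
    by (auto simp: set_ordered_pairs)
  assume "{nm (fst e), nm (snd e)} = {nm (fst f), nm (snd f)}"
  then have "fst e = fst f \<and> snd e = snd f \<or> fst e = snd f \<and> snd e = fst f"
    using K name_inj unfolding doubleton_eq_iff by metis
  with K show "e = f" by (auto simp: prod_eq_iff)
qed

lemma inst_edges_kernel:
  "inst_edges KI = map (\<lambda>e. ({nm (fst e), nm (snd e)}, \<omega> (fst e) (snd e))) (ordered_pairs kv)"
  by (simp add: inst_edges_def kernel_def kedges_eq to_edge_def)

lemma inst_graph_kernel:
  "inst_graph KI = (nm ` K, {{nm u, nm v} |u v. u \<in> K \<and> v \<in> K \<and> u \<noteq> v})"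
proof -
  have "fst ` set (inst_edges KI) = {{nm u, nm v} |u v. u \<in> K \<and> v \<in> K \<and> u < v}"
    unfolding inst_edges_kernel set_map image_image fst_conv set_ordered_pairs by (rule image_pairs)
  also have "\<dots> = {{nm u, nm v} |u v. u \<in> K \<and> v \<in> K \<and> u \<noteq> v}" (is "?L = ?R")
  proof
    show "?R \<subseteq> ?L"
    proof
      fix e assume "e \<in> ?R"
      then obtain u v where e: "e = {nm u, nm v}" "u \<in> K" "v \<in> K" "u \<noteq> v" by blast
      show "e \<in> ?L"
      proof (cases "u < v")
        case False
        with e have "v < u" "e = {nm v, nm u}" by auto
        with e(2,3) show ?thesis by blast
      qed (use e in blast)
    qed
  qed auto
  finally show ?thesis
    by (simp add: inst_graph_def kernel_def to_nat_set_def image_image)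
qed

lemma inst_terminals_kernel: "inst_terminals KI = nm ` R"
  by (simp add: inst_terminals_def kernel_def to_nat_set_def image_image)

lemma distinct_edges_kernel: "distinct (map fst (inst_edges KI))"
  using name_edge_inj distinct_ordered_pairs[OF distinct_kv]
  by (simp add: inst_edges_kernel distinct_map comp_def)

lemma valid_kernel: "valid_inst KI"
  unfolding valid_inst_def
proof (intro conjI)
  show "simple_graph (inst_graph KI)"
    unfolding simple_graph_def inst_graph_kernel case_prod_conv
  proof (intro conjI ballI)
    fix e assume "e \<in> {{nm u, nm v} |u v. u \<in> K \<and> v \<in> K \<and> u \<noteq> v}"
    then obtain u v where "e = {nm u, nm v}" "u \<in> K" "v \<in> K" "u \<noteq> v" by blast
    then show "e \<subseteq> nm ` K" "card e = 2" by (simp_all add: name_inj)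
  qed simp
  show "inst_terminals KI \<subseteq> fst (inst_graph KI)"
    using terms_K by (auto simp: inst_terminals_kernel inst_graph_kernel)
qed (rule distinct_edges_kernel)

lemma card_terminals_kernel: "card (inst_terminals KI) \<le> Suc (length ks)"
proof -
  have "card (nm ` R) \<le> card R" by (rule card_image_le) simp
  also have "\<dots> \<le> length (terms (I, ks))" by (rule card_length)
  also have "\<dots> \<le> Suc (length ks)" by (rule length_terms_le)
  finally show ?thesis by (simp add: inst_terminals_kernel)
qed

lemma inst_weight_kernel:
  assumes "u \<in> K" "v \<in> K" "u \<noteq> v"
  shows "inst_weight KI {nm u, nm v} = \<omega> u v"
proof -
  have *: "inst_weight KI {nm u, nm v} = \<omega> u v" if "u \<in> K" "v \<in> K" "u < v" for u v
  proof -
    have "({nm u, nm v}, \<omega> u v) \<in> set (inst_edges KI)"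
      using that unfolding inst_edges_kernel set_map
      by (intro image_eqI[of _ _ "(u, v)"]) (auto simp: set_ordered_pairs)
    then show ?thesis using map_of_is_SomeI[OF distinct_edges_kernel] by (simp add: inst_weight_def)
  qed
  show ?thesis
  proof (cases "u < v")
    case False
    then have "v < u" using assms(3) by simp
    have "u \<in> U" "v \<in> U" using assms K_U by auto
    then have "d u v = d v u" by (rule distance_sym)
    with *[OF assms(2,1) \<open>v < u\<close>] show ?thesis by (simp add: insert_commute)
  qed (use * assms in blast)
qed

text \<open>A spanning tree of the links is no dearer than the links, and rounding down keeps the
  scaled cost below \<open>M * c\<close>.\<close>

lemma kernel_tree:
  assumes "con R c"
  shows "\<exists>T. is_steiner_tree (inst_graph KI) (nm ` R) T \<and> tot * sum (inst_weight KI) (snd T) \<le> M * c"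
proof -
  obtain F where F: "set F \<subseteq> K \<times> K" "R \<times> R \<subseteq> (set F \<union> (set F)\<inverse>)\<^sup>*" "links F \<le> c"
    using assms unfolding con_def by blast
  \<comment> \<open>\<open>con\<close> admits links from a vertex to itself, which are no edges of a
    simple graph.\<close>
  define F1 where "F1 = filter (\<lambda>e. fst e \<noteq> snd e) F"
  define F2 where "F2 = map (\<lambda>e. (nm (fst e), nm (snd e), \<omega> (fst e) (snd e))) F1"
  define B where "B = both_ways F2"
  define tbl where "tbl = grow B (nm r0) (map nm kv)"
  define T where "T = (fst ` set tbl, edge_set (set (tree_edges tbl)))"
  have F1: "e \<in> set F1 \<longleftrightarrow> e \<in> set F \<and> fst e \<noteq> snd e" for e by (auto simp: F1_def)
  have FK: "fst e \<in> K \<and> snd e \<in> K \<and> fst e \<noteq> snd e" if "e \<in> set F1" for e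
    using subsetD[OF F(1), of e] F1[of e] that by (simp add: mem_Times_iff)
  have tgtB: "tgt ` set B \<subseteq> set (map nm kv)"
  proof
    fix y assume "y \<in> tgt ` set B"
    then obtain e where "e \<in> set F1" "y = nm (fst e) \<or> y = nm (snd e)"
      by (auto simp: B_def set_both_ways F2_def)
    with FK[of e] show "y \<in> set (map nm kv)" by auto
  qed
  have rK: "r0 \<in> K" using root_in_terms terms_K by blast
  have tree: "is_tree T" "\<forall>e\<in>snd T. e \<subseteq> fst T"
    and edges: "snd T \<subseteq> edge_set ((\<lambda>c. (src c, tgt c)) ` set F2)"
    using grow_tree[of B "nm r0" "map nm kv"] edge_set_both_ways[of F2]
    by (simp_all add: T_def tbl_def B_def)
  have edges': "\<exists>u v. e = {nm u, nm v} \<and> u \<in> K \<and> v \<in> K \<and> u \<noteq> v" if "e \<in> snd T" for e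
  proof -
    from that edges obtain f where "f \<in> set F1" "e = {nm (fst f), nm (snd f)}"
      by (auto simp: edge_set_def F2_def)
    with FK[of f] show ?thesis by blast
  qed
  have vertices: "fst T \<subseteq> nm ` K"
  proof
    fix y assume "y \<in> fst T"
    then obtain e where "e \<in> set tbl" "y = fst e" by (auto simp: T_def)
    with grow_entry[of e B "nm r0" "map nm kv"] tgtB rK show "y \<in> nm ` K" by (auto simp: tbl_def)
  qed
  have "subgraph T (inst_graph KI)"
    unfolding subgraph_def inst_graph_kernel
  proof (intro conjI)
    show "simple_graph T"
      unfolding simple_graph_def case_prod_beta
    proof (intro conjI ballI)
      fix e assume e: "e \<in> snd T"
      then show "e \<subseteq> fst T" using tree(2) by blast
      obtain u v where "e = {nm u, nm v}" "u \<in> K" "v \<in> K" "u \<noteq> v" using edges'[OF e] by blast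
      then show "card e = 2" by (simp add: name_inj)
    qed (simp add: T_def)
  qed (use vertices edges' in auto)
  moreover have "nm ` R \<subseteq> fst T"
  proof clarify
    fix y assume "y \<in> R"
    then have "(r0, y) \<in> (set F \<union> (set F)\<inverse>)\<^sup>*" using F(2) root_in_terms by blast
    then have "\<exists>q. walk (set B) (nm r0) q (nm y)"
    proof induction
      case base
      show ?case by (intro exI[of _ "[]"]) simp
    next
      case (step y z)
      then obtain q where q: "walk (set B) (nm r0) q (nm y)" by blast
      show ?case
      proof (cases "y = z")
        case False
        have "(nm y, nm z, \<omega> y z) \<in> set B" if "(y, z) \<in> set F1"
          using that unfolding B_def set_both_ways F2_def set_map
          by (intro UnI1 image_eqI[of _ _ "(y, z)"]) auto
        moreover have "(nm y, nm z, \<omega> z y) \<in> set B" if "(z, y) \<in> set F1"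
          using that unfolding B_def set_both_ways F2_def set_map image_image
          by (intro UnI2 image_eqI[of _ _ "(z, y)"]) (auto simp: flip_def)
        moreover have "(y, z) \<in> set F1 \<or> (z, y) \<in> set F1"
          using step.hyps(2) False by (auto simp: F1)
        ultimately obtain l where "(nm y, nm z, l) \<in> set B" by blast
        with q have "walk (set B) (nm r0) ((nm y, nm z, l) # q) (nm z)" by simp
        then show ?thesis by blast
      qed (use q in blast)
    qed
    then show "nm y \<in> fst T"
      using grow_complete[OF tgtB] rK by (auto simp: T_def tbl_def)
  qed
  ultimately have "is_steiner_tree (inst_graph KI) (nm ` R) T"
    using tree(1) by (simp add: is_steiner_tree_def)
  moreover have "tot * sum (inst_weight KI) (snd T) \<le> M * c"
  proof -
    have "sum (inst_weight KI) (snd T) \<le> sum_list (map (\<lambda>c. inst_weight KI {src c, tgt c}) F2)"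
      by (rule sum_edge_set_le[OF edges])
    also have "\<dots> = sum_list (map (\<lambda>e. \<omega> (fst e) (snd e)) F1)"
      unfolding F2_def map_map comp_def
      by (intro arg_cong[of _ _ sum_list] map_cong refl) (use FK inst_weight_kernel in auto)
    finally have "tot * sum (inst_weight KI) (snd T) \<le> sum_list (map (\<lambda>e. tot * \<omega> (fst e) (snd e)) F1)"
      by (simp add: sum_list_const_mult)
    also have "\<dots> \<le> sum_list (map (\<lambda>e. M * d (fst e) (snd e)) F1)"
      by (intro sum_list_mono scaled_upper)
    also have "\<dots> = M * sum_list (map (\<lambda>e. d (fst e) (snd e)) F1)" by (simp add: sum_list_const_mult)
    also have "sum_list (map (\<lambda>e. d (fst e) (snd e)) F1) \<le> links F"
      unfolding F1_def links_def by (induction F) auto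
    finally show ?thesis using F(3) by (meson mult_le_mono2 order_trans)
  qed
  ultimately show ?thesis by blast
qed

text \<open>The term \<open>length kv * length kv\<close> is the rounding error: at most one unit
  for each kernel edge in use, by \<open>scaled_lower\<close>.\<close>

lemma lifted_tree:
  assumes "is_steiner_tree (inst_graph KI) (nm ` R) (sol_graph t)"
  shows "is_steiner_tree (inst_graph I) R (sol_graph (lifted s (I, ks) t))"
    and "M * sum w (snd (sol_graph (lifted s (I, ks) t)))
      \<le> tot * (sum (inst_weight KI) (snd (sol_graph t)) + length kv * length kv)"
proof -
  define E where "E = snd (sol_graph t)"
  define Q where "Q = filter (\<lambda>e. {nm (fst e), nm (snd e)} \<in> E) (ordered_pairs kv)"
  define F where "F = used_arcs s (I, ks) t"
  define B where "B = both_ways F"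
  define tbl where "tbl = grow B r0 (verts I)"
  have F_eq: "F = concat (map (\<lambda>e. P (fst e) (snd e)) Q)"
    by (simp add: F_def used_arcs_eq Q_def E_def)
  have Q: "e \<in> set Q \<longleftrightarrow> fst e \<in> K \<and> snd e \<in> K \<and> fst e < snd e \<and> {nm (fst e), nm (snd e)} \<in> E" for e
    by (cases e) (auto simp: Q_def set_ordered_pairs)
  have walk_P: "walk A u (P u v) v" if "u \<in> K" "v \<in> K" for u v
    using that K_U path_walk by auto
  have arcs_P: "set (P u v) \<subseteq> A" if "u \<in> K" "v \<in> K" for u v
  proof -
    have "set p \<subseteq> A" if "walk A u p v" for p using that by (induction p arbitrary: v) auto
    then show ?thesis using walk_P that by blast
  qed
  have FA: "set F \<subseteq> A" using arcs_P Q by (auto simp: F_eq)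
  have BA: "set B \<subseteq> A" using FA flip_in_arcs by (auto simp: B_def set_both_ways)
  then have tgtB: "tgt ` set B \<subseteq> set (verts I)" using tgt_arcs by blast
  have flipB: "flip c \<in> set B" if "c \<in> set B" for c
  proof -
    have "flip (flip c') = c'" for c' by (simp add: flip_def)
    moreover obtain c' where "c' \<in> set F" "c = c' \<or> c = flip c'"
      using \<open>c \<in> set B\<close> unfolding B_def set_both_ways by blast
    ultimately show ?thesis unfolding B_def set_both_ways by (metis UnCI imageI)
  qed
  have rV: "r0 \<in> set (verts I)" using root_in_terms terms_verts by blast
  let ?T = "(fst ` set tbl, edge_set (set (tree_edges tbl)))"
  have tree: "is_tree ?T" "\<forall>e\<in>snd ?T. e \<subseteq> fst ?T"
    and edges: "snd ?T \<subseteq> edge_set ((\<lambda>c. (src c, tgt c)) ` set F)"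
    using grow_tree[of B r0 "verts I"] edge_set_both_ways[of F]
    by (simp_all add: tbl_def B_def)
  have vertices: "fst ` set tbl \<subseteq> set (verts I)"
  proof
    fix y assume "y \<in> fst ` set tbl"
    then obtain e where "e \<in> set tbl" "y = fst e" by auto
    with grow_entry[of e B r0 "verts I"] tgtB rV show "y \<in> set (verts I)" by (auto simp: tbl_def)
  qed
  have edges': "snd ?T \<subseteq> snd (inst_graph I)"
  proof
    fix e assume "e \<in> snd ?T"
    then have "e \<in> edge_set ((\<lambda>c. (src c, tgt c)) ` set F)" using edges by blast
    then obtain c where "c \<in> set F" "e = {src c, tgt c}" by (auto simp: edge_set_def)
    with FA in_arcs_iff show "e \<in> snd (inst_graph I)" by blast
  qed
  have "sol_graph (lifted s (I, ks) t) = (set (map fst tbl), edge_set (set (tree_edges tbl)))"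
    unfolding lifted_def Let_def fst_conv F_def[symmetric] B_def[symmetric] tbl_def[symmetric]
    using vertices edges' by (intro sol_graph_encode_tree) (auto simp: fst_inst_graph)
  then have sol: "sol_graph (lifted s (I, ks) t) = ?T" by simp
  have EK: "\<exists>u v. e = {nm u, nm v} \<and> u \<in> K \<and> v \<in> K \<and> u < v" if "e \<in> E" for e
  proof -
    have "e \<in> snd (inst_graph KI)"
      using that assms by (auto simp: E_def is_steiner_tree_def subgraph_def)
    then obtain u v where uv: "e = {nm u, nm v}" "u \<in> K" "v \<in> K" "u \<noteq> v"
      by (auto simp: inst_graph_kernel)
    show ?thesis
    proof (cases "u < v")
      case False
      with uv have "v < u" "e = {nm v, nm u}" by auto
      with uv(2,3) show ?thesis by blast
    qed (use uv in blast)
  qed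
  have reachable: "\<exists>q. walk (set B) r0 q y" if "y \<in> R" for y
  proof -
    have "(nm r0, nm y) \<in> {(x, y). {x, y} \<in> E}\<^sup>*"
    proof -
      have "nm r0 \<in> fst (sol_graph t)" "nm y \<in> fst (sol_graph t)"
        using assms that root_in_terms by (auto simp: is_steiner_tree_def)
      moreover have "connected_graph (sol_graph t)"
        using assms by (simp add: is_steiner_tree_def is_tree_def)
      ultimately show ?thesis by (simp add: connected_graph_def E_def case_prod_beta)
    qed
    \<comment> \<open>The vertices met on the way are names; \<open>z\<close> is the kernel vertex
      behind the current one.\<close>
    then have "\<exists>z\<in>K. nm y = nm z \<and> (\<exists>q. walk (set B) r0 q z)"
    proof induction
      case base
      show ?case using root_in_terms terms_K by (intro bexI[of _ r0] conjI exI[of _ "[]"]) auto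
    next
      case (step y y')
      then obtain z q where z: "z \<in> K" "y = nm z" "walk (set B) r0 q z" by blast
      from step.hyps(2) obtain u v where uv: "{y, y'} = {nm u, nm v}" "u \<in> K" "v \<in> K" "u < v"
        using EK by blast
      have "(u, v) \<in> set Q" using uv step.hyps(2) by (simp add: Q)
      then have "set (P u v) \<subseteq> set B" by (force simp: B_def set_both_ways F_eq)
      then have W: "walk (set B) u (P u v) v"
        using walk_mono[OF walk_own_arcs[OF walk_P]] uv by blast
      from uv(1) z(2) consider "nm z = nm u" "y' = nm v" | "nm z = nm v" "y' = nm u"
        by (auto simp: doubleton_eq_iff)
      then show ?case
      proof cases
        case 1
        then have "z = u" using name_inj z(1) uv(2) by blast
        with W z(3) walk_append 1 uv(3) show ?thesis by blast
      next
        case 2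
        then have "z = v" using name_inj z(1) uv(3) by blast
        with walk_reverse[OF flipB W] z(3) walk_append 2 uv(2) show ?thesis by blast
      qed
    qed
    then show ?thesis using name_inj that terms_K by blast
  qed
  have "subgraph ?T (inst_graph I)"
    unfolding subgraph_def
  proof (intro conjI)
    show "simple_graph ?T" using tree(2) edges' edge_valid(2) by (auto simp: simple_graph_def)
  qed (use vertices edges' fst_inst_graph in auto)
  moreover have "R \<subseteq> fst ?T"
  proof
    fix y assume "y \<in> R"
    then obtain q where "walk (set B) r0 q y" using reachable by blast
    from grow_complete[OF tgtB rV this] show "y \<in> fst ?T" by (simp add: tbl_def)
  qed
  ultimately show "is_steiner_tree (inst_graph I) R (sol_graph (lifted s (I, ks) t))"
    using tree(1) unfolding sol is_steiner_tree_def by blast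
  have "sum w (snd ?T) \<le> sum_list (map (\<lambda>c. w {src c, tgt c}) F)"
    by (rule sum_edge_set_le[OF edges])
  also have "\<dots> = path_len F"
    unfolding path_len_def by (intro arg_cong[of _ _ sum_list] map_cong refl) (use FA in_arcs_iff in auto)
  also have "\<dots> = (\<Sum>e\<in>set Q. d (fst e) (snd e))"
    using distinct_ordered_pairs[OF distinct_kv]
    by (simp add: F_eq path_len_concat comp_def distance_def Q_def sum_list_distinct_conv_sum_set)
  finally have "M * sum w (snd ?T) \<le> (\<Sum>e\<in>set Q. M * d (fst e) (snd e))"
    by (simp add: sum_distrib_left[symmetric])
  also have "\<dots> \<le> (\<Sum>e\<in>set Q. tot * Suc (\<omega> (fst e) (snd e)))"
    using Q by (intro sum_mono scaled_lower) auto
  also have "\<dots> = tot * ((\<Sum>e\<in>set Q. \<omega> (fst e) (snd e)) + card (set Q))"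
    by (simp only: sum_distrib_left[symmetric] sum_Suc)
  also have "(\<Sum>e\<in>set Q. \<omega> (fst e) (snd e)) = sum (inst_weight KI) E"
  proof -
    have "E = (\<lambda>e. {nm (fst e), nm (snd e)}) ` set Q"
    proof
      show "E \<subseteq> (\<lambda>e. {nm (fst e), nm (snd e)}) ` set Q"
      proof
        fix e assume e: "e \<in> E"
        then obtain u v where "e = {nm u, nm v}" "u \<in> K" "v \<in> K" "u < v" using EK by blast
        with e show "e \<in> (\<lambda>e. {nm (fst e), nm (snd e)}) ` set Q"
          by (intro image_eqI[of _ _ "(u, v)"]) (simp_all add: Q)
      qed
    qed (use Q in auto)
    moreover have "inj_on (\<lambda>e. {nm (fst e), nm (snd e)}) (set Q)"
      by (rule inj_on_subset[OF name_edge_inj]) (auto simp: Q_def)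
    ultimately have "sum (inst_weight KI) E = (\<Sum>e\<in>set Q. inst_weight KI {nm (fst e), nm (snd e)})"
      by (simp only: sum.reindex comp_def)
    also have "\<dots> = (\<Sum>e\<in>set Q. \<omega> (fst e) (snd e))"
      using Q by (intro sum.cong refl inst_weight_kernel) auto
    finally show ?thesis by simp
  qed
  also have "card (set Q) \<le> length kv * length kv"
    by (rule order_trans[OF card_length], rule order_trans[OF _ length_ordered_pairs_le])
      (simp add: Q_def)
  finally show "M * sum w (snd (sol_graph (lifted s (I, ks) t)))
      \<le> tot * (sum (inst_weight KI) (snd (sol_graph t)) + length kv * length kv)"
    unfolding sol E_def by simp
qed

text \<open>Of the factor \<open>s + 3\<close>, the part \<open>s + 2\<close> comes from cutting and
  the last unit from rounding. All inequalities are multiplied by \<open>s\<close> and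
  \<open>M\<close> to avoid divisions.\<close>

lemma lifting_ratio:
  assumes T: "is_steiner_tree (inst_graph I) R T"
    and t: "is_steiner_tree (inst_graph KI) (nm ` R) (sol_graph t)"
    and opt: "\<And>T'. is_steiner_tree (inst_graph KI) (nm ` R) T' \<Longrightarrow> m \<le> sum (inst_weight KI) (snd T')"
    and \<rho>: "1 \<le> \<rho>" "real (sum (inst_weight KI) (snd (sol_graph t))) \<le> \<rho> * real m"
  shows "real s * real (sum w (snd (sol_graph (lifted s (I, ks) t)))) \<le> \<rho> * (real s + 3) * real (sum w (snd T))"
proof -
  define L where "L = real (sum w (snd (sol_graph (lifted s (I, ks) t))))"
  define W where "W = real (sum w (snd T))"
  define N where "N = real (length kv)"
  obtain c where c: "con R c" "s * c \<le> (s + 2) * sum w (snd T)"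
    using near_optimal_connection[OF T] by blast
  from kernel_tree[OF c(1)] opt have "tot * m \<le> M * c" by (meson mult_le_mono2 order_trans)
  then have 1: "real tot * real m \<le> real M * real c" by (metis of_nat_le_iff of_nat_mult)
  from c(2) have 2: "real s * real c \<le> (real s + 2) * W"
    unfolding W_def by (metis of_nat_add of_nat_le_iff of_nat_mult of_nat_numeral)
  from lifted_tree(2)[OF t] have "real (M * sum w (snd (sol_graph (lifted s (I, ks) t))))
      \<le> real (tot * (sum (inst_weight KI) (snd (sol_graph t)) + length kv * length kv))"
    by (rule of_nat_mono)
  then have "real M * L \<le> real tot * (real (sum (inst_weight KI) (snd (sol_graph t))) + N * N)"
    by (simp add: L_def N_def)
  also have "\<dots> \<le> real tot * (\<rho> * real m + N * N)" using \<rho>(2) by (intro mult_left_mono add_right_mono) auto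
  finally have 3: "real M * L \<le> real tot * (\<rho> * real m + N * N)" .
  from total_le[OF T] have 4: "real tot \<le> real (length (terms (I, ks))) * W"
    unfolding W_def by (metis of_nat_le_iff of_nat_mult)
  have M: "real M = N * N * real (length (terms (I, ks))) * real s" by (simp add: M_eq N_def)
  have pos: "0 < real M"
  proof -
    have "kv \<noteq> []" using root_in_terms terms_K by force
    then show ?thesis using s terms_nonempty by (simp add: M_eq)
  qed
  have "real M * (real s * L) \<le> real s * (\<rho> * (real tot * real m) + real tot * (N * N))"
    using mult_left_mono[OF 3, of "real s"] by (simp add: algebra_simps)
  also have "\<dots> \<le> real s * (\<rho> * (real M * real c) + (real (length (terms (I, ks))) * W) * (N * N))"
    using 1 4 \<rho>(1) by (intro mult_left_mono add_mono mult_right_mono) (auto simp: N_def)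
  \<comment> \<open>\<open>M\<close> was chosen as the product of \<open>N * N\<close>, the number
    of terminals and \<open>s\<close>, so the rounding error shrinks to a single
    \<open>W\<close>.\<close>
  also have "\<dots> = \<rho> * real M * (real s * real c) + real M * W" by (simp add: M algebra_simps)
  also have "\<dots> \<le> \<rho> * real M * ((real s + 2) * W) + \<rho> * (real M * W)"
  proof (intro add_mono mult_left_mono 2)
    have "1 * (real M * W) \<le> \<rho> * (real M * W)" using \<rho>(1) by (intro mult_right_mono) (auto simp: W_def simp del: of_nat_sum)
    then show "real M * W \<le> \<rho> * (real M * W)" by simp
  qed (use \<rho>(1) in auto)
  also have "\<dots> = real M * (\<rho> * (real s + 3) * W)" by (simp add: algebra_simps)
  finally have "real s * L \<le> \<rho> * (real s + 3) * W" using pos by simp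
  then show ?thesis by (simp add: L_def W_def)
qed

end


section \<open>The size of the kernel\<close>

lemma length_best: "length (snd (best j x v t)) < 2 ^ j"
proof (induction j arbitrary: v t)
  case (Suc j)
  define f where "f u = (let p = best j x u (left t); q = best j x u (right t) in
    (distance (fst x) v u + fst p + fst q, u # snd p @ snd q))" for u
  show ?case
  proof (cases "select_min fst (map f (component x))")
    case (Cons y ys)
    then have "y \<in> f ` set (component x)" using set_select_min[of fst "map f (component x)"] by auto
    then obtain u where u: "y = f u" by blast
    have "length (snd (f u)) < 2 ^ Suc j"
      using Suc.IH[of u "left t"] Suc.IH[of u "right t"] by (simp add: f_def Let_def)
    with Cons u show ?thesis by (simp add: f_def[abs_def])
  qed (simp add: f_def[abs_def])
qed simp

lemma length_shapes: "length (shapes j x) = length (terms x) ^ (2 ^ j)"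
  by (induction j) (simp_all add: length_concat comp_def sum_list_triv power_add[symmetric] mult_2)

lemma length_kverts_le:
  "length (kverts s x) \<le> length (terms x) + length (terms x) * (length (terms x) ^ (2 ^ s) * 2 ^ s)"
proof -
  have "sum_list (map (\<lambda>t. length (snd (best s x r t))) (shapes s x)) \<le> length (shapes s x) * 2 ^ s" for r
    using sum_list_mono[of "shapes s x" "\<lambda>t. length (snd (best s x r t))" "\<lambda>_. 2 ^ s"] length_best
    by (simp add: sum_list_triv less_imp_le)
  from sum_list_mono[of "terms x", OF this]
  have "length (concat (map (\<lambda>r. concat (map (\<lambda>t. snd (best s x r t)) (shapes s x))) (terms x)))
      \<le> length (terms x) * (length (shapes s x) * 2 ^ s)"
    by (simp add: length_concat comp_def sum_list_triv)
  then show ?thesis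
    unfolding kverts_def by (intro order_trans[OF length_dedup_le]) (simp add: length_shapes)
qed

lemma scaled_le: "scaled s x e \<le> length (cap s x)"
  unfolding scaled_def using count_multiples by blast

lemma length_cap: "length (cap s x) =
    (2 + 4 * 2 ^ s) * (length (kverts s x) * (length (kverts s x) * (length (terms x) * s)))"
proof -
  have "length (concat (map (\<lambda>_. scale s x) (replicate n Leaf))) = n * length (scale s x)" for n
    by (induction n) auto
  moreover have "length (scale s x) = length (kverts s x) * (length (kverts s x) * (length (terms x) * s))"
    by (simp add: scale_def length_concat comp_def sum_list_triv)
  ultimately show ?thesis by (simp only: cap_def)
qed

lemma size_name_le: "size (enc (name s x v)) \<le> 2 * length (kverts s x)"
  by (rule order_trans[OF size_enc_nat_le_double]) (simp add: name_def)

lemma size_kernel_le: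
  fixes s x
  defines "n \<equiv> length (kverts s x)" and "l \<equiv> length (terms x)"
  shows "size (enc (kernel s x)) \<le> 2 + n * Suc (2 * n) + l * Suc (2 * n) +
    n * n * Suc (2 + 2 * n + 2 * n + 2 * ((2 + 4 * 2 ^ s) * (n * (n * (l * s)))))"
proof -
  let ?S = "2 + 2 * n + 2 * n + 2 * ((2 + 4 * 2 ^ s) * (n * (n * (l * s))))"
  have names: "size (enc (map (name s x) vs)) \<le> length vs * Suc (2 * n)" for vs
    using size_enc_list_le[of "map (name s x) vs" "2 * n"] size_name_le[of s x] by (auto simp: n_def)
  have edges: "size (enc (kedges s x)) \<le> n * n * Suc ?S"
  proof (rule order_trans[OF size_enc_list_le[of _ ?S] mult_le_mono1])
    fix e assume "e \<in> set (kedges s x)"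
    then obtain u v c where e: "e = ((name s x u, name s x v), scaled s x c)" by (auto simp: kedges_eq)
    have "size (enc (scaled s x c)) \<le> 2 * ((2 + 4 * 2 ^ s) * (n * (n * (l * s))))"
      by (rule order_trans[OF size_enc_nat_le_double])
        (use scaled_le[of s x c] in \<open>simp add: length_cap n_def l_def\<close>)
    with size_name_le[of s x u] size_name_le[of s x v] show "size (enc e) \<le> ?S"
      by (simp add: e n_def)
  next
    show "length (kedges s x) \<le> n * n" by (simp add: kedges_eq n_def length_ordered_pairs_le)
  qed
  show ?thesis
    using names[of "kverts s x"] names[of "terms x"] edges by (simp add: kernel_def n_def l_def)
qed

lemma size_kernel_poly:
  "\<exists>q :: nat poly. \<forall>I ks. size (enc (kernel s (I, ks))) + Suc (length ks) \<le> poly q (length ks)"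
proof -
  \<comment> \<open>\<open>pl\<close>, \<open>pn\<close> and \<open>pS\<close> bound the number of
    terminals, the number of vertices and the size of one edge with its list node. The degrees
    depend on \<open>s\<close> only.\<close>
  define pl :: "nat poly" where "pl = [:1, 1:]"
  define pn :: "nat poly" where "pn = pl + pl * (pl ^ (2 ^ s) * [:2 ^ s:])"
  define pS :: "nat poly" where "pS = [:3:] + [:2:] * pn + [:2:] * pn +
    [:2:] * ([:2 + 4 * 2 ^ s:] * (pn * (pn * (pl * [:s:]))))"
  define q where "q = [:2:] + pn * ([:1:] + [:2:] * pn) + pl * ([:1:] + [:2:] * pn) + pn * pn * pS + pl"
  have "size (enc (kernel s (I, ks))) + Suc (length ks) \<le> poly q (length ks)" for I ks
  proof -
    define l where "l = length (terms (I, ks))"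
    define n where "n = length (kverts s (I, ks))"
    define L where "L = poly pl (length ks)"
    define N where "N = poly pn (length ks)"
    have lL: "l \<le> L" using length_terms_le[of I ks] by (simp add: l_def L_def pl_def)
    have "n \<le> l + l * (l ^ (2 ^ s) * 2 ^ s)" using length_kverts_le[of s "(I, ks)"] by (simp add: n_def l_def)
    also have "\<dots> \<le> L + L * (L ^ (2 ^ s) * 2 ^ s)"
      by (intro add_mono mult_le_mono power_mono lL order_refl) auto
    also have "\<dots> = N" by (simp add: N_def pn_def L_def)
    finally have nN: "n \<le> N" .
    have "size (enc (kernel s (I, ks))) \<le> 2 + n * Suc (2 * n) + l * Suc (2 * n) +
        n * n * Suc (2 + 2 * n + 2 * n + 2 * ((2 + 4 * 2 ^ s) * (n * (n * (l * s)))))"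
      unfolding n_def l_def by (rule size_kernel_le)
    also have "\<dots> \<le> 2 + N * Suc (2 * N) + L * Suc (2 * N) +
        N * N * Suc (2 + 2 * N + 2 * N + 2 * ((2 + 4 * 2 ^ s) * (N * (N * (L * s)))))"
      by (intro add_mono mult_le_mono Suc_le_mono[THEN iffD2] nN lL order_refl)
    finally have "size (enc (kernel s (I, ks))) + Suc (length ks) \<le> 2 + N * Suc (2 * N) + L * Suc (2 * N) +
        N * N * Suc (2 + 2 * N + 2 * N + 2 * ((2 + 4 * 2 ^ s) * (N * (N * (L * s))))) + Suc (length ks)"
      by simp
    also have "\<dots> = poly q (length ks)"
    proof -
      have "poly pS (length ks) = Suc (2 + 2 * N + 2 * N + 2 * ((2 + 4 * 2 ^ s) * (N * (N * (L * s)))))"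
        unfolding pS_def poly_add poly_mult N_def[symmetric] L_def[symmetric] by simp
      moreover have "Suc (length ks) = L" by (simp add: L_def pl_def)
      ultimately show ?thesis
        unfolding q_def poly_add poly_mult N_def[symmetric] L_def[symmetric] by simp
    qed
    finally show ?thesis .
  qed
  then show ?thesis by blast
qed


section \<open>The approximation ratio\<close>

lemma val_steiner:
  assumes "valid_inst J" "card (inst_terminals J) \<le> k"
  shows "val steiner_tree_problem (J, k) t =
    (if is_steiner_tree (inst_graph J) (inst_terminals J) (sol_graph t)
     then ereal (real (sum (inst_weight J) (snd (sol_graph t)))) else \<infinity>)"
  using assms by (simp add: val_def steiner_tree_problem_def ST_def)

text \<open>As every Steiner tree has a code among the solutions, the infimum is a least natural
  number.\<close>

lemma opt_attained:
  assumes J: "valid_inst J" "card (inst_terminals J) \<le> k"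
    and T: "is_steiner_tree (inst_graph J) (inst_terminals J) T"
  obtains m t where "opt steiner_tree_problem (J, k) = ereal (real m)"
    "is_steiner_tree (inst_graph J) (inst_terminals J) (sol_graph t)"
    "m = sum (inst_weight J) (snd (sol_graph t))"
    "\<And>T'. is_steiner_tree (inst_graph J) (inst_terminals J) T' \<Longrightarrow> m \<le> sum (inst_weight J) (snd T')"
proof -
  let ?S = "\<lambda>T. is_steiner_tree (inst_graph J) (inst_terminals J) T"
  let ?W = "\<lambda>T. sum (inst_weight J) (snd T)"
  have code: "\<exists>t\<in>solutions (J, k). sol_graph t = T'" if "?S T'" for T'
    using that tree_has_code by (auto simp: is_steiner_tree_def)
  define m where "m = (LEAST m. \<exists>T. ?S T \<and> ?W T = m)"
  have "\<exists>T. ?S T \<and> ?W T = m" unfolding m_def using T by (intro LeastI[of "\<lambda>m. \<exists>T. ?S T \<and> ?W T = m" "?W T"]) blast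
  then obtain T' where T': "?S T'" "?W T' = m" by blast
  have least: "m \<le> ?W T''" if "?S T''" for T'' unfolding m_def by (rule Least_le) (use that in blast)
  obtain t where t: "t \<in> solutions (J, k)" "sol_graph t = T'" using code[OF T'(1)] by blast
  have "opt steiner_tree_problem (J, k) = ereal (real m)"
  proof (rule antisym)
    have "val steiner_tree_problem (J, k) t = ereal (real m)" using val_steiner[OF J] t T' by simp
    then show "opt steiner_tree_problem (J, k) \<le> ereal (real m)"
      unfolding opt_def using INF_lower[OF t(1), of "val steiner_tree_problem (J, k)"] by (simp only:)
    show "ereal (real m) \<le> opt steiner_tree_problem (J, k)"
      unfolding opt_def
    proof (rule INF_greatest)
      fix u
      show "ereal (real m) \<le> val steiner_tree_problem (J, k) u"
        unfolding val_steiner[OF J] using least[of "sol_graph u"] by (simp del: of_nat_sum)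
    qed
  qed
  moreover have "?S (sol_graph t)" "m = ?W (sol_graph t)" using t(2) T' by simp_all
  ultimately show ?thesis using least by (rule that)
qed

text \<open>Needed if the original instance has no Steiner tree or too many terminals: there the
  ratio is 1, and that of the kernel must not be smaller.\<close>

lemma approx_ratio_ge_1:
  assumes "t \<in> solutions x"
  shows "1 \<le> approx_ratio (val steiner_tree_problem x t) (opt steiner_tree_problem x)"
proof -
  let ?v = "val steiner_tree_problem x t" and ?m = "opt steiner_tree_problem x"
  obtain J k where x: "x = (J, k)" by fastforce
  have le: "?m \<le> ?v" unfolding opt_def by (rule INF_lower[OF assms])
  have "0 \<le> ?m \<or> ?v = -\<infinity>"
  proof (cases "valid_inst J \<and> card (inst_terminals J) > k")
    case True
    then show ?thesis by (simp add: x val_def steiner_tree_problem_def ST_def)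
  next
    case False
    then have "0 \<le> val steiner_tree_problem x u" for u
      by (auto simp: x val_def steiner_tree_problem_def ST_def simp del: of_nat_sum)
    then show ?thesis unfolding opt_def by (simp add: INF_greatest)
  qed
  then show ?thesis
  proof
    assume "0 \<le> ?m"
    with le show ?thesis by (cases ?m; cases ?v) (auto simp: approx_ratio_def)
  qed (use le in \<open>simp add: approx_ratio_def\<close>)
qed

lemma set_terms:
  assumes "card (inst_terminals I) \<le> length ks" "inst_terminals I \<noteq> {}"
  shows "set (terms (I, ks)) = inst_terminals I"
  using assms length_dedup[of "map to_nat (to_list (left (right I)))"]
  by (auto simp: terms_def Let_def inst_terminals_def to_nat_set_def dedup_Nil_iff)

lemma terms_no_terminals:
  assumes "inst_terminals I = {}"
  shows "terms (I, ks) = (case verts I of [] \<Rightarrow> [] | v # _ \<Rightarrow> [v])"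
  using assms by (simp add: terms_def Let_def inst_terminals_def to_nat_set_def dedup_Nil_iff)

lemma feasibleI:
  assumes valid: "valid_inst I" and card: "card (inst_terminals I) \<le> length ks"
    and T: "is_steiner_tree (inst_graph I) (inst_terminals I) T"
  shows "feasible I ks"
proof -
  have T': "fst T \<noteq> {}" "fst T \<subseteq> set (verts I)" "snd T \<subseteq> snd (inst_graph I)"
    "inst_terminals I \<subseteq> fst T"
    and conn: "\<And>u v. u \<in> fst T \<Longrightarrow> v \<in> fst T \<Longrightarrow> (u, v) \<in> (edge_rel (snd T))\<^sup>*"
    using T by (auto simp: is_steiner_tree_def subgraph_def is_tree_def connected_graph_def
        case_prod_beta inst_graph_def verts_def to_nat_set_def edge_rel_def)
  have "terms (I, ks) \<noteq> []"
  proof (cases "inst_terminals I = {}")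
    case True
    with T'(1,2) show ?thesis by (cases "verts I") (auto simp: terms_no_terminals)
  next
    case False
    with set_terms[OF card] show ?thesis by force
  qed
  then interpret valid_code I ks using valid by unfold_locales
  have "y \<in> U" if "y \<in> R" for y
  proof (cases "inst_terminals I = {}")
    case True
    then have "y = r0" using that by (auto simp: terms_no_terminals root_def split: list.splits)
    then show ?thesis using component_iff[of r0] by (metis walk.simps(1))
  next
    case False
    then have "(r0, y) \<in> (edge_rel (snd T))\<^sup>*"
      using set_terms[OF card] that root_in_terms T'(4) by (intro conn) auto
    then have "\<exists>q. walk A r0 q y"
    proof induction
      case base
      show ?case by (intro exI[of _ "[]"]) simp
    next
      case (step y z)
      then obtain q where "walk A r0 q y" by blast
      moreover have "(y, z, w {y, z}) \<in> A"
        using step.hyps(2) T'(3) by (auto simp: in_arcs_iff edge_rel_def)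
      ultimately have "walk A r0 ((y, z, w {y, z}) # q) z" by simp
      then show ?case by blast
    qed
    then show ?thesis by (simp add: component_iff)
  qed
  then show ?thesis by unfold_locales auto
qed

section \<open>The reduction and the lifting on the given encoding\<close>

definition code :: "data \<times> nat \<Rightarrow> instance_code" where
  "code x = (fst x, replicate (snd x) Leaf)"

definition red :: "nat \<Rightarrow> data \<times> nat \<Rightarrow> data \<times> nat" where
  "red s x = (enc (kernel s (code x)), Suc (snd x))"

definition lift :: "nat \<Rightarrow> (data \<times> nat) \<times> (data \<times> nat) \<times> data \<Rightarrow> data" where
  "lift s z = lifted s (code (fst z)) (snd (snd z))"

lemma ratio_infeasible:
  assumes "\<And>t. val steiner_tree_problem x t = c"
  shows "approx_ratio (val steiner_tree_problem x t) (opt steiner_tree_problem x) = 1"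
proof -
  have "Leaf \<in> solutions x" by (simp add: solutions_def case_prod_beta)
  then have "opt steiner_tree_problem x = c"
    unfolding opt_def by (intro INF_eq_const) (auto simp: assms)
  then show ?thesis by (simp add: assms approx_ratio_def)
qed

lemma ratio_feasible:
  assumes \<alpha>: "0 < s" "real s + 3 \<le> \<alpha> * real s"
    and valid: "valid_inst I" and card: "card (inst_terminals I) \<le> k"
    and T: "is_steiner_tree (inst_graph I) (inst_terminals I) T"
    and t: "t \<in> solutions (red s (I, k))"
  shows "approx_ratio (val steiner_tree_problem (I, k) (lifted s (code (I, k)) t)) (opt steiner_tree_problem (I, k))
    \<le> ereal \<alpha> * approx_ratio (val steiner_tree_problem (red s (I, k)) t) (opt steiner_tree_problem (red s (I, k)))"
proof -
  define ks where "ks = replicate k Leaf"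
  have code: "code (I, k) = (I, ks)" and len: "length ks = k" by (simp_all add: code_def ks_def)
  interpret kernelized I ks s
    using feasibleI[OF valid _ T, of ks] card \<alpha>(1)
    by (simp add: kernelized_def kernelized_axioms_def len)
  have red: "red s (I, k) = (KI, Suc k)" by (simp add: red_def code)
  have "\<alpha> > 0"
  proof (rule ccontr)
    assume "\<not> 0 < \<alpha>"
    then have "\<alpha> * real s \<le> 0" by (intro mult_nonpos_nonneg) auto
    with \<alpha>(2) show False by linarith
  qed
  obtain W t0 where W: "opt steiner_tree_problem (I, k) = ereal (real W)"
    "is_steiner_tree (inst_graph I) (inst_terminals I) (sol_graph t0)"
    "W = sum w (snd (sol_graph t0))"
    "\<And>T'. is_steiner_tree (inst_graph I) (inst_terminals I) T' \<Longrightarrow> W \<le> sum w (snd T')"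
    using opt_attained[OF valid card T] by blast
  \<comment> \<open>\<open>R\<close> differs from the terminals of \<open>I\<close> only if there
    are none; then a single vertex of cost 0 is a Steiner tree for \<open>R\<close>.\<close>
  obtain T1 where T1: "is_steiner_tree (inst_graph I) R T1" "sum w (snd T1) \<le> W"
  proof (cases "inst_terminals I = {}")
    case True
    then have "R = {r0}"
      using terms_nonempty by (auto simp: terms_no_terminals root_def split: list.splits)
    then have "is_steiner_tree (inst_graph I) R ({r0}, {})"
      using root_in_terms terms_verts
      by (auto simp: is_steiner_tree_def subgraph_def simple_graph_def is_tree_single fst_inst_graph)
    from that[OF this] show ?thesis by simp
  next
    case False
    with set_terms[of I ks] card that[of "sol_graph t0"] W(2,3) show ?thesis by (simp add: len)
  qed
  have terminals: "inst_terminals I \<subseteq> R"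
    using set_terms[of I ks] card by (cases "inst_terminals I = {}") (simp_all add: len)
  have cardK: "card (inst_terminals KI) \<le> Suc k" using card_terminals_kernel by (simp add: len)
  obtain c where "con R c" using near_optimal_connection[OF T1(1)] by blast
  from kernel_tree[OF this] obtain T2 where "is_steiner_tree (inst_graph KI) (inst_terminals KI) T2"
    unfolding inst_terminals_kernel by blast
  from opt_attained[OF valid_kernel cardK this] obtain m where
    m: "opt steiner_tree_problem (KI, Suc k) = ereal (real m)"
    "\<And>T'. is_steiner_tree (inst_graph KI) (nm ` R) T' \<Longrightarrow> m \<le> sum (inst_weight KI) (snd T')"
    unfolding inst_terminals_kernel by blast
  note valK = val_steiner[OF valid_kernel cardK, of t, unfolded inst_terminals_kernel]
  show ?thesis
  proof (cases "is_steiner_tree (inst_graph KI) (nm ` R) (sol_graph t)")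
    case False
    \<comment> \<open>An infeasible solution against a finite optimum has ratio
      \<open>\<infinity>\<close>, so nothing is demanded of the lifted one.\<close>
    then have "approx_ratio (val steiner_tree_problem (KI, Suc k) t) (opt steiner_tree_problem (KI, Suc k)) = \<infinity>"
      unfolding valK m by (cases "m = 0") (auto simp: approx_ratio_def)
    then show ?thesis using \<open>\<alpha> > 0\<close> by (simp add: red)
  next
    case True
    define W' where "W' = sum (inst_weight KI) (snd (sol_graph t))"
    define L where "L = sum w (snd (sol_graph (lifted s (I, ks) t)))"
    have valK': "val steiner_tree_problem (KI, Suc k) t = ereal (real W')"
      using valK True by (simp add: W'_def)
    have "is_steiner_tree (inst_graph I) (inst_terminals I) (sol_graph (lifted s (I, ks) t))"
      using lifted_tree(1)[OF True] terminals by (auto simp: is_steiner_tree_def)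
    then have val: "val steiner_tree_problem (I, k) (lifted s (I, ks) t) = ereal (real L)"
      and WL: "W \<le> L"
      using val_steiner[OF valid card] W(4) by (simp_all add: L_def)
    have mW': "m \<le> W'" using m(2)[OF True] by (simp add: W'_def)
    show ?thesis
    proof (cases "m = 0 \<and> W' \<noteq> 0")
      case True
      then have "approx_ratio (val steiner_tree_problem (KI, Suc k) t) (opt steiner_tree_problem (KI, Suc k)) = \<infinity>"
        unfolding valK' m by (auto simp: approx_ratio_def)
      then show ?thesis using \<open>\<alpha> > 0\<close> by (simp add: red)
    next
      case False
      \<comment> \<open>For \<open>W' = m = 0\<close> the quotient would have the default value 0,
        whereas the ratio is 1.\<close>
      define \<rho> where "\<rho> = (if W' = m then 1 else real W' / real m)"
      have \<rho>: "1 \<le> \<rho>" "real W' \<le> \<rho> * real m"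
        using False mW' by (auto simp: \<rho>_def field_simps)
      have ratio': "approx_ratio (val steiner_tree_problem (KI, Suc k) t) (opt steiner_tree_problem (KI, Suc k)) = ereal \<rho>"
        unfolding valK' m using False mW' by (auto simp: approx_ratio_def \<rho>_def one_ereal_def)
      have "real s * real L \<le> \<rho> * (real s + 3) * real (sum w (snd T1))"
        unfolding L_def by (rule lifting_ratio[OF T1(1) True m(2) \<rho>(1)]) (use \<rho>(2) in \<open>simp_all add: W'_def\<close>)
      also have "\<dots> \<le> \<rho> * (\<alpha> * real s) * real W"
        using \<alpha>(2) T1(2) \<rho>(1) \<open>\<alpha> > 0\<close>
        by (intro mult_mono mult_left_mono) (auto simp del: of_nat_sum)
      finally have "real s * real L \<le> real s * (\<alpha> * \<rho> * real W)" by (simp add: ac_simps)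
      then have L: "real L \<le> \<alpha> * \<rho> * real W" using \<alpha>(1) by simp
      have "1 \<le> \<alpha>"
      proof -
        have "real s * 1 \<le> real s * \<alpha>" using \<alpha>(2) by (simp add: mult.commute)
        then show ?thesis using \<alpha>(1) by simp
      qed
      then have "1 \<le> \<alpha> * \<rho>" using \<rho>(1) mult_mono[of 1 \<alpha> 1 \<rho>] by simp
      moreover have "real L / real W \<le> \<alpha> * \<rho>" if "L \<noteq> W"
      proof -
        \<comment> \<open>If the optimum is 0, the bound \<open>L\<close> forces the lifted solution
          to be optimal as well.\<close>
        have "0 < real W" using L WL that by (cases "W = 0") auto
        then show ?thesis using L by (simp add: pos_divide_le_eq)
      qed
      ultimately have "approx_ratio (ereal (real L)) (ereal (real W)) \<le> ereal (\<alpha> * \<rho>)"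
        using WL L by (cases "W = 0") (auto simp: approx_ratio_def one_ereal_def)
      then show ?thesis by (simp add: red ratio' W(1) val code)
    qed
  qed
qed

lemma enc_code: "enc (code x) = enc_inst x"
proof -
  have "enc (replicate k Leaf) = unary k" for k by (induction k) auto
  then show ?thesis by (simp add: code_def enc_inst_def case_prod_beta)
qed

lemma poly_time_onI:
  assumes "polytime f" "\<And>a. a \<in> A \<Longrightarrow> ea a = enc (h a)" "\<And>a. a \<in> A \<Longrightarrow> eb (F a) = enc (f (h a))"
  shows "poly_time_on ea eb A F"
proof -
  obtain Q g where g: "poly_bounded g" "\<And>x. \<exists>t\<le>g x. exec Q (enc x) t (enc (f x))"
    using assms(1) by (rule polytimeE) blast
  from g(1) obtain q :: "nat poly" where "\<And>x. g x \<le> poly q (size (enc x))" unfolding poly_bounded_def by blast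
  with g(2) have "\<exists>t\<le>poly q (size (ea a)). exec Q (ea a) t (eb (F a))" if "a \<in> A" for a
    using assms(2,3)[OF that] by (metis order_trans)
  then show ?thesis unfolding poly_time_on_def by blast
qed

lemma red_poly_time: "poly_time_on enc_inst enc_inst UNIV (red s)"
proof (rule poly_time_onI[where h = code])
  \<comment> \<open>One more \<open>Leaf\<close> in the list raises the unary parameter by
    one.\<close>
  show "polytime (\<lambda>c :: instance_code. (enc (kernel s c), Leaf # snd c))" by (intro polytime_intros)
  fix x
  show "enc_inst (red s x) = enc (enc (kernel s (code x)), Leaf # snd (code x))"
    unfolding red_def enc_code[symmetric] by (simp add: code_def)
qed (simp add: enc_code)

lemma lift_poly_time: "poly_time_on enc_lift (\<lambda>s. s) A (lift s)"
proof (rule poly_time_onI[where h = "\<lambda>z. (code (fst z), code (fst (snd z)), snd (snd z))"])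
  show "polytime (\<lambda>z :: instance_code \<times> instance_code \<times> data. lifted s (fst z) (snd (snd z)))"
    by (intro polytime_intros)
qed (auto simp: enc_lift_def enc_code lift_def)

theorem theorem6p3: "admits_PSAKS steiner_tree_problem"
  unfolding admits_PSAKS_def
proof (intro allI impI)
  fix \<alpha> :: real assume \<alpha>: "1 < \<alpha>"
  \<comment> \<open>This is \<open>1 + 3 / s < \<alpha>\<close> solved for \<open>s\<close>.\<close>
  obtain s :: nat where "3 / (\<alpha> - 1) < real s" using reals_Archimedean2 by blast
  moreover have "0 < 3 / (\<alpha> - 1)" using \<alpha> by simp
  ultimately have "0 < real s" "3 / (\<alpha> - 1) < real s" by linarith+
  then have s: "0 < s" "real s + 3 \<le> \<alpha> * real s" using \<alpha> by (simp_all add: field_simps)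
  have ratio: "approx_ratio (val steiner_tree_problem x (lift s (x, red s x, t))) (opt steiner_tree_problem x)
      \<le> ereal \<alpha> * approx_ratio (val steiner_tree_problem (red s x) t) (opt steiner_tree_problem (red s x))"
    if t: "t \<in> solutions (red s x)" for x t
  proof -
    obtain I k where x: "x = (I, k)" by fastforce
    let ?feasible = "\<exists>T. is_steiner_tree (inst_graph I) (inst_terminals I) T"
    show ?thesis
    proof (cases "valid_inst I \<and> card (inst_terminals I) \<le> k \<and> ?feasible")
      case True
      then obtain T where "valid_inst I" "card (inst_terminals I) \<le> k"
        "is_steiner_tree (inst_graph I) (inst_terminals I) T" by blast
      from ratio_feasible[OF s this, of t] t show ?thesis by (simp add: x lift_def)
    next
      case False
      \<comment> \<open>In each way of failing the value is the same for all words, so whatever the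
        lifting returns is optimal.\<close>
      then have "val steiner_tree_problem x u = (if valid_inst I \<and> k < card (inst_terminals I) then -\<infinity> else \<infinity>)" for u
        by (auto simp: x val_def steiner_tree_problem_def ST_def simp del: split_paired_Ex split_paired_All)
      from ratio_infeasible[OF this]
      have "approx_ratio (val steiner_tree_problem x (lift s (x, red s x, t))) (opt steiner_tree_problem x) = 1" .
      also have "1 \<le> ereal \<alpha> * 1" using \<alpha> by (simp add: one_ereal_def)
      also have "\<dots> \<le> ereal \<alpha> * approx_ratio (val steiner_tree_problem (red s x) t) (opt steiner_tree_problem (red s x))"
        using approx_ratio_ge_1[OF t] \<alpha> by (intro ereal_mult_left_mono) auto
      finally show ?thesis .
    qed
  qed
  have small: "lift s (x, red s x, t) \<in> solutions x" for x t
    using size_encode_tree[of "fst x"]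
    by (auto simp: solutions_def lift_def lifted_def Let_def code_def case_prod_beta intro: trans_le_add1)
  have "approx_preprocessing \<alpha> steiner_tree_problem (red s) (lift s)"
    unfolding approx_preprocessing_def
    by (intro conjI allI ballI red_poly_time lift_poly_time ratio small)
  moreover obtain q :: "nat poly" where
    q: "\<forall>I ks. size (enc (kernel s (I, ks))) + Suc (length ks) \<le> poly q (length ks)"
    using size_kernel_poly[of s] by (elim exE)
  have "size (fst (red s (I, k))) + snd (red s (I, k)) \<le> poly q k" for I k
    using q[rule_format, of I "replicate k Leaf"] by (simp add: red_def code_def)
  ultimately show "has_poly_approx_kernel \<alpha> steiner_tree_problem"
    unfolding has_poly_approx_kernel_def
    by (intro exI conjI allI)
qed


end
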